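(* Let $A\subseteq\mathbf R^{n+1}$ be a closed set with $\mathrm{reach}(A)>0$. Let $(a,\eta)\in\widetilde N^\phi_n(A)$, $u\in N(A,a)$ with $\nabla\phi(u)=\eta$, and $\nu\in\mathbf S^n\setminus u^\perp$. Then: (a) there exist $\epsilon(\nu)>0$ and a function $f_\nu:U_{\epsilon(\nu)}(a,\nu)\to\mathbf R$ which is differentiable at $a$ and satisfies $\{b+f_\nu(b)\nu:b\in U_{\epsilon(\nu)}(a,\nu)\}\subseteq\partial A$; (b) for $\nu=u$ (with $f_u$ as in (a)) there exists a map $\tilde\eta:U_{\epsilon(u)}(a,u)\to\partial\mathcal W^\phi$ with $\tilde\eta(b)\in N^\phi(A,b+f_u(b)u)$ for every $b$, $\tilde\eta(a)=\eta$, $\tilde\eta$ differentiable at $a$, and the eigenvalues $\lambda_1\le\dots\le\lambda_n$ of $D\tilde\eta(a)$ satisfy $\lambda_i=\kappa^\phi_{A,i}(a,\eta)$ for $i=1,\dots,n$. Moreover, $\mathbf p(\widetilde N^\phi_n(A))\cap\mathbf p(\widetilde N^\phi(A)\setminus\widetilde N^\phi_n(A))=\varnothing$, where $\mathbf p(a,\eta)=a$.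
   Context: Notation. $n\ge1$; $\mathbf{R}^{n+1}$ with Euclidean inner product $\bullet$, norm $|\cdot|$, unit sphere $\mathbf S^n$; $\mathcal L^{n+1}$ Lebesgue measure. For $a\in\mathbf R^{n+1}$, $\nu\in\mathbf S^n$, $\varepsilon>0$: $U_\varepsilon(a,\nu)=\{x\in a+\nu^\perp:|x-a|<\varepsilon\}$. $\phi$ is a norm on $\mathbf R^{n+1}$ of class $C^2$ on $\mathbf R^{n+1}\setminus\{0\}$, uniformly convex (there is $\gamma>0$ with $u\mapsto\phi(u)-\gamma|u|$ convex). $\phi^*(u)=\sup\{v\bullet u:\phi(v)=1\}$; $\mathcal W^\phi=\{x:\phi^*(x)\le1\}$; $\mathbf n^\phi:\partial\mathcal W^\phi\to\mathbf S^n$ its Euclidean exterior unit normal. For nonempty closed $A$: $\delta^\phi_A(x)=\min\{\phi^*(x-c):c\in A\}$; $\xi^\phi_A(x)=\{c\in A:\phi^*(x-c)=\delta^\phi_A(x)\}$; for $x\notin A$, $\nu^\phi_A(x)=\{\delta^\phi_A(x)^{-1}(x-c):c\in\xi^\phi_A(x)\}$. $\nu^\phi_A$ is differentiable at $x\notin A$ if $\nu^\phi_A(x)$ is a singleton and there is linear $L$ such that for every $\varepsilon>0$ there is $\delta>0$ with $|w-\nu^\phi_A(x)-L(y-x)|\le\varepsilon|y-x|$ for $y\notin A$, $|y-x|<\delta$, $w\in\nu^\phi_A(y)$; $D\nu^\phi_A(x)=L$; $\mathrm{dmn}D\nu^\phi_A$ the set of such $x$. $N^\phi(A)=\{(a,\eta)\in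 A\times\partial\mathcal W^\phi:\delta^\phi_A(a+r\eta)=r$ for some $r>0\}$, $N^\phi(A,a)$ its fibre; $\mathbf r^\phi_A(a,\eta)=\sup\{s>0:\delta^\phi_A(a+s\eta)=s\}$. For $x\notin A$, $a\in\xi^\phi_A(x)$: $\rho^\phi_A(x)=\sup\{s\ge0:\delta^\phi_A(a+s(x-a))=s\delta^\phi_A(x)\}$. $\underline{\mathbf r}^\phi_A(a,\eta)$ is the supremum of $\{0\}$ and all $\sigma r$ with $\sigma>1$, $0<r<\mathbf r^\phi_A(a,\eta)$, such that $\{x\notin A:\rho^\phi_A(x)\ge\sigma\}$ has Lebesgue density $1$ at $a+r\eta$. For $x\in\mathrm{dmn}D\nu^\phi_A$, $D\nu^\phi_A(x)$ maps $\mathbf n^\phi(\nu^\phi_A(x))^\perp$ into itself with real eigenvalues $\chi^\phi_{A,1}(x)\le\dots\le\chi^\phi_{A,n}(x)$. $\widetilde N^\phi(A)$: $(a,\eta)\in N^\phi(A)$ with $a+r\eta\in\mathrm{dmn}D\nu^\phi_A$ for some (then all) $r\in(0,\underline{\mathbf r}^\phi_A(a,\eta))$; $\kappa^\phi_{A,i}(a,\eta)=\chi^\phi_{A,i}(a+r\eta)/(1-r\chi^\phi_{A,i}(a+r\eta))\in(-\infty,+\infty]$ (independent of $r$). $\widetilde N^\phi_n(A)$ is the set of $(a,\eta)\in\widetilde N^\phi(A)$ with all $\kappa^\phi_{A,i}(a,\eta)$ finite. Without superscript everything refers to the Euclidean norm: $N(A,a)\subseteq\mathbf S^n$ is the fibre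 of the Euclidean unit normal bundle; $\mathrm{reach}(A)$ is the supremum of $\rho\ge0$ such that every point at Euclidean distance $<\rho$ from $A$ has a unique nearest point in $A$. *)

theory Defs
  imports "HOL-Analysis.Analysis"
begin

text \<open>Ambient space R^(n+1) is a Euclidean space type 'a with DIM('a) = n+1.\<close>

definition is_norm_fun :: "('a::euclidean_space \<Rightarrow> real) \<Rightarrow> bool" where
  "is_norm_fun \<phi> \<longleftrightarrow> (\<forall>x. \<phi> x = 0 \<longleftrightarrow> x = 0) \<and>
     (\<forall>c x. \<phi> (c *\<^sub>R x) = \<bar>c\<bar> * \<phi> x) \<and> (\<forall>x y. \<phi> (x + y) \<le> \<phi> x + \<phi> y)"

definition grad :: "('a::euclidean_space \<Rightarrow> real) \<Rightarrow> 'a \<Rightarrow> 'a" where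
  "grad f x = (THE g. (f has_derivative (\<lambda>v. g \<bullet> v)) (at x))"

definition C2_off_origin :: "('a::euclidean_space \<Rightarrow> real) \<Rightarrow> bool" where
  "C2_off_origin f \<longleftrightarrow> (\<exists>g :: 'a \<Rightarrow> 'a. \<exists>H :: 'a \<Rightarrow> ('a \<Rightarrow>\<^sub>L 'a).
     (\<forall>x. x \<noteq> 0 \<longrightarrow> (f has_derivative (\<lambda>v. g x \<bullet> v)) (at x)) \<and>
     (\<forall>x. x \<noteq> 0 \<longrightarrow> (g has_derivative blinfun_apply (H x)) (at x)) \<and>
     continuous_on (UNIV - {0}) H)"

definition unif_convex :: "('a::euclidean_space \<Rightarrow> real) \<Rightarrow> bool" where
  "unif_convex \<phi> \<longleftrightarrow> (\<exists>\<gamma>>0. convex_on UNIV (\<lambda>u. \<phi> u - \<gamma> * norm u))"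

definition phi_star :: "('a::euclidean_space \<Rightarrow> real) \<Rightarrow> 'a \<Rightarrow> real" where
  "phi_star \<phi> u = Sup {v \<bullet> u | v. \<phi> v = 1}"

definition Wphi :: "('a::euclidean_space \<Rightarrow> real) \<Rightarrow> 'a set" where
  "Wphi \<phi> = {x. phi_star \<phi> x \<le> 1}"

definition nphi :: "('a::euclidean_space \<Rightarrow> real) \<Rightarrow> 'a \<Rightarrow> 'a" where
  "nphi \<phi> x = (THE \<nu>. norm \<nu> = 1 \<and> (\<forall>y\<in>Wphi \<phi>. \<nu> \<bullet> (y - x) \<le> 0))"

definition U_disk :: "real \<Rightarrow> 'a::euclidean_space \<Rightarrow> 'a \<Rightarrow> 'a set" where
  "U_disk \<epsilon> a \<nu> = {x. (x - a) \<bullet> \<nu> = 0 \<and> norm (x - a) < \<epsilon>}"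

definition delta_phi :: "('a::euclidean_space \<Rightarrow> real) \<Rightarrow> 'a set \<Rightarrow> 'a \<Rightarrow> real" where
  "delta_phi \<phi> A x = Inf {phi_star \<phi> (x - c) | c. c \<in> A}"

definition xi_phi :: "('a::euclidean_space \<Rightarrow> real) \<Rightarrow> 'a set \<Rightarrow> 'a \<Rightarrow> 'a set" where
  "xi_phi \<phi> A x = {c \<in> A. phi_star \<phi> (x - c) = delta_phi \<phi> A x}"

definition nu_phi :: "('a::euclidean_space \<Rightarrow> real) \<Rightarrow> 'a set \<Rightarrow> 'a \<Rightarrow> 'a set" where
  "nu_phi \<phi> A x = {(1 / delta_phi \<phi> A x) *\<^sub>R (x - c) | c. c \<in> xi_phi \<phi> A x}"

definition nu_pt :: "('a::euclidean_space \<Rightarrow> real) \<Rightarrow> 'a set \<Rightarrow> 'a \<Rightarrow> 'a" where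
  "nu_pt \<phi> A x = (THE w. nu_phi \<phi> A x = {w})"

definition nu_diff_with :: "('a::euclidean_space \<Rightarrow> real) \<Rightarrow> 'a set \<Rightarrow> 'a \<Rightarrow> ('a \<Rightarrow> 'a) \<Rightarrow> bool" where
  "nu_diff_with \<phi> A x L \<longleftrightarrow> x \<notin> A \<and> (\<exists>w. nu_phi \<phi> A x = {w}) \<and> linear L \<and>
     (\<forall>\<epsilon>>0. \<exists>\<delta>>0. \<forall>y w. y \<notin> A \<and> norm (y - x) < \<delta> \<and> w \<in> nu_phi \<phi> A y \<longrightarrow>
        norm (w - nu_pt \<phi> A x - L (y - x)) \<le> \<epsilon> * norm (y - x))"

definition dmn_Dnu :: "('a::euclidean_space \<Rightarrow> real) \<Rightarrow> 'a set \<Rightarrow> 'a set" where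
  "dmn_Dnu \<phi> A = {x. \<exists>L. nu_diff_with \<phi> A x L}"

definition Dnu :: "('a::euclidean_space \<Rightarrow> real) \<Rightarrow> 'a set \<Rightarrow> 'a \<Rightarrow> ('a \<Rightarrow> 'a)" where
  "Dnu \<phi> A x = (THE L. nu_diff_with \<phi> A x L)"

definition Nphi :: "('a::euclidean_space \<Rightarrow> real) \<Rightarrow> 'a set \<Rightarrow> ('a \<times> 'a) set" where
  "Nphi \<phi> A = {(a, \<eta>). a \<in> A \<and> \<eta> \<in> frontier (Wphi \<phi>) \<and>
                 (\<exists>r>0. delta_phi \<phi> A (a + r *\<^sub>R \<eta>) = r)}"

definition Nphi_at :: "('a::euclidean_space \<Rightarrow> real) \<Rightarrow> 'a set \<Rightarrow> 'a \<Rightarrow> 'a set" where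
  "Nphi_at \<phi> A a = {\<eta>. (a, \<eta>) \<in> Nphi \<phi> A}"

definition rphi :: "('a::euclidean_space \<Rightarrow> real) \<Rightarrow> 'a set \<Rightarrow> 'a \<Rightarrow> 'a \<Rightarrow> ereal" where
  "rphi \<phi> A a \<eta> = Sup {ereal s | s. s > 0 \<and> delta_phi \<phi> A (a + s *\<^sub>R \<eta>) = s}"

text \<open>rho^phi_A(x), computed with some a in xi(x) (the value does not depend on the choice).\<close>
definition rho_phi :: "('a::euclidean_space \<Rightarrow> real) \<Rightarrow> 'a set \<Rightarrow> 'a \<Rightarrow> ereal" where
  "rho_phi \<phi> A x = (let a = (SOME a. a \<in> xi_phi \<phi> A x) in
     Sup {ereal s | s. s \<ge> 0 \<and> delta_phi \<phi> A (a + s *\<^sub>R (x - a)) = s * delta_phi \<phi> A x})"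

definition leb_outer :: "'a::euclidean_space set \<Rightarrow> ennreal" where
  "leb_outer S = (INF T \<in> {T. T \<in> sets lebesgue \<and> S \<subseteq> T}. emeasure lebesgue T)"

definition density_one :: "'a::euclidean_space set \<Rightarrow> 'a \<Rightarrow> bool" where
  "density_one S p \<longleftrightarrow>
     ((\<lambda>r. enn2real (leb_outer (S \<inter> ball p r)) / measure lebesgue (ball p r)) \<longlongrightarrow> 1) (at_right 0)"

definition rphi_low :: "('a::euclidean_space \<Rightarrow> real) \<Rightarrow> 'a set \<Rightarrow> 'a \<Rightarrow> 'a \<Rightarrow> ereal" where
  "rphi_low \<phi> A a \<eta> = Sup ({0} \<union> {ereal (\<sigma> * r) | \<sigma> r. \<sigma> > 1 \<and> 0 < r \<and> ereal r < rphi \<phi> A a \<eta> \<and>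
       density_one {x. x \<notin> A \<and> rho_phi \<phi> A x \<ge> ereal \<sigma>} (a + r *\<^sub>R \<eta>)})"

definition detn :: "nat \<Rightarrow> (nat \<Rightarrow> nat \<Rightarrow> real) \<Rightarrow> real" where
  "detn m M = (\<Sum>p | p permutes {..<m}. of_int (sign p) * (\<Prod>i<m. M i (p i)))"

text \<open>xs is the increasingly ordered list (with algebraic multiplicity) of the real
  eigenvalues of the linear map L restricted to the invariant subspace V:
  the characteristic polynomial of L|V w.r.t. an orthonormal basis of V splits as
  prod (xs!i - t).\<close>
definition ordered_eigs :: "('a::euclidean_space \<Rightarrow> 'a) \<Rightarrow> 'a set \<Rightarrow> real list \<Rightarrow> bool" where
  "ordered_eigs L V xs \<longleftrightarrow> sorted xs \<and> length xs = dim V \<and>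
     (\<exists>b :: 'a list. length b = dim V \<and> (\<forall>i<length b. b ! i \<in> V) \<and>
        (\<forall>i<length b. \<forall>j<length b. b ! i \<bullet> b ! j = (if i = j then 1 else 0)) \<and>
        (\<forall>t. detn (dim V) (\<lambda>i j. b ! i \<bullet> L (b ! j) - (if i = j then t else 0))
              = (\<Prod>i<dim V. xs ! i - t)))"

definition eig :: "('a::euclidean_space \<Rightarrow> 'a) \<Rightarrow> 'a set \<Rightarrow> nat \<Rightarrow> real" where
  "eig L V i = (THE xs. ordered_eigs L V xs) ! (i - 1)"

definition chi_phi :: "('a::euclidean_space \<Rightarrow> real) \<Rightarrow> 'a set \<Rightarrow> 'a \<Rightarrow> nat \<Rightarrow> real" where
  "chi_phi \<phi> A x i = eig (Dnu \<phi> A x) ({v. v \<bullet> nphi \<phi> (nu_pt \<phi> A x) = 0}) i"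

definition Ntilde :: "('a::euclidean_space \<Rightarrow> real) \<Rightarrow> 'a set \<Rightarrow> ('a \<times> 'a) set" where
  "Ntilde \<phi> A = {(a, \<eta>). (a, \<eta>) \<in> Nphi \<phi> A \<and>
      (\<exists>r. 0 < r \<and> ereal r < rphi_low \<phi> A a \<eta> \<and> a + r *\<^sub>R \<eta> \<in> dmn_Dnu \<phi> A)}"

text \<open>kappa_i(a,eta) = chi/(1 - r chi) evaluated at some admissible r (independent of r);
  value +infinity when 1 - r chi = 0.\<close>
definition kappa_phi :: "('a::euclidean_space \<Rightarrow> real) \<Rightarrow> 'a set \<Rightarrow> 'a \<Rightarrow> 'a \<Rightarrow> nat \<Rightarrow> ereal" where
  "kappa_phi \<phi> A a \<eta> i = (let r = (SOME r. 0 < r \<and> ereal r < rphi_low \<phi> A a \<eta> \<and>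
                                           a + r *\<^sub>R \<eta> \<in> dmn_Dnu \<phi> A);
                               c = chi_phi \<phi> A (a + r *\<^sub>R \<eta>) i in
       if 1 - r * c = 0 then \<infinity> else ereal (c / (1 - r * c)))"

definition Ntilde_n :: "('a::euclidean_space \<Rightarrow> real) \<Rightarrow> 'a set \<Rightarrow> ('a \<times> 'a) set" where
  "Ntilde_n \<phi> A = {(a, \<eta>). (a, \<eta>) \<in> Ntilde \<phi> A \<and>
      (\<forall>i\<in>{1..DIM('a) - 1}. kappa_phi \<phi> A a \<eta> i \<noteq> \<infinity>)}"

definition Nunit :: "'a::euclidean_space set \<Rightarrow> 'a \<Rightarrow> 'a set" where
  "Nunit A a = {u. a \<in> A \<and> norm u = 1 \<and> (\<exists>r>0. infdist (a + r *\<^sub>R u) A = r)}"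

definition reach :: "'a::euclidean_space set \<Rightarrow> ereal" where
  "reach A = Sup {ereal \<rho> | \<rho>. \<rho> \<ge> 0 \<and>
      (\<forall>x. infdist x A < \<rho> \<longrightarrow> (\<exists>!c. c \<in> A \<and> dist x c = infdist x A))}"

end

theory Submission
  imports Defs "Jordan_Normal_Form.Determinant"
begin

text \<open>
  Write F for half the squared norm and F* for half the squared dual norm. Both are uniformly convex and
  have Lipschitz gradients, and the gradient J of F* is differentiable away from 0 with symmetric positive
  derivative. Positive reach makes the Euclidean normals of A satisfy a quadratic inequality with a uniform
  constant; adding the strong monotonicity of J gives a tube around A in which the nearest point is unique
  and the normal field is Lipschitz. If the normal field is differentiable at a + r eta with derivative L,
  then I - (r - t) L is injective for 0 < t < r, and for small t the field is differentiable at a + t eta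
  with derivative L (I - (r - t) L)^(-1). There half the squared distance is C^1 with gradient J (z - proj z),
  so the derivative is self-adjoint for a positive form on the tangent space, hence diagonalisable.

  Finite curvatures mean that the derivative of the nearest point projection is onto the tangent space at
  a + t eta, so by an open mapping argument the projection covers a graph over a disk. For the last claim this
  graph leaves only the normals eta and -eta at a; an infinite curvature at -eta would make the
  projection from a - t eta stationary in a tangent direction, contradicting for small t that A contains a
  curve in that direction.
\<close>

text \<open>Squares are used because a norm is affine along its own rays: uniform convexity of
  \<open>\<phi>\<close> controls only displacements transverse to p, and squaring supplies the
  radial ones. Duality exchanges the constants: smoothness \<open>Lam\<close> of F is convexity 1 /
  \<open>Lam\<close> of F*, and convexity \<open>lam\<close> of F is smoothness 1 /
  \<open>lam\<close> of F*. The obstacle is that the normal field is known to be differentiable at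
  one point a + r eta only, possibly far from A, where nearest points need not be unique. This
  excludes the inverse function theorem, makes the graph and its normal field differentiable at a
  alone, and forces the transfer to a + t eta in the tube. Injectivity of I - (r - t) L rests on the
  calmness of nearest points at interior points of the ray, where the touching ball is strictly
  enclosed by the one at the end. It also yields r c <= 1 for the eigenvalues c of L. With r c = 1
  excluded by finiteness, c / (1 - r c) is increasing on the spectrum, so ordered eigenvalues
  correspond to ordered curvatures.\<close>

no_notation scalar_prod (infix "\<bullet>" 70)
hide_const (open) Matrix.orthogonal

section \<open>Norms and their duals\<close>

text \<open>Convexity makes \<open>\<phi>\<close> continuous, so it has positive extrema on the unit
  sphere, and homogeneity carries them everywhere. It stands outside the locale because it is
  applied both to \<open>\<phi>\<close> and to its dual norm.\<close>

lemma is_norm_fun_bounds: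
  fixes \<phi> :: "'a::euclidean_space \<Rightarrow> real"
  assumes "is_norm_fun \<phi>"
  obtains m M where "0 < m" "0 < M" "\<And>x. m * norm x \<le> \<phi> x" "\<And>x. \<phi> x \<le> M * norm x"
    "continuous_on UNIV \<phi>"
proof -
  have z: "\<And>x. \<phi> x = 0 \<longleftrightarrow> x = 0" and h: "\<And>c x. \<phi> (c *\<^sub>R x) = \<bar>c\<bar> * \<phi> x"
    and tri: "\<And>x y. \<phi> (x + y) \<le> \<phi> x + \<phi> y"
    using assms unfolding is_norm_fun_def by auto
  have "convex_on UNIV \<phi>"
  proof (rule convex_onI)
    fix t :: real and x y :: 'a assume t: "0 < t" "t < 1"
    show "\<phi> ((1 - t) *\<^sub>R x + t *\<^sub>R y) \<le> (1 - t) * \<phi> x + t * \<phi> y"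
      using tri[of "(1 - t) *\<^sub>R x" "t *\<^sub>R y"] t by (simp add: h)
  qed auto
  then have cont: "continuous_on UNIV \<phi>"
    by (rule convex_on_continuous[OF open_UNIV])
  have nn: "0 \<le> \<phi> x" for x
    using tri[of x "-x"] h[of "-1" x] z[of 0] by simp
  have ne: "sphere (0::'a) 1 \<noteq> {}" by simp
  obtain p where p: "p \<in> sphere 0 1" "\<And>y. y \<in> sphere 0 1 \<Longrightarrow> \<phi> p \<le> \<phi> y"
    using continuous_attains_inf[OF compact_sphere ne continuous_on_subset[OF cont]] by auto
  obtain q where q: "q \<in> sphere 0 1" "\<And>y. y \<in> sphere 0 1 \<Longrightarrow> \<phi> y \<le> \<phi> q"
    using continuous_attains_sup[OF compact_sphere ne continuous_on_subset[OF cont]] by auto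
  have pq: "0 < \<phi> p" "0 < \<phi> q" using nn[of p] nn[of q] z[of p] z[of q] p(1) q(1)
    by (auto simp: less_le)
  have "\<phi> p * norm x \<le> \<phi> x \<and> \<phi> x \<le> \<phi> q * norm x" for x
  proof (cases "x = 0")
    case False
    then have s: "(1 / norm x) *\<^sub>R x \<in> sphere 0 1" by simp
    have "\<phi> x = norm x * \<phi> ((1 / norm x) *\<^sub>R x)" using False by (simp add: h)
    then show ?thesis using p(2)[OF s] q(2)[OF s] False by (simp add: mult.commute h field_simps)
  qed (use z[of x] in simp)
  then show ?thesis using that pq cont by blast
qed

locale smooth_norm =
  fixes \<phi> :: "'a::euclidean_space \<Rightarrow> real"
  assumes norm_fun: "is_norm_fun \<phi>" and C2: "C2_off_origin \<phi>" and uconv: "unif_convex \<phi>"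
begin

abbreviation ps where "ps \<equiv> phi_star \<phi>"

lemma phi_zero_iff [simp]: "\<phi> x = 0 \<longleftrightarrow> x = 0"
  and phi_scale: "\<phi> (c *\<^sub>R x) = \<bar>c\<bar> * \<phi> x"
  and phi_tri: "\<phi> (x + y) \<le> \<phi> x + \<phi> y"
  using norm_fun unfolding is_norm_fun_def by auto

lemma phi_0 [simp]: "\<phi> 0 = 0" by simp

lemma phi_minus [simp]: "\<phi> (- x) = \<phi> x"
  using phi_scale[of "-1" x] by simp

lemma phi_nonneg [simp]: "0 \<le> \<phi> x"
  using phi_tri[of x "-x"] by simp

lemma phi_pos: "x \<noteq> 0 \<Longrightarrow> 0 < \<phi> x"
  using phi_nonneg[of x] by (simp add: less_le)

lemma phi_sphere: "compact {v. \<phi> v = 1}" "\<exists>v. \<phi> v = 1"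
proof -
  obtain m M where m: "0 < m" "\<And>x. m * norm x \<le> \<phi> x" and c: "continuous_on UNIV \<phi>"
    by (rule is_norm_fun_bounds[OF norm_fun]) blast
  have "closed {v. \<phi> v = 1}"
    using continuous_closed_preimage_constant[OF c, of 1] by simp
  moreover have "norm v \<le> 1 / m" if "\<phi> v = 1" for v
    using m(2)[of v] m(1) that by (simp add: field_simps)
  then have "bounded {v. \<phi> v = 1}" by (auto simp: bounded_iff)
  ultimately show "compact {v. \<phi> v = 1}" by (simp add: compact_eq_bounded_closed)
  obtain b :: 'a where "b \<in> Basis" using nonempty_Basis by blast
  then have "\<phi> b > 0" using phi_pos[OF nonzero_Basis] by blast
  then have "\<phi> ((1 / \<phi> b) *\<^sub>R b) = 1" by (auto simp: phi_scale)
  then show "\<exists>v. \<phi> v = 1" ..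
qed

text \<open>Compactness of the unit sphere of \<open>\<phi>\<close> turns the supremum into a
  maximum; later arguments use \<open>phi_star\<close> only through this maximiser.\<close>

lemma ps_attained: obtains v where "\<phi> v = 1" "v \<bullet> x = ps x" "\<And>w. \<phi> w = 1 \<Longrightarrow> w \<bullet> x \<le> ps x"
proof -
  have "\<exists>v\<in>{v. \<phi> v = 1}. \<forall>w\<in>{v. \<phi> v = 1}. w \<bullet> x \<le> v \<bullet> x"
    by (rule continuous_attains_sup[OF phi_sphere(1)]) (use phi_sphere(2) in \<open>auto intro!: continuous_intros\<close>)
  then obtain v where v: "\<phi> v = 1" "\<And>w. \<phi> w = 1 \<Longrightarrow> w \<bullet> x \<le> v \<bullet> x" by auto
  have "Sup {v \<bullet> x | v. \<phi> v = 1} = v \<bullet> x"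
    by (rule cSup_eq_maximum) (use v in auto)
  then have "ps x = v \<bullet> x" unfolding phi_star_def .
  with v that show ?thesis by auto
qed

lemma inner_le_phi_ps: "v \<bullet> x \<le> \<phi> v * ps x"
proof (cases "v = 0")
  case False
  have "\<phi> ((1 / \<phi> v) *\<^sub>R v) = 1" using False by (simp add: phi_scale)
  then have "((1 / \<phi> v) *\<^sub>R v) \<bullet> x \<le> ps x" using ps_attained[of x] by metis
  then show ?thesis using phi_pos[OF False] by (simp add: field_simps)
qed auto

lemma is_norm_fun_ps: "is_norm_fun ps"
proof -
  have nn: "0 \<le> ps x" for x
  proof -
    obtain v where v: "\<phi> v = 1" "v \<bullet> x = ps x" using ps_attained by metis
    show ?thesis using inner_le_phi_ps[of "-v" x] v by simp
  qed
  have z: "ps x = 0 \<longleftrightarrow> x = 0" for x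
  proof
    assume "ps x = 0"
    then have "x \<bullet> x \<le> 0" using inner_le_phi_ps[of x x] by simp
    then show "x = 0" by (metis inner_gt_zero_iff not_less)
  next
    assume "x = 0"
    then show "ps x = 0" by (metis ps_attained inner_zero_right)
  qed
  have tri: "ps (x + y) \<le> ps x + ps y" for x y
  proof -
    obtain v where v: "\<phi> v = 1" "v \<bullet> (x + y) = ps (x + y)" using ps_attained by metis
    then show ?thesis using inner_le_phi_ps[of v x] inner_le_phi_ps[of v y]
      by (simp add: inner_add_right)
  qed
  have le: "ps (c *\<^sub>R x) \<le> \<bar>c\<bar> * ps x" for c x
  proof -
    obtain v where v: "\<phi> v = 1" "v \<bullet> (c *\<^sub>R x) = ps (c *\<^sub>R x)" using ps_attained by metis
    have "c * (v \<bullet> x) \<le> \<bar>c\<bar> * \<bar>v \<bullet> x\<bar>" by (metis abs_ge_self abs_mult)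
    also have "\<dots> \<le> \<bar>c\<bar> * ps x"
      using inner_le_phi_ps[of v x] inner_le_phi_ps[of "-v" x] v by (intro mult_left_mono) auto
    finally show ?thesis using v by simp
  qed
  have "ps (c *\<^sub>R x) = \<bar>c\<bar> * ps x" for c x
  proof (cases "c = 0")
    case False
    then have "ps x \<le> \<bar>1 / c\<bar> * ps (c *\<^sub>R x)" using le[of "1 / c" "c *\<^sub>R x"] by simp
    then show ?thesis using le[of c x] False by (simp add: field_simps)
  qed (use z[of 0] in simp)
  with z tri show ?thesis unfolding is_norm_fun_def by blast
qed

lemma ps_zero_iff [simp]: "ps x = 0 \<longleftrightarrow> x = 0"
  and ps_scale: "ps (c *\<^sub>R x) = \<bar>c\<bar> * ps x"
  and ps_tri: "ps (x + y) \<le> ps x + ps y"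
  using is_norm_fun_ps unfolding is_norm_fun_def by auto

lemma ps_0 [simp]: "ps 0 = 0" by simp

lemma ps_minus [simp]: "ps (- x) = ps x"
  using ps_scale[of "-1" x] by simp

lemma ps_nonneg [simp]: "0 \<le> ps x"
  using ps_tri[of x "-x"] by simp

lemma continuous_ps: "continuous_on UNIV ps"
  by (rule is_norm_fun_bounds[OF is_norm_fun_ps])

text \<open>Equality in Fenchel's inequality for half the squared norms: dp x p means that x is the gradient of
  half the squared norm at p.\<close>
definition dp :: "'a \<Rightarrow> 'a \<Rightarrow> bool" where
  "dp x p \<longleftrightarrow> p \<bullet> x = \<phi> p * ps x \<and> \<phi> p = ps x"

lemma dp_exists: "\<exists>p. dp x p"
proof -
  obtain v where v: "\<phi> v = 1" "v \<bullet> x = ps x" using ps_attained by metis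
  then have "dp x (ps x *\<^sub>R v)" by (simp add: dp_def phi_scale)
  then show ?thesis ..
qed

lemma dp_scale: "dp x p \<Longrightarrow> dp (c *\<^sub>R x) (c *\<^sub>R p)"
  by (simp add: dp_def phi_scale ps_scale)

lemma dp_zero: "dp x p \<Longrightarrow> x = 0 \<longleftrightarrow> p = 0"
  unfolding dp_def using phi_zero_iff[of p] ps_zero_iff[of x] by argo

lemma fenchel: "v \<bullet> x \<le> (\<phi> v)\<^sup>2 / 2 + (ps x)\<^sup>2 / 2"
  using inner_le_phi_ps[of v x] sum_squares_ge_zero[of "\<phi> v - ps x" 0]
  by (simp add: power2_eq_square algebra_simps)

text \<open>By \<open>inner_le_phi_ps\<close>, equality leaves the square of
  \<open>\<phi> p - ps x\<close> at most 0. This sum form is the one that combines with quadratic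
  bounds.\<close>

lemma dp_iff: "dp x p \<longleftrightarrow> p \<bullet> x = (\<phi> p)\<^sup>2 / 2 + (ps x)\<^sup>2 / 2"
proof
  assume "dp x p"
  then show "p \<bullet> x = (\<phi> p)\<^sup>2 / 2 + (ps x)\<^sup>2 / 2" by (simp add: dp_def power2_eq_square)
next
  assume a: "p \<bullet> x = (\<phi> p)\<^sup>2 / 2 + (ps x)\<^sup>2 / 2"
  have "(\<phi> p - ps x)\<^sup>2 \<le> 0"
    using inner_le_phi_ps[of p x] a by (simp add: power2_eq_square algebra_simps)
  then have "\<phi> p = ps x" by simp
  then show "dp x p" using a by (simp add: dp_def power2_eq_square)
qed

lemma dp_phi: "dp x p \<Longrightarrow> \<phi> p = ps x" and dp_inner: "dp x p \<Longrightarrow> p \<bullet> x = (ps x)\<^sup>2"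
  by (auto simp: dp_def power2_eq_square)

end

section \<open>Smoothness and convexity of half the squared norm\<close>

text \<open>Turns an inequality along a short segment, coming from convexity or the triangle
  inequality, into one for the derivative at its start.\<close>

lemma right_derivative_nonneg:
  fixes f :: "real \<Rightarrow> real"
  assumes "(f has_real_derivative d) (at 0)" "f 0 = 0" "\<And>t. 0 < t \<Longrightarrow> t < 1 \<Longrightarrow> 0 \<le> f t"
  shows "0 \<le> d"
proof (rule ccontr)
  assume "\<not> 0 \<le> d"
  then obtain e where e: "e > 0" "\<And>h. 0 < h \<Longrightarrow> h < e \<Longrightarrow> f (0 + h) < f 0"
    using DERIV_neg_dec_right[OF assms(1)] by force
  define h where "h = min e 1 / 2"
  have "0 < h" "h < e" "h < 1" using e(1) by (auto simp: h_def)
  then show False using e(2)[of h] assms(2) assms(3)[of h] by simp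
qed

lemma power2_sum_le: "(x + y)\<^sup>2 \<le> 2 * x\<^sup>2 + 2 * y\<^sup>2" for x y :: real
  using sum_squares_bound[of x y] by (simp add: power2_sum)

context smooth_norm
begin

text \<open>Taken as a witness of \<open>C2_off_origin\<close> instead of \<open>grad\<close>, so
  that the second derivative comes with it. The proof of \<open>grad_eq_imp_J\<close> identifies it
  with \<open>grad\<close> at unit vectors.\<close>

definition dphi :: "'a \<Rightarrow> 'a" where
  "dphi = (SOME g. \<exists>H :: 'a \<Rightarrow> ('a \<Rightarrow>\<^sub>L 'a). (\<forall>x. x \<noteq> 0 \<longrightarrow> (\<phi> has_derivative (\<lambda>v. g x \<bullet> v)) (at x)) \<and>
     (\<forall>x. x \<noteq> 0 \<longrightarrow> (g has_derivative blinfun_apply (H x)) (at x)) \<and> continuous_on (UNIV - {0}) H)"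

definition d2phi :: "'a \<Rightarrow> ('a \<Rightarrow>\<^sub>L 'a)" where
  "d2phi = (SOME H. (\<forall>x. x \<noteq> 0 \<longrightarrow> (dphi has_derivative blinfun_apply (H x)) (at x)) \<and>
     continuous_on (UNIV - {0}) H)"

lemma has_derivative_phi: "x \<noteq> 0 \<Longrightarrow> (\<phi> has_derivative (\<lambda>v. dphi x \<bullet> v)) (at x)"
  and has_derivative_dphi: "x \<noteq> 0 \<Longrightarrow> (dphi has_derivative blinfun_apply (d2phi x)) (at x)"
  and continuous_d2phi: "continuous_on (UNIV - {0}) d2phi"
proof -
  have "\<exists>H :: 'a \<Rightarrow> ('a \<Rightarrow>\<^sub>L 'a). (\<forall>x. x \<noteq> 0 \<longrightarrow> (\<phi> has_derivative (\<lambda>v. dphi x \<bullet> v)) (at x)) \<and>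
     (\<forall>x. x \<noteq> 0 \<longrightarrow> (dphi has_derivative blinfun_apply (H x)) (at x)) \<and> continuous_on (UNIV - {0}) H"
    using someI_ex[OF C2[unfolded C2_off_origin_def]] unfolding dphi_def .
  then obtain H where H: "\<forall>x. x \<noteq> 0 \<longrightarrow> (\<phi> has_derivative (\<lambda>v. dphi x \<bullet> v)) (at x)"
    "(\<forall>x. x \<noteq> 0 \<longrightarrow> (dphi has_derivative blinfun_apply (H x)) (at x)) \<and> continuous_on (UNIV - {0}) H"
    by blast
  have "(\<forall>x. x \<noteq> 0 \<longrightarrow> (dphi has_derivative blinfun_apply (d2phi x)) (at x)) \<and>
     continuous_on (UNIV - {0}) d2phi"
    unfolding d2phi_def by (rule someI[of _ H]) (rule H(2))
  with H(1) show "x \<noteq> 0 \<Longrightarrow> (\<phi> has_derivative (\<lambda>v. dphi x \<bullet> v)) (at x)"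
    "x \<noteq> 0 \<Longrightarrow> (dphi has_derivative blinfun_apply (d2phi x)) (at x)"
    "continuous_on (UNIV - {0}) d2phi" by auto
qed

lemma DERIV_phi_line:
  assumes "p \<noteq> 0" shows "((\<lambda>t. \<phi> (p + t *\<^sub>R v)) has_real_derivative (dphi p \<bullet> v)) (at 0)"
proof -
  have "((\<lambda>t. \<phi> (p + t *\<^sub>R v)) has_derivative (\<lambda>t. dphi p \<bullet> (t *\<^sub>R v))) (at 0)"
    by (rule has_derivative_compose[where f = "\<lambda>t. p + t *\<^sub>R v" and g = \<phi>])
      (use has_derivative_phi[OF assms] in \<open>auto intro!: derivative_eq_intros\<close>)
  then show ?thesis by (simp add: has_field_derivative_def mult_commute_abs)
qed

lemma dphi_le:
  assumes "p \<noteq> 0" "\<And>t. 0 < t \<Longrightarrow> t < 1 \<Longrightarrow> \<phi> (p + t *\<^sub>R v) \<le> \<phi> p + t * c"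
  shows "dphi p \<bullet> v \<le> c"
proof -
  have "0 \<le> c - dphi p \<bullet> v"
  proof (rule right_derivative_nonneg)
    show "((\<lambda>t. \<phi> p + t * c - \<phi> (p + t *\<^sub>R v)) has_real_derivative c - dphi p \<bullet> v) (at 0)"
      using DERIV_phi_line[OF assms(1), of v] by (auto intro!: derivative_eq_intros)
  qed (use assms(2) in auto)
  then show ?thesis by simp
qed

lemma dphi_ge:
  assumes "p \<noteq> 0" "\<And>t. 0 < t \<Longrightarrow> t < 1 \<Longrightarrow> \<phi> p + t * c \<le> \<phi> (p + t *\<^sub>R v)"
  shows "c \<le> dphi p \<bullet> v"
proof -
  have "0 \<le> dphi p \<bullet> v - c"
  proof (rule right_derivative_nonneg)
    show "((\<lambda>t. \<phi> (p + t *\<^sub>R v) - (\<phi> p + t * c)) has_real_derivative dphi p \<bullet> v - c) (at 0)"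
      using DERIV_phi_line[OF assms(1), of v] by (auto intro!: derivative_eq_intros)
  qed (use assms(2) in auto)
  then show ?thesis by simp
qed

lemma dphi_le_phi: "p \<noteq> 0 \<Longrightarrow> dphi p \<bullet> v \<le> \<phi> v"
proof (rule dphi_le)
  fix t :: real assume "0 < t"
  then show "\<phi> (p + t *\<^sub>R v) \<le> \<phi> p + t * \<phi> v" using phi_tri[of p "t *\<^sub>R v"] by (simp add: phi_scale)
qed

lemma dphi_self:
  assumes "p \<noteq> 0" shows "dphi p \<bullet> p = \<phi> p"
proof -
  have "dphi p \<bullet> (- p) \<le> - \<phi> p"
  proof (rule dphi_le[OF assms])
    fix t :: real assume t: "0 < t" "t < 1"
    have "\<phi> (p + t *\<^sub>R - p) = \<phi> ((1 - t) *\<^sub>R p)" by (simp add: algebra_simps)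
    also have "\<dots> = (1 - t) * \<phi> p" using t by (simp only: phi_scale)
    finally show "\<phi> (p + t *\<^sub>R - p) \<le> \<phi> p + t * - \<phi> p" by (simp add: algebra_simps)
  qed
  then show ?thesis using dphi_le_phi[OF assms, of p] by simp
qed

lemma dp_dphi:
  assumes "p \<noteq> 0" shows "dp (\<phi> p *\<^sub>R dphi p) p"
proof -
  obtain v where v: "\<phi> v = 1" "v \<bullet> dphi p = ps (dphi p)" using ps_attained by metis
  have "ps (dphi p) \<le> 1" using dphi_le_phi[OF assms, of v] v by (simp add: inner_commute)
  moreover have "\<phi> p \<le> \<phi> p * ps (dphi p)"
    using inner_le_phi_ps[of p "dphi p"] dphi_self[OF assms] by (simp add: inner_commute)
  then have "1 \<le> ps (dphi p)" using phi_pos[OF assms] by simp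
  ultimately have "ps (dphi p) = 1" by simp
  then show ?thesis using dphi_self[OF assms] by (simp add: dp_def ps_scale inner_commute)
qed

text \<open>The function sending q to \<open>\<phi> p * \<phi> q - q \<bullet> x\<close> is
  nonnegative and vanishes at p, so its derivative there vanishes.\<close>

lemma dp_imp_dphi:
  assumes "dp x p" "p \<noteq> 0" shows "x = \<phi> p *\<^sub>R dphi p"
proof -
  have k: "0 < \<phi> p" "ps x = \<phi> p" using phi_pos[OF assms(2)] assms(1) by (auto simp: dp_def)
  have "(x \<bullet> v) / \<phi> p \<le> dphi p \<bullet> v" for v
  proof (rule dphi_ge[OF assms(2)])
    fix t :: real
    have "\<phi> p * \<phi> p + t * (x \<bullet> v) \<le> \<phi> p * \<phi> (p + t *\<^sub>R v)"
    proof -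
      have "(p + t *\<^sub>R v) \<bullet> x = p \<bullet> x + t * (x \<bullet> v)"
        by (simp add: inner_add_left inner_commute[of v x])
      then show ?thesis
        using inner_le_phi_ps[of "p + t *\<^sub>R v" x] k assms(1) by (simp add: dp_def mult.commute)
    qed
    then have "(\<phi> p * \<phi> p + t * (x \<bullet> v)) / \<phi> p \<le> \<phi> (p + t *\<^sub>R v)"
      using k(1) by (simp add: divide_le_eq mult.commute)
    then show "\<phi> p + t * ((x \<bullet> v) / \<phi> p) \<le> \<phi> (p + t *\<^sub>R v)"
      using assms(2) by (simp add: add_divide_distrib)
  qed
  then have *: "x \<bullet> v \<le> (\<phi> p *\<^sub>R dphi p) \<bullet> v" for v using k(1) by (simp add: field_simps)
  \<comment> \<open>The inequality holds in every direction v; testing it with the difference of the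
    two vectors gives equality.\<close>
  have "(x - \<phi> p *\<^sub>R dphi p) \<bullet> (x - \<phi> p *\<^sub>R dphi p) \<le> 0"
    using *[of "x - \<phi> p *\<^sub>R dphi p"] by (simp add: inner_diff_left)
  then show ?thesis by (metis inner_gt_zero_iff not_less right_minus_eq)
qed

text \<open>At points with \<open>\<phi> p = 1\<close> the Hessian is bounded on a compact shell
  that avoids the origin, where \<open>\<phi>\<close> is not smooth; homogeneity later reaches all
  other base points.\<close>

lemma phi_taylor:
  obtains B r where "0 \<le> B" "0 < r"
    "\<And>p h. \<phi> p = 1 \<Longrightarrow> norm h \<le> r \<Longrightarrow> \<phi> (p + h) \<le> 1 + dphi p \<bullet> h + B * (norm h)\<^sup>2"
proof -
  obtain m M where m: "0 < m" "\<And>x. m * norm x \<le> \<phi> x" and M: "0 < M" "\<And>x. \<phi> x \<le> M * norm x"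
    by (rule is_norm_fun_bounds[OF norm_fun]) blast
  \<comment> \<open>\<open>\<phi> p = 1\<close> gives |p| >= 1 / M = 2 r, so the ball of radius r
    about p stays outside the ball of radius r about 0.\<close>
  define r where "r = 1 / (2 * M)"
  define K where "K = cball (0::'a) (1 / m + r) - ball 0 r"
  have r: "0 < r" using M(1) by (simp add: r_def)
  have "compact K" unfolding K_def by (rule compact_diff) auto
  moreover have "continuous_on K d2phi"
    by (rule continuous_on_subset[OF continuous_d2phi]) (use r in \<open>auto simp: K_def\<close>)
  ultimately have "bounded (d2phi ` K)" by (intro compact_imp_bounded compact_continuous_image)
  then obtain B where B: "0 < B" "\<And>y. y \<in> K \<Longrightarrow> norm (d2phi y) \<le> B" by (auto simp: bounded_pos)
  have "\<phi> (p + h) \<le> 1 + dphi p \<bullet> h + B * (norm h)\<^sup>2" if p: "\<phi> p = 1" and h: "norm h \<le> r" for p h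
  proof -
    have "1 / M \<le> norm p" "norm p \<le> 1 / m"
      using m(1) m(2)[of p] M(1) M(2)[of p] p by (simp_all add: field_simps)
    have S: "cball p (norm h) \<subseteq> K"
    proof
      fix y assume "y \<in> cball p (norm h)"
      then have y: "norm (y - p) \<le> r" using h by (simp add: dist_norm norm_minus_commute)
      have "norm y \<le> norm p + norm (y - p)" "norm p \<le> norm y + norm (y - p)"
        using norm_triangle_sub[of y p] norm_triangle_sub[of p y] by (simp_all add: norm_minus_commute)
      moreover have "1 / M = 2 * r" by (simp add: r_def)
      ultimately have "r \<le> norm y" "norm y \<le> 1 / m + r"
        using y \<open>1 / M \<le> norm p\<close> \<open>norm p \<le> 1 / m\<close> by linarith+
      then show "y \<in> K" by (simp add: K_def)
    qed
    have nz: "y \<noteq> 0" if "y \<in> cball p (norm h)" for y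
      using subsetD[OF S that] r by (auto simp: K_def)
    have lip: "norm (dphi y - dphi p) \<le> B * norm h" if y: "y \<in> cball p (norm h)" for y
    proof -
      have "norm (dphi y - dphi p) \<le> B * norm (y - p)"
      proof (rule differentiable_bound[where S = "cball p (norm h)" and f' = "\<lambda>x. blinfun_apply (d2phi x)"])
        fix x assume x: "x \<in> cball p (norm h)"
        show "(dphi has_derivative blinfun_apply (d2phi x)) (at x within cball p (norm h))"
          using has_derivative_dphi[OF nz[OF x]] by (rule has_derivative_at_withinI)
        show "onorm (blinfun_apply (d2phi x)) \<le> B"
          using B(2)[of x] S x by (auto simp: norm_blinfun.rep_eq)
      qed (use y in auto)
      also have "\<dots> \<le> B * norm h" using y B(1) by (intro mult_left_mono) (auto simp: dist_norm norm_minus_commute)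
      finally show ?thesis .
    qed
    \<comment> \<open>The mean value bound for \<open>\<phi>\<close> minus its linear part at p,
      whose gradient has norm at most B |h| on this ball.\<close>
    have "norm ((\<phi> (p + h) - dphi p \<bullet> (p + h)) - (\<phi> p - dphi p \<bullet> p)) \<le> (B * norm h) * norm (p + h - p)"
    proof (rule differentiable_bound[where S = "cball p (norm h)" and f' = "\<lambda>y v. dphi y \<bullet> v - dphi p \<bullet> v"])
      fix x assume x: "x \<in> cball p (norm h)"
      show "((\<lambda>y. \<phi> y - dphi p \<bullet> y) has_derivative (\<lambda>v. dphi x \<bullet> v - dphi p \<bullet> v)) (at x within cball p (norm h))"
        by (intro has_derivative_diff has_derivative_at_withinI[OF has_derivative_phi[OF nz[OF x]]]
            bounded_linear_imp_has_derivative bounded_linear_inner_right)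
      show "onorm (\<lambda>v. dphi x \<bullet> v - dphi p \<bullet> v) \<le> B * norm h"
      proof (rule onorm_le)
        fix v
        have "norm ((dphi x - dphi p) \<bullet> v) \<le> norm (dphi x - dphi p) * norm v"
          by (simp add: Cauchy_Schwarz_ineq2)
        also have "\<dots> \<le> B * norm h * norm v" using lip[OF x] by (intro mult_right_mono) auto
        finally show "norm (dphi x \<bullet> v - dphi p \<bullet> v) \<le> B * norm h * norm v" by (simp add: inner_diff_left)
      qed
    qed (auto simp: dist_norm)
    then show ?thesis using p by (simp add: inner_add_right power2_eq_square)
  qed
  then show ?thesis using that[of B r] B(1) r by simp
qed

text \<open>Constants of uniform smoothness and of uniform convexity of half the squared norm.\<close>
definition Lam_prop where "Lam_prop \<Lambda> \<longleftrightarrow> 0 < \<Lambda> \<and>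
  (\<forall>x p h. dp x p \<longrightarrow> (\<phi> (p + h))\<^sup>2 / 2 \<le> (\<phi> p)\<^sup>2 / 2 + x \<bullet> h + \<Lambda> / 2 * (norm h)\<^sup>2)"

definition lam_prop where "lam_prop l \<longleftrightarrow> 0 < l \<and>
  (\<forall>x p h. dp x p \<longrightarrow> (\<phi> p)\<^sup>2 / 2 + x \<bullet> h + l / 2 * (norm h)\<^sup>2 \<le> (\<phi> (p + h))\<^sup>2 / 2)"

text \<open>Half the squared norm is homogeneous of degree 2, so base points with
  \<open>\<phi> p = 1\<close> and the origin suffice. Small h is covered by
  \<open>phi_taylor\<close>; for |h| > r a quadratic in h dominates the constant and linear
  terms.\<close>

lemma Lam_exists: "\<exists>\<Lambda>. Lam_prop \<Lambda>"
proof -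
  obtain m M where m: "0 < m" "\<And>x. m * norm x \<le> \<phi> x" and M: "0 < M" "\<And>x. \<phi> x \<le> M * norm x"
    by (rule is_norm_fun_bounds[OF norm_fun]) blast
  obtain B r where B: "0 \<le> B" "0 < r"
    and T: "\<And>p h. \<phi> p = 1 \<Longrightarrow> norm h \<le> r \<Longrightarrow> \<phi> (p + h) \<le> 1 + dphi p \<bullet> h + B * (norm h)\<^sup>2"
    by (rule phi_taylor) blast
  \<comment> \<open>\<open>L1\<close> serves |h| <= r, \<open>L2\<close> serves |h| > r, and the
    square of M serves the base point 0.\<close>
  define L1 where "L1 = B + (M + B * r)\<^sup>2 / 2"
  define L2 where "L2 = (1 / r + M)\<^sup>2 / 2 + M / r"
  define L where "L = 2 * L1 + 2 * L2 + M\<^sup>2"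
  have pos: "0 \<le> L1" "0 \<le> L2" "0 < M\<^sup>2" using B M(1) by (auto simp: L1_def L2_def)
  have unit: "(\<phi> (p + h))\<^sup>2 / 2 \<le> 1 / 2 + dphi p \<bullet> h + (L1 + L2) * (norm h)\<^sup>2" if p: "\<phi> p = 1" for p h
  proof -
    have p0: "p \<noteq> 0" using p by auto
    let ?A = "dphi p \<bullet> h" and ?n = "norm h"
    have A: "\<bar>?A\<bar> \<le> M * ?n" using dphi_le_phi[OF p0, of h] dphi_le_phi[OF p0, of "-h"] M(2)[of h] by simp
    show ?thesis
    proof (cases "?n \<le> r")
      case True
      have "(\<phi> (p + h))\<^sup>2 \<le> (1 + ?A + B * ?n\<^sup>2)\<^sup>2"
        using T[OF p True] by (intro power_mono) auto
      also have "\<dots> = 1 + 2 * ?A + 2 * B * ?n\<^sup>2 + (?A + B * ?n\<^sup>2)\<^sup>2"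
        by (simp add: power2_eq_square algebra_simps)
      also have "(?A + B * ?n\<^sup>2)\<^sup>2 \<le> ((M + B * r) * ?n)\<^sup>2"
      proof (rule power2_le_iff_abs_le[THEN iffD2])
        have "B * ?n\<^sup>2 \<le> B * r * ?n"
          using True B(1) by (simp add: power2_eq_square mult_left_mono mult_right_mono mult.assoc)
        then show "\<bar>?A + B * ?n\<^sup>2\<bar> \<le> (M + B * r) * ?n"
          using A B(1) by (auto simp: algebra_simps abs_le_iff) (smt (verit) mult_nonneg_nonneg zero_le_power2)
      qed (use M B in auto)
      also have "((M + B * r) * ?n)\<^sup>2 = (M + B * r)\<^sup>2 * ?n\<^sup>2" by (simp only: power_mult_distrib)
      finally have "(\<phi> (p + h))\<^sup>2 / 2 \<le> 1 / 2 + ?A + L1 * ?n\<^sup>2"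
        unfolding L1_def distrib_right by simp
      then show ?thesis using mult_nonneg_nonneg[OF pos(2) zero_le_power2[of ?n]]
        unfolding distrib_right by linarith
    next
      case False
      have a: "1 \<le> 1 / r * ?n" using False B by (simp add: field_simps)
      have "\<phi> (p + h) \<le> (1 / r + M) * ?n"
        using phi_tri[of p h] M(2)[of h] p a unfolding distrib_right by linarith
      then have "(\<phi> (p + h))\<^sup>2 \<le> (1 / r + M)\<^sup>2 * ?n\<^sup>2"
        using power_mono[of "\<phi> (p + h)" "(1 / r + M) * ?n" 2] by (simp add: power_mult_distrib)
      moreover have "M * ?n \<le> M * ?n * (1 / r * ?n)"
        using mult_left_mono[OF a, of "M * ?n"] M(1) by simp
      then have "- ?A \<le> M / r * ?n\<^sup>2" using A by (simp add: power2_eq_square)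
      moreover have "L2 * ?n\<^sup>2 = (1 / r + M)\<^sup>2 * ?n\<^sup>2 / 2 + M / r * ?n\<^sup>2"
        by (simp add: L2_def distrib_right)
      ultimately have "(\<phi> (p + h))\<^sup>2 / 2 \<le> ?A + L2 * ?n\<^sup>2" by linarith
      then show ?thesis using mult_nonneg_nonneg[OF pos(1) zero_le_power2[of ?n]]
        unfolding distrib_right by linarith
    qed
  qed
  have "(\<phi> (p + h))\<^sup>2 / 2 \<le> (\<phi> p)\<^sup>2 / 2 + x \<bullet> h + L / 2 * (norm h)\<^sup>2" if d: "dp x p" for x p h
  proof (cases "p = 0")
    case True
    then have "x = 0" using dp_zero[OF d] by simp
    have "(\<phi> h)\<^sup>2 \<le> M\<^sup>2 * (norm h)\<^sup>2"
      using power_mono[OF M(2)[of h], of 2] by (simp add: power_mult_distrib)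
    also have "\<dots> \<le> L * (norm h)\<^sup>2" using pos by (intro mult_right_mono) (auto simp: L_def)
    finally show ?thesis using True \<open>x = 0\<close> by simp
  next
    case False
    define k where "k = \<phi> p"
    have k: "0 < k" using phi_pos[OF False] by (simp add: k_def)
    have d1: "dp ((1 / k) *\<^sub>R x) ((1 / k) *\<^sub>R p)" by (rule dp_scale[OF d])
    have u: "\<phi> ((1 / k) *\<^sub>R p) = 1" using False by (simp add: phi_scale k_def)
    have x: "(1 / k) *\<^sub>R x = dphi ((1 / k) *\<^sub>R p)" using dp_imp_dphi[OF d1] u False k by simp
    have "(\<phi> ((1 / k) *\<^sub>R (p + h)))\<^sup>2 / 2 \<le> 1 / 2 + ((1 / k) *\<^sub>R x) \<bullet> ((1 / k) *\<^sub>R h) + (L1 + L2) * (norm ((1 / k) *\<^sub>R h))\<^sup>2"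
      using unit[OF u, of "(1 / k) *\<^sub>R h"] unfolding x scaleR_add_right by simp
    then have "k\<^sup>2 * ((\<phi> ((1 / k) *\<^sub>R (p + h)))\<^sup>2 / 2) \<le> k\<^sup>2 * (1 / 2 + ((1 / k) *\<^sub>R x) \<bullet> ((1 / k) *\<^sub>R h) + (L1 + L2) * (norm ((1 / k) *\<^sub>R h))\<^sup>2)"
      by (intro mult_left_mono) auto
    then have "(\<phi> (p + h))\<^sup>2 / 2 \<le> k\<^sup>2 / 2 + x \<bullet> h + (L1 + L2) * (norm h)\<^sup>2"
      unfolding phi_scale
      using k by (simp add: power_mult_distrib power_divide distrib_left power2_eq_square)
    also have "\<dots> \<le> k\<^sup>2 / 2 + x \<bullet> h + L / 2 * (norm h)\<^sup>2"
      using pos by (intro add_left_mono mult_right_mono) (auto simp: L_def)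
    finally show ?thesis by (simp add: k_def)
  qed
  moreover have "0 < L" unfolding L_def using pos by linarith
  ultimately have "Lam_prop L" unfolding Lam_prop_def by blast
  then show ?thesis ..
qed

text \<open>The tangent inequality at p of the convex function in the hypothesis. The bracket
  vanishes exactly when q is a nonnegative multiple of p, so it measures transverse displacement
  only.\<close>

lemma phi_lower_tangent:
  assumes g: "convex_on UNIV (\<lambda>u. \<phi> u - \<gamma> * norm u)" and p: "p \<noteq> 0"
  shows "dphi p \<bullet> q + \<gamma> * (norm q - (p \<bullet> q) / norm p) \<le> \<phi> q"
proof -
  let ?v = "q - p"
  have n: "((\<lambda>t. norm (p + t *\<^sub>R ?v)) has_real_derivative (sgn p \<bullet> ?v)) (at 0)"
  proof -
    have "((\<lambda>t. norm (p + t *\<^sub>R ?v)) has_derivative (\<lambda>t. sgn p \<bullet> (t *\<^sub>R ?v))) (at 0)"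
      by (rule has_derivative_compose[where f = "\<lambda>t. p + t *\<^sub>R ?v" and g = norm])
        (use has_derivative_norm[OF p] in \<open>auto simp: inner_commute intro!: derivative_eq_intros\<close>)
    then show ?thesis by (simp add: has_field_derivative_def mult_commute_abs)
  qed
  have "0 \<le> (\<phi> q - \<phi> p) + \<gamma> * (sgn p \<bullet> ?v + norm p - norm q) - dphi p \<bullet> ?v"
  proof (rule right_derivative_nonneg)
    show "((\<lambda>t. \<phi> p + t * (\<phi> q - \<phi> p) + \<gamma> * (norm (p + t *\<^sub>R ?v) - (1 - t) * norm p - t * norm q) - \<phi> (p + t *\<^sub>R ?v))
      has_real_derivative (\<phi> q - \<phi> p) + \<gamma> * (sgn p \<bullet> ?v + norm p - norm q) - dphi p \<bullet> ?v) (at 0)"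
      using DERIV_phi_line[OF p, of ?v] n by (auto intro!: derivative_eq_intros)
    fix t :: real assume t: "0 < t" "t < 1"
    have "p + t *\<^sub>R ?v = (1 - t) *\<^sub>R p + t *\<^sub>R q" by (simp add: algebra_simps)
    then show "0 \<le> \<phi> p + t * (\<phi> q - \<phi> p) + \<gamma> * (norm (p + t *\<^sub>R ?v) - (1 - t) * norm p - t * norm q) - \<phi> (p + t *\<^sub>R ?v)"
      using convex_onD[OF g, of t p q] t by (simp add: algebra_simps)
  qed simp
  moreover have "sgn p \<bullet> p = norm p"
    using p by (simp add: sgn_div_norm dot_square_norm power2_eq_square)
  then have "sgn p \<bullet> ?v + norm p = (p \<bullet> q) / norm p"
    by (simp add: inner_diff_right) (simp add: sgn_div_norm divide_inverse mult.commute)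
  ultimately show ?thesis using dphi_self[OF p] by (simp add: inner_diff_right right_diff_distrib)
qed

text \<open>With q = p + h and a = |\<open>\<phi> q\<close> - 1|, the gap of half the square over
  its tangent is a^2 / 2 plus the gap of \<open>\<phi>\<close> itself, which is at least \<gamma> w
  by \<open>phi_lower_tangent\<close>. Hence |h|^2 has to be bounded by a multiple of a^2 + 2
  \<gamma> w, where a sees the radial and w the transverse part.\<close>

lemma lam_exists: "\<exists>l. lam_prop l"
proof -
  obtain m M where m: "0 < m" "\<And>x. m * norm x \<le> \<phi> x" and M: "0 < M" "\<And>x. \<phi> x \<le> M * norm x"
    by (rule is_norm_fun_bounds[OF norm_fun]) blast
  obtain \<gamma> where g: "0 < \<gamma>" "convex_on UNIV (\<lambda>u. \<phi> u - \<gamma> * norm u)"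
    using uconv unfolding unif_convex_def by blast
  \<comment> \<open>The first summand serves \<open>2 \<le> \<phi> q\<close>; the next two serve the
    radial and the transverse error when \<open>\<phi> q < 2\<close>.\<close>
  define C where "C = 9 / m\<^sup>2 + 2 / m\<^sup>2 + 4 * (1 + M / m)\<^sup>2 / (m * \<gamma>) + m\<^sup>2"
  have terms: "0 < 9 / m\<^sup>2" "0 < 2 / m\<^sup>2" "0 < 4 * (1 + M / m)\<^sup>2 / (m * \<gamma>)" "0 < m\<^sup>2"
    using m(1) M(1) g(1) by (auto intro!: divide_pos_pos mult_pos_pos zero_less_power add_pos_pos)
  have Cpos: "0 < C" unfolding C_def using terms by linarith
  have Cs: "9 / m\<^sup>2 \<le> C" "2 / m\<^sup>2 \<le> C" "4 * (1 + M / m)\<^sup>2 / (m * \<gamma>) \<le> C"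
    unfolding C_def using terms by linarith+
  have unit: "1 / 2 + dphi p \<bullet> h + (1 / C) / 2 * (norm h)\<^sup>2 \<le> (\<phi> (p + h))\<^sup>2 / 2" if p: "\<phi> p = 1" for p h
  proof -
    have p0: "p \<noteq> 0" using p by auto
    define q where "q = p + h"
    define e where "e = (1 / norm p) *\<^sub>R p"
    define w where "w = norm q - q \<bullet> e"
    define a where "a = \<bar>\<phi> q - 1\<bar>"
    have ne: "norm e = 1" using p0 by (simp add: e_def)
    have np: "norm p \<le> 1 / m" using m(1) m(2)[of p] p by (simp add: field_simps)
    have w: "0 \<le> w" using norm_cauchy_schwarz[of q e] ne by (simp add: w_def)
    have low: "dphi p \<bullet> q + \<gamma> * w \<le> \<phi> q"
      using phi_lower_tangent[OF g(2) p0, of q] by (simp add: w_def e_def inner_commute)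
    have "(norm (q - p))\<^sup>2 \<le> C * (a\<^sup>2 + 2 * \<gamma> * w)"
    proof (cases "2 \<le> \<phi> q")
      case True
      have "norm (q - p) \<le> norm q + norm p" by (rule norm_triangle_ineq4)
      also have "\<dots> \<le> \<phi> q / m + 1 / m" using m(1) m(2)[of q] np by (simp add: field_simps)
      also have "\<dots> \<le> 3 * a / m" using True m(1) by (simp add: a_def field_simps)
      finally have "(norm (q - p))\<^sup>2 \<le> (3 * a / m)\<^sup>2" by (intro power_mono) auto
      also have "\<dots> = 9 / m\<^sup>2 * a\<^sup>2" by (simp add: power2_eq_square field_simps)
      also have "\<dots> \<le> C * (a\<^sup>2 + 2 * \<gamma> * w)"
        by (rule mult_mono) (use Cs g(1) w Cpos in auto)
      finally show ?thesis .
    next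
      case False
      \<comment> \<open>The distance from q to the point of the ray through p with the same
        Euclidean norm. Its square is 2 |q| w, which ties it to the transverse gap.\<close>
      define E where "E = norm (norm q *\<^sub>R e - q)"
      have nq: "norm q \<le> 2 / m" using False m(1) m(2)[of q] by (simp add: field_simps)
      have E2: "E\<^sup>2 = 2 * norm q * w"
      proof -
        have "e \<bullet> e = 1" "q \<bullet> q = norm q * norm q"
          using ne by (simp_all add: dot_square_norm power2_eq_square)
        then show ?thesis unfolding E_def power2_norm_eq_inner
          by (simp add: inner_diff_left inner_diff_right w_def inner_commute algebra_simps)
      qed
      have "2 * norm q * w \<le> 2 * (2 / m) * w" using nq w by (intro mult_right_mono) auto
      then have E2le: "E\<^sup>2 \<le> 4 / m * w" using E2 by simp
      have pe: "\<phi> (norm q *\<^sub>R e) = norm q / norm p" using p by (simp add: phi_scale e_def)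
      have "\<bar>norm q / norm p - \<phi> q\<bar> \<le> M * E"
      proof -
        have "\<phi> (norm q *\<^sub>R e) \<le> \<phi> q + \<phi> (norm q *\<^sub>R e - q)" using phi_tri[of q "norm q *\<^sub>R e - q"] by simp
        moreover have "\<phi> q \<le> \<phi> (norm q *\<^sub>R e) + \<phi> (norm q *\<^sub>R e - q)"
          using phi_tri[of "norm q *\<^sub>R e" "q - norm q *\<^sub>R e"] phi_minus[of "norm q *\<^sub>R e - q"] by simp
        ultimately show ?thesis using M(2)[of "norm q *\<^sub>R e - q"] unfolding E_def pe by linarith
      qed
      then have b: "\<bar>norm q / norm p - 1\<bar> \<le> a + M * E" by (simp add: a_def)
      have "norm (norm q *\<^sub>R e - p) = norm p * \<bar>norm q / norm p - 1\<bar>"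
      proof -
        have "norm q *\<^sub>R e - p = (norm q / norm p - 1) *\<^sub>R p" by (simp add: e_def algebra_simps)
        then show ?thesis by (simp add: mult.commute)
      qed
      also have "\<dots> \<le> (1 / m) * (a + M * E)" using np b m(1) by (intro mult_mono) auto
      finally have "norm (q - p) \<le> E + (1 / m) * (a + M * E)"
        using norm_triangle_ineq[of "q - norm q *\<^sub>R e" "norm q *\<^sub>R e - p"]
        by (simp add: E_def norm_minus_commute)
      also have "\<dots> = (1 + M / m) * E + a / m" by (simp add: algebra_simps)
      finally have "(norm (q - p))\<^sup>2 \<le> ((1 + M / m) * E + a / m)\<^sup>2" by (intro power_mono) auto
      also have "\<dots> \<le> 2 * ((1 + M / m) * E)\<^sup>2 + 2 * (a / m)\<^sup>2"
        by (rule power2_sum_le)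
      also have "\<dots> = 2 * (1 + M / m)\<^sup>2 * E\<^sup>2 + 2 / m\<^sup>2 * a\<^sup>2" by (simp add: power_mult_distrib power_divide)
      also have "\<dots> \<le> 2 * (1 + M / m)\<^sup>2 * (4 / m * w) + 2 / m\<^sup>2 * a\<^sup>2"
        using E2le by (intro add_right_mono mult_left_mono) auto
      also have "\<dots> = (4 * (1 + M / m)\<^sup>2 / (m * \<gamma>)) * (2 * \<gamma> * w) + 2 / m\<^sup>2 * a\<^sup>2" using g(1) by simp
      also have "\<dots> \<le> C * (2 * \<gamma> * w) + C * a\<^sup>2"
        by (intro add_mono mult_right_mono) (use Cs g(1) w in auto)
      finally show ?thesis by (simp add: algebra_simps)
    qed
    then have "(1 / C) * (norm h)\<^sup>2 \<le> a\<^sup>2 + 2 * \<gamma> * w" using Cpos by (simp add: q_def field_simps)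
    moreover have "a\<^sup>2 = (\<phi> q)\<^sup>2 - 2 * \<phi> q + 1" by (simp add: a_def power2_eq_square algebra_simps)
    moreover have "dphi p \<bullet> q = 1 + dphi p \<bullet> h" using dphi_self[OF p0] p by (simp add: q_def inner_add_right)
    ultimately show ?thesis using low by (simp add: q_def)
  qed
  have "(\<phi> p)\<^sup>2 / 2 + x \<bullet> h + (1 / C) / 2 * (norm h)\<^sup>2 \<le> (\<phi> (p + h))\<^sup>2 / 2" if d: "dp x p" for x p h
  proof (cases "p = 0")
    case True
    then have "x = 0" using dp_zero[OF d] by simp
    have "m\<^sup>2 * (norm h)\<^sup>2 \<le> (\<phi> h)\<^sup>2"
      using power_mono[OF m(2)[of h], of 2] m(1) by (simp add: power_mult_distrib)
    moreover have "1 \<le> m\<^sup>2 * C" using mult_left_mono[OF Cs(1), of "m\<^sup>2"] m(1) by simp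
    then have "1 / C \<le> m\<^sup>2" using Cpos by (simp add: field_simps)
    then have "1 / C * (norm h)\<^sup>2 \<le> m\<^sup>2 * (norm h)\<^sup>2" by (intro mult_right_mono) auto
    ultimately show ?thesis using True \<open>x = 0\<close> by simp
  next
    case False
    define k where "k = \<phi> p"
    have k: "0 < k" using phi_pos[OF False] by (simp add: k_def)
    have d1: "dp ((1 / k) *\<^sub>R x) ((1 / k) *\<^sub>R p)" by (rule dp_scale[OF d])
    have u: "\<phi> ((1 / k) *\<^sub>R p) = 1" using False by (simp add: phi_scale k_def)
    have x: "(1 / k) *\<^sub>R x = dphi ((1 / k) *\<^sub>R p)" using dp_imp_dphi[OF d1] u False k by simp
    have "1 / 2 + ((1 / k) *\<^sub>R x) \<bullet> ((1 / k) *\<^sub>R h) + (1 / C) / 2 * (norm ((1 / k) *\<^sub>R h))\<^sup>2 \<le> (\<phi> ((1 / k) *\<^sub>R (p + h)))\<^sup>2 / 2"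
      using unit[OF u, of "(1 / k) *\<^sub>R h"] unfolding x scaleR_add_right by simp
    then have "k\<^sup>2 * (1 / 2 + ((1 / k) *\<^sub>R x) \<bullet> ((1 / k) *\<^sub>R h) + (1 / C) / 2 * (norm ((1 / k) *\<^sub>R h))\<^sup>2) \<le> k\<^sup>2 * ((\<phi> ((1 / k) *\<^sub>R (p + h)))\<^sup>2 / 2)"
      by (intro mult_left_mono) auto
    then show ?thesis unfolding phi_scale k_def[symmetric]
      using k by (simp add: power_mult_distrib power_divide distrib_left power2_eq_square)
  qed
  moreover have "0 < 1 / C" using Cpos by simp
  ultimately have "lam_prop (1 / C)" unfolding lam_prop_def by blast
  then show ?thesis ..
qed

end

section \<open>The duality map\<close>

lemma young_inner:
  fixes a b :: "'a::real_inner"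
  assumes "0 < l" shows "a \<bullet> b \<le> l / 2 * (norm a)\<^sup>2 + (norm b)\<^sup>2 / (2 * l)"
proof -
  have "0 \<le> (norm (l *\<^sub>R a - b))\<^sup>2" by simp
  also have "\<dots> = l\<^sup>2 * (norm a)\<^sup>2 - 2 * l * (a \<bullet> b) + (norm b)\<^sup>2"
    by (simp only: power2_norm_eq_inner inner_diff_left inner_diff_right inner_scaleR_left inner_scaleR_right
        inner_commute[of b a]) (simp add: power2_eq_square algebra_simps)
  finally have "2 * l * (a \<bullet> b) \<le> 2 * l * (l / 2 * (norm a)\<^sup>2 + (norm b)\<^sup>2 / (2 * l))"
    using assms by (simp add: power2_eq_square distrib_left)
  then show ?thesis using mult_le_cancel_left_pos[of "2 * l"] assms by simp
qed

lemma has_derivative_quadratic_remainder: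
  fixes f :: "'a::real_normed_vector \<Rightarrow> 'b::real_normed_vector"
  assumes "bounded_linear L" "0 < r"
    "\<And>y. norm (y - x) < r \<Longrightarrow> norm (f y - f x - L (y - x)) \<le> C * (norm (y - x))\<^sup>2"
  shows "(f has_derivative L) (at x)"
  unfolding has_derivative_at_alt
proof (intro conjI allI impI)
  fix e :: real assume e: "0 < e"
  define d where "d = min r (e / (\<bar>C\<bar> + 1))"
  have d: "0 < d" using e assms(2) by (simp add: d_def)
  have "norm (f y - f x - L (y - x)) \<le> e * norm (y - x)" if y: "norm (y - x) < d" for y
  proof -
    have "C * (norm (y - x))\<^sup>2 \<le> (\<bar>C\<bar> + 1) * norm (y - x) * norm (y - x)"
      by (simp add: power2_eq_square mult_right_mono mult.assoc)
    also have "\<dots> \<le> e * norm (y - x)"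
    proof (rule mult_right_mono)
      have "norm (y - x) \<le> e / (\<bar>C\<bar> + 1)" using y by (simp add: d_def)
      then show "(\<bar>C\<bar> + 1) * norm (y - x) \<le> e" by (simp add: field_simps)
    qed simp
    finally show ?thesis using assms(3)[of y] y by (simp add: d_def)
  qed
  with d show "\<exists>d>0. \<forall>y. norm (y - x) < d \<longrightarrow> norm (f y - f x - L (y - x)) \<le> e * norm (y - x)" by blast
qed (rule assms)

text \<open>Both iterated difference quotients of f over the parallelogram spanned by v and w agree, and
  the mean value theorem compares each of them with a value of the bilinear form of D.\<close>
lemma gradient_derivative_symmetric:
  fixes f :: "'a::euclidean_space \<Rightarrow> real"
  assumes S: "open S" "x \<in> S" and f: "\<And>y. y \<in> S \<Longrightarrow> (f has_derivative (\<lambda>v. G y \<bullet> v)) (at y)"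
    and G: "(G has_derivative D) (at x)"
  shows "D v \<bullet> w = v \<bullet> D w"
proof -
  define c where "c = norm v + norm w + 1"
  have c: "1 \<le> c" "0 < c" by (auto simp: c_def add_nonneg_pos)
  have lin: "linear D" using G by (rule has_derivative_linear)
  have bnd: "\<bar>D v \<bullet> w - v \<bullet> D w\<bar> \<le> 4 * e * c\<^sup>2" if e: "0 < e" for e
  proof -
    obtain d1 where d1: "0 < d1" "\<And>y. norm (y - x) < d1 \<Longrightarrow> norm (G y - G x - D (y - x)) \<le> e * norm (y - x)"
      using G e unfolding has_derivative_at_alt by blast
    obtain d2 where d2: "0 < d2" "ball x d2 \<subseteq> S" using S openE by blast
    define d where "d = min d1 d2"
    define s where "s = d / (2 * c)"
    have d: "0 < d" using d1 d2 by (simp add: d_def)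
    have s: "0 < s" "s * c < d" using d c by (auto simp: s_def)
    have Q: "\<bar>(f (x + s *\<^sub>R a + s *\<^sub>R b) - f (x + s *\<^sub>R a) - f (x + s *\<^sub>R b) + f x) - s\<^sup>2 * (D b \<bullet> a)\<bar> \<le> 2 * e * s\<^sup>2 * c\<^sup>2"
      if ab: "norm a + norm b + 1 = c" for a b
    proof -
      have near: "norm (t *\<^sub>R (s *\<^sub>R a) + u *\<^sub>R (s *\<^sub>R b)) \<le> s * c" if "0 \<le> t" "t \<le> 1" "0 \<le> u" "u \<le> 1" for t u
      proof -
        have "norm (t *\<^sub>R (s *\<^sub>R a) + u *\<^sub>R (s *\<^sub>R b)) \<le> t * (s * norm a) + u * (s * norm b)"
          using norm_triangle_ineq[of "t *\<^sub>R (s *\<^sub>R a)" "u *\<^sub>R (s *\<^sub>R b)"] that s(1) by simp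
        also have "\<dots> \<le> 1 * (s * norm a) + 1 * (s * norm b)"
          using that s(1) by (intro add_mono mult_right_mono) auto
        also have "\<dots> \<le> s * c" using s(1) ab[symmetric] by (simp add: distrib_left)
        finally show ?thesis .
      qed
      define h where "h = (\<lambda>t. f (x + t *\<^sub>R (s *\<^sub>R a) + s *\<^sub>R b) - f (x + t *\<^sub>R (s *\<^sub>R a)))"
      define h' where "h' = (\<lambda>t. (G (x + t *\<^sub>R (s *\<^sub>R a) + s *\<^sub>R b) - G (x + t *\<^sub>R (s *\<^sub>R a))) \<bullet> (s *\<^sub>R a))"
      have der: "(h has_real_derivative h' t) (at t)" if t: "0 \<le> t" "t \<le> 1" for t
      proof -
        have i1: "x + t *\<^sub>R (s *\<^sub>R a) + s *\<^sub>R b \<in> S"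
        proof -
          have "dist (x + t *\<^sub>R (s *\<^sub>R a) + s *\<^sub>R b) x \<le> s * c"
            using near[of t 1] t by (simp add: dist_norm add.assoc)
          then show ?thesis using s by (intro subsetD[OF d2(2)]) (simp add: d_def dist_commute)
        qed
        have i2: "x + t *\<^sub>R (s *\<^sub>R a) \<in> S"
        proof -
          have "dist (x + t *\<^sub>R (s *\<^sub>R a)) x \<le> s * c"
            using near[of t 0] t by (simp add: dist_norm)
          then show ?thesis using s by (intro subsetD[OF d2(2)]) (simp add: d_def dist_commute)
        qed
        have 1: "((\<lambda>t. f (x + t *\<^sub>R (s *\<^sub>R a) + s *\<^sub>R b)) has_derivative (\<lambda>u. G (x + t *\<^sub>R (s *\<^sub>R a) + s *\<^sub>R b) \<bullet> (u *\<^sub>R (s *\<^sub>R a)))) (at t)"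
          by (rule has_derivative_compose[where g = f and f = "\<lambda>t. x + t *\<^sub>R (s *\<^sub>R a) + s *\<^sub>R b"])
            (use f[OF i1] in \<open>auto intro!: derivative_eq_intros\<close>)
        have 2: "((\<lambda>t. f (x + t *\<^sub>R (s *\<^sub>R a))) has_derivative (\<lambda>u. G (x + t *\<^sub>R (s *\<^sub>R a)) \<bullet> (u *\<^sub>R (s *\<^sub>R a)))) (at t)"
          by (rule has_derivative_compose[where g = f and f = "\<lambda>t. x + t *\<^sub>R (s *\<^sub>R a)"])
            (use f[OF i2] in \<open>auto intro!: derivative_eq_intros\<close>)
        have "(h has_derivative (\<lambda>u. G (x + t *\<^sub>R (s *\<^sub>R a) + s *\<^sub>R b) \<bullet> (u *\<^sub>R (s *\<^sub>R a)) - G (x + t *\<^sub>R (s *\<^sub>R a)) \<bullet> (u *\<^sub>R (s *\<^sub>R a)))) (at t)"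
          unfolding h_def by (rule has_derivative_diff[OF 1 2])
        moreover have "(\<lambda>u. G (x + t *\<^sub>R (s *\<^sub>R a) + s *\<^sub>R b) \<bullet> (u *\<^sub>R (s *\<^sub>R a)) - G (x + t *\<^sub>R (s *\<^sub>R a)) \<bullet> (u *\<^sub>R (s *\<^sub>R a))) = (*) (h' t)"
          by (rule ext) (simp add: h'_def inner_diff_left algebra_simps)
        ultimately show ?thesis by (simp add: has_field_derivative_def)
      qed
      obtain t where t: "0 < t" "t < 1" "h 1 - h 0 = (1 - 0) * h' t"
        using MVT2[of 0 1 h h'] der by auto
      let ?y1 = "x + t *\<^sub>R (s *\<^sub>R a) + s *\<^sub>R b" and ?y0 = "x + t *\<^sub>R (s *\<^sub>R a)"
      have n1: "norm (?y1 - x) \<le> s * c" using near[of t 1] t by (simp add: add.assoc)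
      have n0: "norm (?y0 - x) \<le> s * c" using near[of t 0] t by simp
      have e1: "norm (G ?y1 - G x - D (?y1 - x)) \<le> e * (s * c)"
        using d1(2)[of ?y1] n1 s(2) e by (smt (verit) d_def mult_left_mono)
      have e0: "norm (G ?y0 - G x - D (?y0 - x)) \<le> e * (s * c)"
        using d1(2)[of ?y0] n0 s(2) e by (smt (verit) d_def mult_left_mono)
      have Db: "D (?y1 - x) - D (?y0 - x) = s *\<^sub>R D b"
        by (simp add: linear_add[OF lin] linear_cmul[OF lin])
      have "norm (G ?y1 - G ?y0 - s *\<^sub>R D b) \<le> 2 * (e * (s * c))"
      proof -
        have eq: "G ?y1 - G ?y0 - s *\<^sub>R D b = (G ?y1 - G x - D (?y1 - x)) - (G ?y0 - G x - D (?y0 - x))"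
          unfolding Db[symmetric] by simp
        show ?thesis unfolding eq mult_2
          by (rule norm_triangle_le_diff) (rule add_mono[OF e1 e0])
      qed
      moreover have "norm (s *\<^sub>R a) \<le> s * c" using near[of 1 0] by simp
      ultimately have "\<bar>(G ?y1 - G ?y0 - s *\<^sub>R D b) \<bullet> (s *\<^sub>R a)\<bar> \<le> 2 * (e * (s * c)) * (s * c)"
        using e s c by (intro order_trans[OF Cauchy_Schwarz_ineq2] mult_mono) auto
      moreover have "(G ?y1 - G ?y0 - s *\<^sub>R D b) \<bullet> (s *\<^sub>R a) = h' t - s\<^sup>2 * (D b \<bullet> a)"
        by (simp add: h'_def inner_diff_left power2_eq_square algebra_simps)
      moreover have "h 1 - h 0 = f (x + s *\<^sub>R a + s *\<^sub>R b) - f (x + s *\<^sub>R a) - f (x + s *\<^sub>R b) + f x"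
        by (simp add: h_def)
      ultimately show ?thesis using t(3) by (simp add: power2_eq_square algebra_simps)
    qed
    have q1: "\<bar>(f (x + s *\<^sub>R v + s *\<^sub>R w) - f (x + s *\<^sub>R v) - f (x + s *\<^sub>R w) + f x) - s\<^sup>2 * (D w \<bullet> v)\<bar> \<le> 2 * e * s\<^sup>2 * c\<^sup>2"
      by (rule Q) (simp add: c_def)
    have q2: "\<bar>(f (x + s *\<^sub>R v + s *\<^sub>R w) - f (x + s *\<^sub>R v) - f (x + s *\<^sub>R w) + f x) - s\<^sup>2 * (D v \<bullet> w)\<bar> \<le> 2 * e * s\<^sup>2 * c\<^sup>2"
      using Q[of w v] by (simp add: c_def algebra_simps)
    have "\<bar>s\<^sup>2 * (D v \<bullet> w) - s\<^sup>2 * (D w \<bullet> v)\<bar> \<le> 4 * e * s\<^sup>2 * c\<^sup>2" using q1 q2 by linarith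
    moreover have "\<bar>s\<^sup>2 * (D v \<bullet> w) - s\<^sup>2 * (D w \<bullet> v)\<bar> = s\<^sup>2 * \<bar>D v \<bullet> w - v \<bullet> D w\<bar>"
      unfolding right_diff_distrib[symmetric] abs_mult by (simp add: inner_commute)
    ultimately have "s\<^sup>2 * \<bar>D v \<bullet> w - v \<bullet> D w\<bar> \<le> s\<^sup>2 * (4 * e * c\<^sup>2)"
      by (simp add: mult.assoc mult.left_commute)
    then show ?thesis using s(1) by simp
  qed
  show ?thesis
  proof (rule ccontr)
    assume "D v \<bullet> w \<noteq> v \<bullet> D w"
    then have p: "0 < \<bar>D v \<bullet> w - v \<bullet> D w\<bar>" by simp
    have "0 < \<bar>D v \<bullet> w - v \<bullet> D w\<bar> / (8 * c\<^sup>2)" using p c by simp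
    from bnd[OF this] show False using p c by simp
  qed
qed

context smooth_norm
begin

definition Lam where "Lam = (SOME l. Lam_prop l)"
definition lam where "lam = (SOME l. lam_prop l)"

lemma Lam_pos: "0 < Lam"
  and quad_upper: "dp x p \<Longrightarrow> (\<phi> (p + h))\<^sup>2 / 2 \<le> (\<phi> p)\<^sup>2 / 2 + x \<bullet> h + Lam / 2 * (norm h)\<^sup>2"
  using someI_ex[OF Lam_exists] unfolding Lam_def[symmetric] by (auto simp: Lam_prop_def)

lemma lam_pos: "0 < lam"
  and quad_lower: "dp x p \<Longrightarrow> (\<phi> p)\<^sup>2 / 2 + x \<bullet> h + lam / 2 * (norm h)\<^sup>2 \<le> (\<phi> (p + h))\<^sup>2 / 2"
  using someI_ex[OF lam_exists] unfolding lam_def[symmetric] by (auto simp: lam_prop_def)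

text \<open>Dualises \<open>quad_upper\<close>: Fenchel's inequality at p + h and x + w, where h = w
  / \<open>Lam\<close> maximises \<open>h \<bullet> w\<close> minus the quadratic term in h.\<close>

lemma ps_quad_lower:
  assumes "dp x p" shows "(ps x)\<^sup>2 / 2 + p \<bullet> w + (norm w)\<^sup>2 / (2 * Lam) \<le> (ps (x + w))\<^sup>2 / 2"
proof -
  define h where "h = (1 / Lam) *\<^sub>R w"
  have "(p + h) \<bullet> (x + w) \<le> (\<phi> (p + h))\<^sup>2 / 2 + (ps (x + w))\<^sup>2 / 2" by (rule fenchel)
  moreover have "p \<bullet> x = (\<phi> p)\<^sup>2 / 2 + (ps x)\<^sup>2 / 2" using assms by (simp add: dp_iff)
  moreover note quad_upper[OF assms, of h]
  moreover have "h \<bullet> w - Lam / 2 * (norm h)\<^sup>2 = (norm w)\<^sup>2 / (2 * Lam)"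
    using Lam_pos by (simp add: h_def power_mult_distrib power_divide dot_square_norm power2_eq_square field_simps)
  ultimately show ?thesis by (simp add: inner_add_left inner_add_right inner_commute[of x h])
qed

text \<open>Dualises \<open>quad_lower\<close>: for the vector v paired with x + w, the convexity
  gain in v - p absorbs \<open>(v - p) \<bullet> w\<close> by Young's inequality.\<close>

lemma ps_quad_upper:
  assumes "dp x p" shows "(ps (x + w))\<^sup>2 / 2 \<le> (ps x)\<^sup>2 / 2 + p \<bullet> w + (norm w)\<^sup>2 / (2 * lam)"
proof -
  obtain v where v: "dp (x + w) v" using dp_exists by blast
  have "v \<bullet> (x + w) = (\<phi> v)\<^sup>2 / 2 + (ps (x + w))\<^sup>2 / 2" using v by (simp add: dp_iff)
  moreover have "p \<bullet> x = (\<phi> p)\<^sup>2 / 2 + (ps x)\<^sup>2 / 2" using assms by (simp add: dp_iff)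
  moreover have "(\<phi> p)\<^sup>2 / 2 + x \<bullet> (v - p) + lam / 2 * (norm (v - p))\<^sup>2 \<le> (\<phi> v)\<^sup>2 / 2"
    using quad_lower[OF assms, of "v - p"] by simp
  moreover note young_inner[OF lam_pos, of "v - p" w]
  ultimately show ?thesis by (simp add: inner_diff_left inner_diff_right inner_add_left inner_add_right inner_commute[of x])
qed

text \<open>Add the quadratic bounds at the two base points, each evaluated at the other
  one.\<close>

lemma dp_strongly_monotone:
  assumes "dp x p" "dp y q"
  shows "lam * (norm (p - q))\<^sup>2 \<le> (x - y) \<bullet> (p - q)" "(norm (x - y))\<^sup>2 / Lam \<le> (x - y) \<bullet> (p - q)"
proof -
  have "lam * (norm (p - q))\<^sup>2 = lam / 2 * (norm (q - p))\<^sup>2 + lam / 2 * (norm (p - q))\<^sup>2"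
    by (simp add: norm_minus_commute)
  then show "lam * (norm (p - q))\<^sup>2 \<le> (x - y) \<bullet> (p - q)"
    using quad_lower[OF assms(1), of "q - p"] quad_lower[OF assms(2), of "p - q"]
    by (simp add: inner_diff_left inner_diff_right)
  have "(norm (x - y))\<^sup>2 / Lam = (norm (y - x))\<^sup>2 / (2 * Lam) + (norm (x - y))\<^sup>2 / (2 * Lam)"
    by (simp add: norm_minus_commute)
  then show "(norm (x - y))\<^sup>2 / Lam \<le> (x - y) \<bullet> (p - q)"
    using ps_quad_lower[OF assms(1), of "y - x"] ps_quad_lower[OF assms(2), of "x - y"]
    by (simp add: inner_diff_left inner_diff_right inner_commute)
qed

lemma dp_Lipschitz:
  assumes "dp x p" "dp y q"
  shows "norm (p - q) \<le> norm (x - y) / lam" "norm (x - y) \<le> Lam * norm (p - q)"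
proof -
  have cs: "(x - y) \<bullet> (p - q) \<le> norm (x - y) * norm (p - q)" by (rule norm_cauchy_schwarz)
  show "norm (p - q) \<le> norm (x - y) / lam"
  proof (cases "p = q")
    case False
    have "(lam * norm (p - q)) * norm (p - q) \<le> norm (x - y) * norm (p - q)"
      using dp_strongly_monotone(1)[OF assms] cs by (simp add: power2_eq_square)
    then show ?thesis using False lam_pos by (simp add: field_simps)
  qed (use lam_pos in simp)
  show "norm (x - y) \<le> Lam * norm (p - q)"
  proof (cases "x = y")
    case False
    have "norm (x - y) * (norm (x - y) / Lam) \<le> norm (x - y) * norm (p - q)"
      using dp_strongly_monotone(2)[OF assms] cs by (simp add: power2_eq_square)
    then show ?thesis using False Lam_pos by (simp add: field_simps)
  qed (use Lam_pos in simp)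
qed

lemma dp_unique: "dp x p \<Longrightarrow> dp x q \<Longrightarrow> p = q" and dp_unique_left: "dp x p \<Longrightarrow> dp y p \<Longrightarrow> x = y"
  using dp_Lipschitz[of x p x q] dp_Lipschitz[of x p y p] by auto

definition J where "J x = (THE p. dp x p)"

lemma dp_J: "dp x (J x)"
  unfolding J_def by (rule theI') (use dp_exists dp_unique in blast)

lemma J_eq: "dp x p \<Longrightarrow> J x = p"
  using dp_J dp_unique by blast

lemma J_scale: "J (c *\<^sub>R x) = c *\<^sub>R J x"
  by (rule J_eq) (rule dp_scale[OF dp_J])

lemma J_minus: "J (- x) = - J x"
  using J_scale[of "-1" x] by simp

lemma J_eq_0_iff [simp]: "J x = 0 \<longleftrightarrow> x = 0"
  using dp_zero[OF dp_J] by auto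

lemma J_0 [simp]: "J 0 = 0" by simp

lemma J_inj: "J x = J y \<Longrightarrow> x = y"
  using dp_unique_left dp_J by metis

lemma phi_J: "\<phi> (J x) = ps x" and J_inner: "J x \<bullet> x = (ps x)\<^sup>2"
  by (rule dp_phi[OF dp_J], rule dp_inner[OF dp_J])

lemma J_Lipschitz: "norm (J x - J y) \<le> norm (x - y) / lam"
  by (rule dp_Lipschitz[OF dp_J dp_J])

lemma continuous_J: "continuous (at x) J"
  unfolding continuous_at Lim_at dist_norm
proof (intro allI impI)
  fix e :: real assume "0 < e"
  have "norm (J y - J x) < e" if "norm (y - x) < e * lam" for y
  proof -
    have "norm (y - x) / lam < e" using that lam_pos by (simp add: divide_less_eq)
    then show ?thesis using J_Lipschitz[of y x] by linarith
  qed
  then show "\<exists>d>0. \<forall>y. 0 < norm (y - x) \<and> norm (y - x) < d \<longrightarrow> norm (J y - J x) < e"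
    using lam_pos \<open>0 < e\<close> by (intro exI[of _ "e * lam"]) auto
qed

lemma has_derivative_ps_sq: "((\<lambda>x. (ps x)\<^sup>2 / 2) has_derivative (\<lambda>w. J x \<bullet> w)) (at x)"
proof (rule has_derivative_quadratic_remainder[where r = 1 and C = "1 / (2 * lam)"])
  fix y
  have "0 \<le> (norm (y - x))\<^sup>2 / (2 * Lam)" using Lam_pos by simp
  then show "norm ((ps y)\<^sup>2 / 2 - (ps x)\<^sup>2 / 2 - J x \<bullet> (y - x)) \<le> 1 / (2 * lam) * (norm (y - x))\<^sup>2"
    using ps_quad_lower[OF dp_J, of x "y - x"] ps_quad_upper[OF dp_J, of x "y - x"]
    unfolding real_norm_def by (simp add: abs_le_iff)
qed (simp_all add: bounded_linear_inner_right)

text \<open>\<open>J\<close> inverts G, the gradient of half the squared norm. Away from 0 the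
  derivative of G is symmetric as a Hessian and coercive by strong monotonicity, so it is
  invertible, and the inverse is again symmetric and positive.\<close>

lemma J_differentiable:
  assumes "x0 \<noteq> 0"
  obtains K where "(J has_derivative K) (at x0)" "\<And>v w. K v \<bullet> w = v \<bullet> K w" "\<And>v. v \<noteq> 0 \<Longrightarrow> 0 < K v \<bullet> v"
proof -
  define p0 where "p0 = J x0"
  have p0: "p0 \<noteq> 0" using assms by (simp add: p0_def)
  define G where "G = (\<lambda>p. \<phi> p *\<^sub>R dphi p)"
  define S where "S = (\<lambda>h. \<phi> p0 *\<^sub>R d2phi p0 h + (dphi p0 \<bullet> h) *\<^sub>R dphi p0)"
  have dG: "(G has_derivative S) (at p0)"
    unfolding G_def S_def
    by (rule has_derivative_scaleR[OF has_derivative_phi[OF p0] has_derivative_dphi[OF p0]])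
  \<comment> \<open>At p = 0 the value of \<open>dphi\<close> is unspecified, but the factor
    \<open>\<phi> 0\<close> = 0 removes it.\<close>
  have dpG: "dp (G p) p" for p
    unfolding G_def by (cases "p = 0") (use dp_dphi[of p] in \<open>simp_all add: dp_def\<close>)
  have GJ: "G (J x) = x" for x
    using dp_unique_left[OF dpG dp_J] .
  have lin: "linear S" using dG by (rule has_derivative_linear)
  have symS: "S v \<bullet> w = v \<bullet> S w" for v w
  proof (rule gradient_derivative_symmetric[where S = "UNIV - {0}" and f = "\<lambda>p. (\<phi> p)\<^sup>2 / 2"])
    fix y :: 'a assume "y \<in> UNIV - {0}"
    then have "y \<noteq> 0" by simp
    show "((\<lambda>p. (\<phi> p)\<^sup>2 / 2) has_derivative (\<bullet>) (G y)) (at y)"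
      using has_derivative_phi[OF \<open>y \<noteq> 0\<close>]
      by (auto intro!: derivative_eq_intros simp: G_def fun_eq_iff)
  qed (use dG p0 in \<open>auto simp: open_Diff\<close>)
  have coer: "lam * (norm h)\<^sup>2 \<le> S h \<bullet> h" for h
  proof -
    have "((\<lambda>s. G (p0 + s *\<^sub>R h)) has_derivative (\<lambda>u. S (u *\<^sub>R h))) (at 0)"
      by (rule has_derivative_compose[where g = G and f = "\<lambda>s. p0 + s *\<^sub>R h"])
        (use dG in \<open>auto intro!: derivative_eq_intros\<close>)
    then have "((\<lambda>s. G (p0 + s *\<^sub>R h) \<bullet> h) has_derivative (\<lambda>u. S (u *\<^sub>R h) \<bullet> h)) (at 0)"
      by (rule has_derivative_inner_left)
    then have "((\<lambda>s. G (p0 + s *\<^sub>R h) \<bullet> h) has_real_derivative (S h \<bullet> h)) (at 0)"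
      by (simp add: has_field_derivative_def linear_cmul[OF lin] mult_commute_abs)
    then have "((\<lambda>s. G (p0 + s *\<^sub>R h) \<bullet> h - G p0 \<bullet> h - lam * s * (norm h)\<^sup>2) has_real_derivative (S h \<bullet> h - lam * (norm h)\<^sup>2)) (at 0)"
      by (auto intro!: derivative_eq_intros)
    then have "0 \<le> S h \<bullet> h - lam * (norm h)\<^sup>2"
    proof (rule right_derivative_nonneg)
      fix s :: real assume s: "0 < s"
      have "s * (lam * s * (norm h)\<^sup>2) \<le> s * (G (p0 + s *\<^sub>R h) \<bullet> h - G p0 \<bullet> h)"
        using dp_strongly_monotone(1)[OF dpG dpG, of "p0 + s *\<^sub>R h" p0]
        by (simp add: power_mult_distrib inner_diff_left power2_eq_square algebra_simps)
      then show "0 \<le> G (p0 + s *\<^sub>R h) \<bullet> h - G p0 \<bullet> h - lam * s * (norm h)\<^sup>2" using s by simp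
    qed simp
    then show ?thesis by simp
  qed
  have "inj S"
  proof (rule linear_injective_0[OF lin, THEN iffD2], intro allI impI)
    fix h assume "S h = 0"
    then have "lam * (norm h)\<^sup>2 \<le> 0" using coer[of h] by simp
    then have "(norm h)\<^sup>2 \<le> 0" using lam_pos by (simp add: mult_le_0_iff)
    then show "h = 0" by simp
  qed
  then obtain K where K: "linear K" "\<And>x. K (S x) = x" "\<And>x. S (K x) = x"
    using linear_injective_isomorphism[OF lin] by blast
  have "(J has_derivative K) (at x0)"
  proof (rule has_derivative_inverse_basic[where f = G and f' = S and T = UNIV])
    show "(G has_derivative S) (at (J x0))" using dG by (simp add: p0_def)
    show "bounded_linear K" using K(1) by (simp add: linear_conv_bounded_linear)
  qed (use K GJ continuous_J in auto)
  moreover have "K v \<bullet> w = v \<bullet> K w" for v w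
    using symS[of "K v" "K w"] K(3) by simp
  moreover have "0 < K v \<bullet> v" if "v \<noteq> 0" for v
  proof -
    have "K v \<noteq> 0" using K(3)[of v] linear_0[OF lin] that by auto
    then have "0 < lam * (norm (K v))\<^sup>2" using lam_pos by simp
    then show ?thesis using coer[of "K v"] K(3)[of v] by (simp add: inner_commute)
  qed
  ultimately show ?thesis using that by blast
qed

end

section \<open>Sets of positive reach\<close>

lemma power2_norm_diff:
  fixes a b :: "'a::real_inner"
  shows "(norm (a - b))\<^sup>2 = (norm a)\<^sup>2 - 2 * (a \<bullet> b) + (norm b)\<^sup>2"
  by (simp add: power2_norm_eq_inner inner_diff_left inner_diff_right inner_commute[of b a])

lemma infdist_eqI:
  assumes "c \<in> A" "dist x c = t" "\<And>c'. c' \<in> A \<Longrightarrow> t \<le> dist x c'"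
  shows "infdist x A = t"
proof (rule antisym)
  show "infdist x A \<le> t" using infdist_le[OF assms(1), of x] assms(2) by simp
  have "A \<noteq> {}" using assms(1) by auto
  then show "t \<le> infdist x A"
    unfolding infdist_notempty[OF \<open>A \<noteq> {}\<close>] by (rule cINF_greatest) (rule assms(3))
qed

text \<open>By compactness, points of A away from P x are farther from x than P x by a fixed gap g;
  moving x by less than g / 2 cannot make one of them nearest.\<close>

lemma continuous_on_unique_nearest:
  fixes A :: "'a::euclidean_space set"
  assumes A: "closed A" "A \<noteq> {}"
    and U: "\<And>x c. x \<in> U \<Longrightarrow> c \<in> A \<Longrightarrow> dist x c = infdist x A \<Longrightarrow> c = P x"
    and P: "\<And>x. x \<in> U \<Longrightarrow> P x \<in> A \<and> dist x (P x) = infdist x A"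
  shows "continuous_on U P"
  unfolding continuous_on_iff
proof (intro ballI allI impI)
  fix x e assume x: "x \<in> U" and e: "(0::real) < e"
  \<comment> \<open>A point y within 1 of x has its nearest point within
    \<open>infdist x A + 2\<close> of x, whence the radius.\<close>
  define K where "K = A \<inter> (cball x (infdist x A + 2) - ball (P x) e)"
  have K: "compact K" unfolding K_def
    by (rule closed_Int_compact[OF A(1)]) (rule compact_diff, auto)
  obtain g where g: "0 < g" "\<And>c. c \<in> K \<Longrightarrow> infdist x A + g \<le> dist x c"
  proof (cases "K = {}")
    case False
    obtain c0 where c0: "c0 \<in> K" "\<And>c. c \<in> K \<Longrightarrow> dist x c0 \<le> dist x c"
      using continuous_attains_inf[OF K False continuous_on_dist[OF continuous_on_const continuous_on_id], of x]
      by auto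
    have "dist x c0 \<noteq> infdist x A" using U[OF x, of c0] c0(1) e by (auto simp: K_def)
    then have "infdist x A < dist x c0" using infdist_le[of c0 A x] c0(1) by (auto simp: K_def)
    then show ?thesis using c0(2) by (intro that[of "dist x c0 - infdist x A"]) auto
  qed (use that[of 1] in auto)
  have "dist (P y) (P x) < e" if y: "y \<in> U" "dist y x < min 1 (g / 2)" for y
  proof -
    have "infdist y A \<le> infdist x A + dist y x" by (rule infdist_triangle)
    then have l: "dist x (P y) \<le> infdist x A + 2 * dist y x"
      using P[OF y(1)] dist_triangle[of x "P y" y] by (simp add: dist_commute)
    then have "P y \<notin> K" using g(2)[of "P y"] y(2) by force
    then show ?thesis using P[OF y(1)] l y(2) by (auto simp: K_def dist_commute)
  qed
  then show "\<exists>d>0. \<forall>y\<in>U. dist y x < d \<longrightarrow> dist (P y) (P x) < e"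
    using g(1) by (intro exI[of _ "min 1 (g / 2)"]) auto
qed

text \<open>A fixed point y of the map sending y to the point of the sphere around x in the direction of
  y - P y has x on the segment from P y to y: it extends the normal ray through x beyond x.\<close>
lemma extend_normal_ray:
  fixes A :: "'a::euclidean_space set"
  assumes A: "closed A" "A \<noteq> {}"
    and uniq: "\<And>x. infdist x A < \<rho>0 \<Longrightarrow> \<exists>!c. c \<in> A \<and> dist x c = infdist x A"
    and c: "c \<in> A" "norm n = 1" and \<tau>: "0 < \<tau>" "\<tau> < \<rho>" "\<rho> < \<rho>0" "infdist (c + \<tau> *\<^sub>R n) A = \<tau>"
  obtains t where "\<tau> < t" "t \<le> \<rho>" "infdist (c + t *\<^sub>R n) A = t"
proof -
  define P where "P = (\<lambda>x. THE c. c \<in> A \<and> dist x c = infdist x A)"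
  define U where "U = {x. infdist x A < \<rho>0}"
  have P: "P x \<in> A \<and> dist x (P x) = infdist x A" if "x \<in> U" for x
    unfolding P_def by (rule theI') (use uniq that in \<open>simp add: U_def\<close>)
  have PU: "c = P x" if "x \<in> U" "c \<in> A" "dist x c = infdist x A" for x c
    using uniq[of x] P[OF that(1)] that by (auto simp: U_def)
  have contP: "continuous_on U P" by (rule continuous_on_unique_nearest[OF A PU P])
  define x where "x = c + \<tau> *\<^sub>R n"
  \<comment> \<open>The bound \<tau> / 3 keeps the distance to A above s on the ball, and \<rho> -
    \<tau> keeps the ball where nearest points are unique.\<close>
  define s where "s = min (\<tau> / 3) (\<rho> - \<tau>)"
  have s: "0 < s" "s \<le> \<tau> / 3" "s \<le> \<rho> - \<tau>" using \<tau> unfolding s_def by linarith+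
  have dy: "\<tau> - s \<le> infdist y A" "infdist y A \<le> \<tau> + s" if "y \<in> cball x s" for y
    using that infdist_triangle[of x A y] infdist_triangle[of y A x] \<tau>(4)
    by (auto simp: x_def dist_commute)
  have cU: "cball x s \<subseteq> U" using dy s \<tau> by (force simp: U_def)
  define T where "T = (\<lambda>y. x + (s / infdist y A) *\<^sub>R (y - P y))"
  have "continuous_on (cball x s) T"
    unfolding T_def using dy(1) s
    by (intro continuous_intros continuous_on_subset[OF contP cU]) fastforce
  moreover have "T \<in> cball x s \<rightarrow> cball x s"
  proof
    fix y assume y: "y \<in> cball x s"
    then have "norm (y - P y) = infdist y A" using P[of y] cU by (auto simp: dist_norm)
    moreover have "0 < infdist y A" using dy(1)[OF y] s by linarith
    ultimately show "T y \<in> cball x s" using s(1) by (simp add: T_def dist_norm)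
  qed
  ultimately obtain y where y: "y \<in> cball x s" "T y = y" using brouwer_ball[OF s(1)] by blast
  define d where "d = infdist y A"
  have yU: "y \<in> U" using y cU by auto
  have d: "s < d" using dy(1)[OF y(1)] s \<tau>(1) by (simp add: d_def)
  have ny: "norm (y - P y) = d" using P[OF yU] by (simp add: d_def dist_norm)
  have yx: "y - x = (s / d) *\<^sub>R (y - P y)" using y(2) by (simp add: T_def d_def algebra_simps)
  have xP: "x - P y = ((d - s) / d) *\<^sub>R (y - P y)"
  proof -
    have "x - P y = (y - P y) - (y - x)" by simp
    also have "\<dots> = (1 - s / d) *\<^sub>R (y - P y)" unfolding yx by (simp only: scaleR_diff_left scaleR_one)
    also have "1 - s / d = (d - s) / d" using d s by (simp add: diff_divide_distrib)
    finally show ?thesis .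
  qed
  have dxP: "dist x (P y) = d - s"
    using xP ny d s(1) by (simp add: dist_norm)
  have dyx: "dist y x = s" using yx ny d s by (simp add: dist_norm)
  \<comment> \<open>Equality in both distance estimates makes P y a nearest point of x too, hence
    equal to c.\<close>
  have tau: "\<tau> = d - s"
  proof (rule antisym)
    show "\<tau> \<le> d - s" using infdist_le[of "P y" A x] P[OF yU] dxP \<tau>(4) by (simp add: x_def)
    show "d - s \<le> \<tau>" using infdist_triangle[of y A x] dyx \<tau>(4) by (simp add: d_def x_def)
  qed
  have xU: "x \<in> U" using \<tau> by (simp add: U_def x_def)
  have "P y = P x" using PU[OF xU, of "P y"] P[OF yU] dxP tau \<tau>(4) by (simp add: x_def)
  moreover have "c = P x" using PU[OF xU, of c] c \<tau> by (simp add: x_def dist_norm)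
  ultimately have Pc: "P y = c" by simp
  have "\<tau> *\<^sub>R n = (\<tau> / d) *\<^sub>R (y - c)" using xP Pc tau by (simp add: x_def)
  then have "(d / \<tau>) *\<^sub>R (\<tau> *\<^sub>R n) = (d / \<tau>) *\<^sub>R ((\<tau> / d) *\<^sub>R (y - c))" by simp
  then have "d *\<^sub>R n = y - c" using \<tau>(1) d s(1) by simp
  then have "y = c + d *\<^sub>R n" by (simp add: algebra_simps)
  then have "infdist (c + d *\<^sub>R n) A = d" by (simp add: d_def)
  then show ?thesis using tau s by (intro that[of d]) auto
qed

text \<open>A normal ray that realises the distance for a short time does so up to length \<rho>:
  the largest admissible length is attained by compactness, and \<open>extend_normal_ray\<close>
  would exceed a smaller one. Expanding the square for the resulting touching ball gives the
  inequality.\<close>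

lemma reach_normal_ineq:
  fixes A :: "'a::euclidean_space set"
  assumes A: "closed A" "A \<noteq> {}" and r: "reach A > 0"
  obtains \<rho> where "0 < \<rho>"
    "\<And>c n c'. n \<in> Nunit A c \<Longrightarrow> c' \<in> A \<Longrightarrow> n \<bullet> (c' - c) \<le> (norm (c' - c))\<^sup>2 / (2 * \<rho>)"
proof -
  obtain \<rho>0 where \<rho>0: "0 < \<rho>0" "\<And>x. infdist x A < \<rho>0 \<Longrightarrow> \<exists>!c. c \<in> A \<and> dist x c = infdist x A"
    using r unfolding reach_def less_Sup_iff by auto
  \<comment> \<open>Strictly below an admissible radius, as \<open>extend_normal_ray\<close> needs
    room around points at distance up to \<rho>.\<close>
  define \<rho> where "\<rho> = \<rho>0 / 2"
  have \<rho>: "0 < \<rho>" "\<rho> < \<rho>0" using \<rho>0 by (auto simp: \<rho>_def)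
  have "n \<bullet> (c' - c) \<le> (norm (c' - c))\<^sup>2 / (2 * \<rho>)" if n: "n \<in> Nunit A c" and c': "c' \<in> A" for c n c'
  proof -
    from n obtain r where c: "c \<in> A" and n1: "norm n = 1" and r: "0 < r" "infdist (c + r *\<^sub>R n) A = r"
      by (auto simp: Nunit_def)
    define T where "T = {t \<in> {0..\<rho>}. infdist (c + t *\<^sub>R n) A - t = 0}"
    have "closed T" unfolding T_def
      by (intro continuous_closed_preimage_constant continuous_intros)
    moreover have "bounded T" by (rule bounded_subset[OF bounded_closed_interval[of 0 \<rho>]]) (auto simp: T_def)
    ultimately have T: "compact T" by (simp add: compact_eq_bounded_closed)
    define t0 where "t0 = min r \<rho>"
    have t0: "0 < t0" "t0 \<le> \<rho>" "t0 \<le> r" using r \<rho> by (auto simp: t0_def)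
    have "infdist (c + t0 *\<^sub>R n) A = t0"
    proof (rule infdist_eqI[OF c])
      show "dist (c + t0 *\<^sub>R n) c = t0" using n1 t0 by (simp add: dist_norm)
      fix c1 assume "c1 \<in> A"
      then have "r \<le> dist (c + r *\<^sub>R n) c1" using infdist_le r by metis
      also have "\<dots> \<le> dist (c + r *\<^sub>R n) (c + t0 *\<^sub>R n) + dist (c + t0 *\<^sub>R n) c1" by (rule dist_triangle)
      also have "dist (c + r *\<^sub>R n) (c + t0 *\<^sub>R n) = r - t0"
        using n1 t0 by (simp add: dist_norm scaleR_diff_left[symmetric])
      finally show "t0 \<le> dist (c + t0 *\<^sub>R n) c1" by simp
    qed
    then have t0T: "t0 \<in> T" using t0 by (simp add: T_def)
    then obtain \<tau> where tt: "\<tau> \<in> T" "\<And>t. t \<in> T \<Longrightarrow> t \<le> \<tau>" using compact_attains_sup[OF T] by auto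
    have "\<tau> = \<rho>"
    proof (rule ccontr)
      assume "\<tau> \<noteq> \<rho>"
      then have "\<tau> < \<rho>" using tt(1) by (auto simp: T_def)
      moreover have "0 < \<tau>" using tt(2)[OF t0T] t0 by simp
      ultimately obtain t where "\<tau> < t" "t \<le> \<rho>" "infdist (c + t *\<^sub>R n) A = t"
        using extend_normal_ray[OF A \<rho>0(2) c n1 _ _ \<rho>(2)] tt(1) by (auto simp: T_def)
      then show False using tt(2)[of t] \<open>0 < \<tau>\<close> by (auto simp: T_def)
    qed
    then have "infdist (c + \<rho> *\<^sub>R n) A = \<rho>" using tt(1) by (simp add: T_def)
    then have "\<rho> \<le> norm (\<rho> *\<^sub>R n - (c' - c))" using infdist_le[OF c', of "c + \<rho> *\<^sub>R n"]
      by (simp add: dist_norm algebra_simps)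
    then have "\<rho>\<^sup>2 \<le> (norm (\<rho> *\<^sub>R n - (c' - c)))\<^sup>2" using \<rho> by (intro power_mono) auto
    also have "\<dots> = \<rho>\<^sup>2 - 2 * \<rho> * (n \<bullet> (c' - c)) + (norm (c' - c))\<^sup>2"
      using n1 by (simp add: power2_norm_diff)
    finally show ?thesis using \<rho> by (simp add: field_simps)
  qed
  then show ?thesis using that \<rho>(1) by blast
qed

section \<open>The anisotropic distance function\<close>

locale smooth_norm_set = smooth_norm \<phi> for \<phi> :: "'a::euclidean_space \<Rightarrow> real" +
  fixes A :: "'a set"
  assumes closed_A: "closed A" and nonempty_A: "A \<noteq> {}"
begin

abbreviation \<delta> where "\<delta> \<equiv> delta_phi \<phi> A"
abbreviation \<xi> where "\<xi> \<equiv> xi_phi \<phi> A"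

lemma delta_attained: obtains c where "c \<in> A" "ps (x - c) = \<delta> x" "\<And>c'. c' \<in> A \<Longrightarrow> \<delta> x \<le> ps (x - c')"
proof -
  obtain m M where m: "0 < m" "\<And>x. m * norm x \<le> ps x"
    by (rule is_norm_fun_bounds[OF is_norm_fun_ps]) blast
  obtain c0 where c0: "c0 \<in> A" using nonempty_A by blast
  define K where "K = A \<inter> cball x (ps (x - c0) / m)"
  have "norm (x - c0) \<le> ps (x - c0) / m" using m(2)[of "x - c0"] m(1) by (simp add: field_simps)
  then have c0K: "c0 \<in> K" using c0 by (simp add: K_def dist_norm)
  have "compact K" unfolding K_def by (rule closed_Int_compact[OF closed_A compact_cball])
  moreover have "continuous_on K (\<lambda>c. ps (x - c))"
    by (rule continuous_on_compose2[OF continuous_ps]) (auto intro: continuous_intros)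
  ultimately obtain c where c: "c \<in> K" "\<And>c'. c' \<in> K \<Longrightarrow> ps (x - c) \<le> ps (x - c')"
    using continuous_attains_inf[of K "\<lambda>c. ps (x - c)"] c0K by blast
  have min: "ps (x - c) \<le> ps (x - c')" if "c' \<in> A" for c'
  proof (cases "c' \<in> K")
    case False
    then have "ps (x - c0) / m < norm (x - c')" using that by (auto simp: K_def dist_norm)
    then have "ps (x - c0) < m * norm (x - c')" using m(1) by (simp add: field_simps)
    then show ?thesis using m(2)[of "x - c'"] c(2)[OF c0K] by linarith
  qed (rule c(2))
  have "c \<in> A" using c(1) by (simp add: K_def)
  moreover have "\<delta> x = ps (x - c)" unfolding delta_phi_def
    by (rule cInf_eq_minimum) (use min \<open>c \<in> A\<close> in auto)
  ultimately show ?thesis using that min by auto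
qed

lemma delta_le: "c \<in> A \<Longrightarrow> \<delta> x \<le> ps (x - c)"
  by (rule delta_attained[of x])

lemma xi_nonempty: "\<exists>c. c \<in> \<xi> x"
  using delta_attained[of x] by (auto simp: xi_phi_def)

lemma xi_D: "c \<in> \<xi> x \<Longrightarrow> c \<in> A" "c \<in> \<xi> x \<Longrightarrow> ps (x - c) = \<delta> x"
  by (auto simp: xi_phi_def)

lemma delta_nonneg: "0 \<le> \<delta> x"
  using xi_nonempty[of x] xi_D(2)[of _ x] ps_nonneg by metis

lemma delta_zero_iff: "\<delta> x = 0 \<longleftrightarrow> x \<in> A"
proof
  assume "\<delta> x = 0"
  then show "x \<in> A" using xi_nonempty[of x] xi_D[of _ x] by (metis ps_zero_iff right_minus_eq)
next
  assume "x \<in> A"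
  then show "\<delta> x = 0" using delta_le[of x x] delta_nonneg[of x] by simp
qed

lemma delta_pos: "x \<notin> A \<longleftrightarrow> 0 < \<delta> x"
  using delta_zero_iff[of x] delta_nonneg[of x] by auto

lemma delta_triangle: "\<delta> x \<le> \<delta> y + ps (x - y)"
proof -
  obtain c where "c \<in> \<xi> y" using xi_nonempty by blast
  then show ?thesis using delta_le[of c x] ps_tri[of "y - c" "x - y"] xi_D[of c y] by simp
qed

lemma continuous_delta: "continuous_on UNIV \<delta>"
proof -
  obtain m M where M: "0 < M" "\<And>x. ps x \<le> M * norm x"
    by (rule is_norm_fun_bounds[OF is_norm_fun_ps]) blast
  have "dist (\<delta> x) (\<delta> y) \<le> M * dist x y" for x y
    using delta_triangle[of x y] delta_triangle[of y x] M(2)[of "x - y"] ps_minus[of "x - y"]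
    by (simp add: dist_norm abs_le_iff)
  then have "M-lipschitz_on UNIV \<delta>" using M(1) by (intro lipschitz_onI) auto
  then show ?thesis by (rule lipschitz_on_continuous_on)
qed

lemma xi_contract:
  assumes "c \<in> \<xi> x" "0 \<le> s" "s \<le> 1"
  shows "\<delta> (c + s *\<^sub>R (x - c)) = s * \<delta> x" "c \<in> \<xi> (c + s *\<^sub>R (x - c))"
proof -
  let ?y = "c + s *\<^sub>R (x - c)"
  have c: "c \<in> A" "ps (x - c) = \<delta> x" using xi_D[OF assms(1)] .
  have 1: "ps (?y - c) = s * \<delta> x" using c assms by (simp add: ps_scale)
  have "x - ?y = (1 - s) *\<^sub>R (x - c)" by (simp add: algebra_simps)
  then have "ps (x - ?y) = (1 - s) * \<delta> x" using c assms by (simp add: ps_scale)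
  then have "s * \<delta> x \<le> \<delta> ?y" using delta_triangle[of x ?y] by (simp add: algebra_simps)
  then show "\<delta> ?y = s * \<delta> x" using delta_le[OF c(1), of ?y] 1 by simp
  then show "c \<in> \<xi> ?y" using 1 c by (simp add: xi_phi_def)
qed

lemma nu_iff: "x \<notin> A \<Longrightarrow> w \<in> nu_phi \<phi> A x \<longleftrightarrow> x - \<delta> x *\<^sub>R w \<in> \<xi> x"
proof -
  assume x: "x \<notin> A"
  then have d: "0 < \<delta> x" by (simp add: delta_pos)
  have "w = (1 / \<delta> x) *\<^sub>R (x - c) \<longleftrightarrow> c = x - \<delta> x *\<^sub>R w" for c
  proof
    assume "w = (1 / \<delta> x) *\<^sub>R (x - c)"
    then show "c = x - \<delta> x *\<^sub>R w" using d by simp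
  next
    assume "c = x - \<delta> x *\<^sub>R w"
    then have "x - c = \<delta> x *\<^sub>R w" by simp
    then show "w = (1 / \<delta> x) *\<^sub>R (x - c)" using d by simp
  qed
  then show ?thesis unfolding nu_phi_def by auto
qed

lemma nu_nonempty: "\<exists>w. w \<in> nu_phi \<phi> A x"
  using xi_nonempty[of x] by (auto simp: nu_phi_def)

lemma ps_nu: "x \<notin> A \<Longrightarrow> w \<in> nu_phi \<phi> A x \<Longrightarrow> ps w = 1"
  using nu_iff[of x w] xi_D(2)[of "x - \<delta> x *\<^sub>R w" x] delta_pos[of x] by (simp add: ps_scale)

lemma frontier_Wphi: "frontier (Wphi \<phi>) = {x. ps x = 1}"
proof -
  have cl: "closed (Wphi \<phi>)" unfolding Wphi_def
    by (rule closed_Collect_le) (auto intro: continuous_ps continuous_intros)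
  have "interior (Wphi \<phi>) = {x. ps x < 1}"
  proof (rule interior_unique)
    show "open {x. ps x < 1}" by (rule open_Collect_less) (auto intro: continuous_ps continuous_intros)
    fix T assume T: "T \<subseteq> Wphi \<phi>" "open T"
    show "T \<subseteq> {x. ps x < 1}"
    proof
      fix x assume "x \<in> T"
      then obtain e where e: "0 < e" "ball x e \<subseteq> T" using T(2) openE by blast
      define n where "n = norm x + 1"
      define k where "k = e / (2 * n)"
      have nx: "0 < n" by (simp add: n_def add_nonneg_pos)
      have k: "0 < k" using e nx by (simp add: k_def)
      have "k * norm x < e" 
      proof -
        have "k * norm x \<le> k * n" using k by (simp add: n_def)
        also have "\<dots> = e / 2" using nx by (simp add: k_def)
        finally show ?thesis using e by simp
      qed
      then have "(1 + k) *\<^sub>R x \<in> ball x e" using k by (simp add: dist_norm scaleR_add_left)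
      then have "ps ((1 + k) *\<^sub>R x) \<le> 1" using e(2) T(1) unfolding Wphi_def by blast
      then have "(1 + k) * ps x \<le> 1" using k by (simp add: ps_scale)
      then have "ps x \<le> 1 / (1 + k)" using k by (simp add: field_simps)
      also have "\<dots> < 1" using k by simp
      finally have "ps x < 1" .
      then show "x \<in> {x. ps x < 1}" by simp
    qed
  qed (auto simp: Wphi_def)
  then show ?thesis unfolding frontier_def closure_closed[OF cl] by (simp add: Wphi_def set_diff_eq not_less) (simp add: order_eq_iff)
qed

lemma Nphi_iff: "(a, \<eta>) \<in> Nphi \<phi> A \<longleftrightarrow> a \<in> A \<and> ps \<eta> = 1 \<and> (\<exists>r>0. \<delta> (a + r *\<^sub>R \<eta>) = r)"
  by (simp add: Nphi_def frontier_Wphi)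

text \<open>Comparing the distances to c' and c through \<open>ps_quad_upper\<close> shows that an
  anisotropic nearest point is a Euclidean proximal one, with normal direction
  \<open>J (x - c)\<close>.\<close>

lemma proximal:
  assumes "c \<in> \<xi> x" "c' \<in> A"
  shows "J (x - c) \<bullet> (c' - c) \<le> (norm (c' - c))\<^sup>2 / (2 * lam)"
proof -
  have "(ps (x - c))\<^sup>2 \<le> (ps (x - c'))\<^sup>2"
    using delta_le[OF assms(2), of x] xi_D[OF assms(1)] delta_nonneg[of x] by (intro power_mono) auto
  moreover have "(ps (x - c'))\<^sup>2 / 2 \<le> (ps (x - c))\<^sup>2 / 2 + J (x - c) \<bullet> (c - c') + (norm (c' - c))\<^sup>2 / (2 * lam)"
    using ps_quad_upper[OF dp_J, of "x - c" "c - c'"] by (simp add: norm_minus_commute)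
  moreover have "J (x - c) \<bullet> (c - c') = - (J (x - c) \<bullet> (c' - c))" by (simp add: inner_diff_right)
  ultimately show ?thesis by linarith
qed

text \<open>The bridge to the Euclidean hypothesis: with p = \<open>J (x - c)\<close>,
  \<open>proximal\<close> says that the ball of radius \<open>lam\<close> |p| about c +
  \<open>lam\<close> p has no point of A in its interior.\<close>

lemma proximal_Nunit:
  assumes "c \<in> \<xi> x" "x \<notin> A"
  shows "(1 / norm (J (x - c))) *\<^sub>R J (x - c) \<in> Nunit A c"
proof -
  have c: "c \<in> A" using xi_D[OF assms(1)] by auto
  define p where "p = J (x - c)"
  have p: "p \<noteq> 0" using c assms(2) by (auto simp: p_def)
  have "infdist (c + (lam * norm p) *\<^sub>R ((1 / norm p) *\<^sub>R p)) A = lam * norm p"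
  proof (rule infdist_eqI[OF c])
    show "dist (c + (lam * norm p) *\<^sub>R ((1 / norm p) *\<^sub>R p)) c = lam * norm p"
      using p lam_pos by (simp add: dist_norm)
    fix c' assume "c' \<in> A"
    then have "2 * lam * (p \<bullet> (c' - c)) \<le> (norm (c' - c))\<^sup>2"
      using proximal[OF assms(1), of c'] lam_pos by (simp add: p_def field_simps)
    moreover have "(norm (lam *\<^sub>R p - (c' - c)))\<^sup>2 = (lam * norm p)\<^sup>2 - 2 * lam * (p \<bullet> (c' - c)) + (norm (c' - c))\<^sup>2"
      by (simp add: power2_norm_diff power_mult_distrib)
    ultimately have "(lam * norm p)\<^sup>2 \<le> (norm (lam *\<^sub>R p - (c' - c)))\<^sup>2" by simp
    then have "lam * norm p \<le> norm (lam *\<^sub>R p - (c' - c))" by (rule power2_le_imp_le) simp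
    then show "lam * norm p \<le> dist (c + (lam * norm p) *\<^sub>R ((1 / norm p) *\<^sub>R p)) c'"
      using p by (simp add: dist_norm algebra_simps)
  qed
  then show ?thesis using c p lam_pos unfolding Nunit_def p_def[symmetric]
    by (auto intro!: exI[of _ "lam * norm p"])
qed

text \<open>The ball around a + s eta touching A at a lies inside the larger touching ball around a + r eta;
  strong convexity of the squared dual norm quantifies by how much other points of A are farther away.\<close>
lemma xi_calm_on_ray:
  assumes a: "a \<in> A" "ps \<eta> = 1" and r: "0 < s" "s < r" "\<delta> (a + r *\<^sub>R \<eta>) = r"
  obtains C where "0 < C" "\<And>z c. c \<in> \<xi> z \<Longrightarrow> norm (c - a) \<le> C * norm (z - (a + s *\<^sub>R \<eta>))"
proof -
  define \<theta> where "\<theta> = s / r"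
  have th: "0 < \<theta>" "\<theta> < 1" "\<theta> * r = s" using r by (auto simp: \<theta>_def)
  define \<kappa> where "\<kappa> = (1 - \<theta>) / (2 * Lam)"
  have \<kappa>: "0 < \<kappa>" using th Lam_pos by (simp add: \<kappa>_def)
  have gain: "s\<^sup>2 / 2 + \<kappa> * (norm d)\<^sup>2 \<le> (ps (s *\<^sub>R \<eta> - d))\<^sup>2 / 2" if "a + d \<in> A" for d
  proof -
    define e where "e = (1 / s) *\<^sub>R d"
    have d: "d = s *\<^sub>R e" using r by (simp add: e_def)
    \<comment> \<open>Equivalently y = (1 - \<theta>) \<eta> + \<theta> (\<eta> - e). The larger
      touching ball keeps \<open>ps y\<close> at least 1.\<close>
    define y where "y = \<eta> - \<theta> *\<^sub>R e"
    have "r \<le> ps (r *\<^sub>R \<eta> - d)" using delta_le[OF that, of "a + r *\<^sub>R \<eta>"] r(3) by simp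
    also have "r *\<^sub>R \<eta> - d = r *\<^sub>R y" using th(3) by (simp add: y_def d algebra_simps)
    finally have "1 \<le> ps y" using r by (simp add: ps_scale)
    then have y: "1 / 2 \<le> (ps y)\<^sup>2 / 2" by (simp add: one_le_power)
    have 1: "(ps y)\<^sup>2 / 2 + \<theta> * (J y \<bullet> e) + \<theta>\<^sup>2 * (norm e)\<^sup>2 / (2 * Lam) \<le> 1 / 2"
      using ps_quad_lower[OF dp_J, of y "\<theta> *\<^sub>R e"] a(2) by (simp add: y_def power_mult_distrib)
    have "y + (\<theta> - 1) *\<^sub>R e = \<eta> - e" by (simp add: y_def algebra_simps)
    then have 2: "(ps y)\<^sup>2 / 2 + (\<theta> - 1) * (J y \<bullet> e) + (1 - \<theta>)\<^sup>2 * (norm e)\<^sup>2 / (2 * Lam) \<le> (ps (\<eta> - e))\<^sup>2 / 2"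
      using ps_quad_lower[OF dp_J, of y "(\<theta> - 1) *\<^sub>R e"] by (simp add: power_mult_distrib power2_commute)
    define N where "N = (norm e)\<^sup>2 / (2 * Lam)"
    \<comment> \<open>With weights 1 - \<theta> and \<theta> the linear terms in
      \<open>J y \<bullet> e\<close> cancel.\<close>
    have h1: "(1 - \<theta>) * ((ps y)\<^sup>2 / 2 + \<theta> * (J y \<bullet> e) + \<theta>\<^sup>2 * N) \<le> (1 - \<theta>) * (1 / 2)"
      using 1 th by (intro mult_left_mono) (auto simp: N_def)
    have h2: "\<theta> * ((ps y)\<^sup>2 / 2 + (\<theta> - 1) * (J y \<bullet> e) + (1 - \<theta>)\<^sup>2 * N) \<le> \<theta> * ((ps (\<eta> - e))\<^sup>2 / 2)"
      using 2 th by (intro mult_left_mono) (auto simp: N_def)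
    have "(ps y)\<^sup>2 / 2 + \<theta> * (1 - \<theta>) * N \<le> (1 - \<theta>) * (1 / 2) + \<theta> * ((ps (\<eta> - e))\<^sup>2 / 2)"
    proof -
      have "(1 - \<theta>) * (Y + \<theta> * b + \<theta>\<^sup>2 * N) + \<theta> * (Y + (\<theta> - 1) * b + (1 - \<theta>)\<^sup>2 * N) = Y + \<theta> * (1 - \<theta>) * N" for Y b
        by (simp add: algebra_simps power2_eq_square)
      then show ?thesis using add_mono[OF h1 h2] by (simp only:)
    qed
    then have "\<theta> * (1 / 2 + (1 - \<theta>) * N) \<le> \<theta> * ((ps (\<eta> - e))\<^sup>2 / 2)"
    proof -
      have "\<theta> * (1 / 2 + (1 - \<theta>) * N) = \<theta> * (1 - \<theta>) * N + \<theta> / 2" "(1 - \<theta>) * (1 / 2) = 1 / 2 - \<theta> / 2"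
        by (simp_all add: field_simps)
      then show ?thesis using y \<open>(ps y)\<^sup>2 / 2 + \<theta> * (1 - \<theta>) * N \<le> (1 - \<theta>) * (1 / 2) + \<theta> * ((ps (\<eta> - e))\<^sup>2 / 2)\<close>
        by linarith
    qed
    then have "1 / 2 + (1 - \<theta>) * N \<le> (ps (\<eta> - e))\<^sup>2 / 2" using th by simp
    then have "s\<^sup>2 * (1 / 2 + (1 - \<theta>) * N) \<le> s\<^sup>2 * ((ps (\<eta> - e))\<^sup>2 / 2)" by (intro mult_left_mono) auto
    moreover have "ps (s *\<^sub>R \<eta> - d) = s * ps (\<eta> - e)"
      using r(1) ps_scale[of s "\<eta> - e"] by (simp add: d scaleR_diff_right)
    moreover have "s\<^sup>2 * (1 / 2 + (1 - \<theta>) * N) = s\<^sup>2 / 2 + \<kappa> * (norm d)\<^sup>2"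
      by (simp add: d \<kappa>_def N_def power_mult_distrib distrib_left)
    ultimately show ?thesis by (simp add: power_mult_distrib)
  qed
  \<comment> \<open>Larger than 1, so that a violation forces |q| <= |d|, and larger than 2 /
    (\<kappa> \<open>lam\<close>), which closes the contradiction.\<close>
  define C where "C = 2 / (\<kappa> * lam) + 1"
  have C: "1 < C" using \<kappa> lam_pos by (simp add: C_def)
  have "norm (c - a) \<le> C * norm (z - (a + s *\<^sub>R \<eta>))" if c: "c \<in> \<xi> z" for z c
  proof (rule ccontr)
    define q where "q = z - (a + s *\<^sub>R \<eta>)"
    define d where "d = c - a"
    assume "\<not> norm (c - a) \<le> C * norm (z - (a + s *\<^sub>R \<eta>))"
    then have big: "C * norm q < norm d" by (simp add: q_def d_def)
    have dpos: "0 < norm d" using big C by (smt (verit) mult_nonneg_nonneg norm_ge_zero)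
    have qd: "norm q \<le> norm d" using big C by (smt (verit) mult_right_mono norm_ge_zero mult_cancel_right1)
    have "c \<in> A" "ps (z - c) = \<delta> z" using xi_D[OF c] .
    then have "(ps (z - c))\<^sup>2 \<le> (ps (z - a))\<^sup>2" using delta_le[OF a(1), of z] delta_nonneg[of z] by (intro power_mono) auto
    moreover have "(ps (z - a))\<^sup>2 / 2 \<le> s\<^sup>2 / 2 + J (s *\<^sub>R \<eta>) \<bullet> q + (norm q)\<^sup>2 / (2 * lam)"
      using ps_quad_upper[OF dp_J, of "s *\<^sub>R \<eta>" q] a(2) r(1) by (simp add: q_def ps_scale)
    moreover have "(ps (s *\<^sub>R \<eta> - d))\<^sup>2 / 2 + J (s *\<^sub>R \<eta> - d) \<bullet> q \<le> (ps (z - c))\<^sup>2 / 2"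
    proof -
      have "s *\<^sub>R \<eta> - d + q = z - c" by (simp add: d_def q_def)
      moreover have "0 \<le> (norm q)\<^sup>2 / (2 * Lam)" using Lam_pos by simp
      ultimately show ?thesis using ps_quad_lower[OF dp_J, of "s *\<^sub>R \<eta> - d" q] by simp
    qed
    moreover have "s\<^sup>2 / 2 + \<kappa> * (norm d)\<^sup>2 \<le> (ps (s *\<^sub>R \<eta> - d))\<^sup>2 / 2"
      using gain[of d] \<open>c \<in> A\<close> by (simp add: d_def)
    moreover have "(J (s *\<^sub>R \<eta>) - J (s *\<^sub>R \<eta> - d)) \<bullet> q \<le> norm d / lam * norm q"
    proof -
      have "norm (J (s *\<^sub>R \<eta>) - J (s *\<^sub>R \<eta> - d)) \<le> norm d / lam"
        using J_Lipschitz[of "s *\<^sub>R \<eta>" "s *\<^sub>R \<eta> - d"] by simp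
      then show ?thesis by (intro order_trans[OF norm_cauchy_schwarz] mult_right_mono) auto
    qed
    ultimately have "\<kappa> * (norm d)\<^sup>2 \<le> norm d / lam * norm q + (norm q)\<^sup>2 / (2 * lam)"
      unfolding inner_diff_left by linarith
    also have "\<dots> \<le> norm d / lam * norm q + norm d / lam * norm q"
    proof (rule add_left_mono)
      have "(norm q)\<^sup>2 \<le> norm d * norm q" unfolding power2_eq_square using qd by (rule mult_right_mono) simp
      then have "(norm q)\<^sup>2 / (2 * lam) \<le> (norm d * norm q) / lam"
        using lam_pos by (intro frac_le) auto
      then show "(norm q)\<^sup>2 / (2 * lam) \<le> norm d / lam * norm q" by simp
    qed
    finally have "norm d * (\<kappa> * lam * norm d) \<le> norm d * (2 * norm q)"
      using lam_pos by (simp add: power2_eq_square field_simps)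
    then have "\<kappa> * lam * norm d \<le> 2 * norm q" using dpos by simp
    then have "norm d \<le> 2 / (\<kappa> * lam) * norm q" using \<kappa> lam_pos by (simp add: field_simps)
    also have "\<dots> \<le> C * norm q" by (rule mult_right_mono) (simp_all add: C_def)
    finally show False using big by simp
  qed
  then show ?thesis using that[of C] C by auto
qed

end

section \<open>Sliding along normal rays\<close>

context smooth_norm_set
begin

text \<open>On the way to its nearest point a point keeps that nearest point, so a normal found at y
  is also a normal at every retracted point.\<close>

lemma nu_retract:
  assumes "y \<notin> A" "w \<in> nu_phi \<phi> A y" "0 \<le> \<tau>" "\<tau> < \<delta> y"
  shows "\<delta> (y - \<tau> *\<^sub>R w) = \<delta> y - \<tau>" "y - \<tau> *\<^sub>R w \<notin> A" "w \<in> nu_phi \<phi> A (y - \<tau> *\<^sub>R w)"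
    "y - \<delta> y *\<^sub>R w \<in> \<xi> (y - \<tau> *\<^sub>R w)"
proof -
  define c where "c = y - \<delta> y *\<^sub>R w"
  have d: "0 < \<delta> y" using assms(1) delta_pos by simp
  have c: "c \<in> \<xi> y" using nu_iff[OF assms(1)] assms(2) by (simp add: c_def)
  define k where "k = (\<delta> y - \<tau>) / \<delta> y"
  have k: "0 \<le> k" "k \<le> 1" "k * \<delta> y = \<delta> y - \<tau>" using d assms by (auto simp: k_def)
  have "c + k *\<^sub>R (y - c) = y - \<delta> y *\<^sub>R w + (k * \<delta> y) *\<^sub>R w" by (simp add: c_def)
  also have "\<dots> = y - \<tau> *\<^sub>R w" unfolding k(3) by (simp add: algebra_simps)
  finally have y: "c + k *\<^sub>R (y - c) = y - \<tau> *\<^sub>R w" .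
  show 1: "\<delta> (y - \<tau> *\<^sub>R w) = \<delta> y - \<tau>" using xi_contract(1)[OF c k(1,2)] y k(3) by simp
  then show 2: "y - \<tau> *\<^sub>R w \<notin> A" using assms(4) delta_pos by simp
  show 3: "y - \<delta> y *\<^sub>R w \<in> \<xi> (y - \<tau> *\<^sub>R w)" using xi_contract(2)[OF c k(1,2)] unfolding y unfolding c_def .
  have "y - \<tau> *\<^sub>R w - (\<delta> y - \<tau>) *\<^sub>R w = y - \<delta> y *\<^sub>R w" by (simp add: algebra_simps)
  then show "w \<in> nu_phi \<phi> A (y - \<tau> *\<^sub>R w)" using 3 unfolding nu_iff[OF 2] 1 by (simp only:)
qed

lemma ray_point:
  assumes "a \<in> A" "ps \<eta> = 1" "0 < r" "\<delta> (a + r *\<^sub>R \<eta>) = r"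
  shows "a \<in> \<xi> (a + r *\<^sub>R \<eta>)" "a + r *\<^sub>R \<eta> \<notin> A" "\<eta> \<in> nu_phi \<phi> A (a + r *\<^sub>R \<eta>)"
proof -
  show 1: "a \<in> \<xi> (a + r *\<^sub>R \<eta>)" using assms by (simp add: xi_phi_def ps_scale)
  show 2: "a + r *\<^sub>R \<eta> \<notin> A" using assms delta_pos by simp
  show "\<eta> \<in> nu_phi \<phi> A (a + r *\<^sub>R \<eta>)" using nu_iff[OF 2] 1 assms by simp
qed

lemma ray_contract:
  assumes "a \<in> A" "ps \<eta> = 1" "0 < r" "\<delta> (a + r *\<^sub>R \<eta>) = r" "0 \<le> s" "s \<le> r"
  shows "\<delta> (a + s *\<^sub>R \<eta>) = s"
  using xi_contract(1)[OF ray_point(1)[OF assms(1-4)], of "s / r"] assms by simp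

lemma ps_norm_bounds: obtains m M where "0 < m" "0 < M" "\<And>x. m * norm x \<le> ps x" "\<And>x. ps x \<le> M * norm x"
  by (rule is_norm_fun_bounds[OF is_norm_fun_ps]) blast

lemma delta_Lipschitz: obtains M where "0 < M" "\<And>x y. \<bar>\<delta> x - \<delta> y\<bar> \<le> M * norm (x - y)"
proof -
  obtain m M where M: "0 < M" "\<And>x. ps x \<le> M * norm x" by (rule ps_norm_bounds) blast
  have "\<bar>\<delta> x - \<delta> y\<bar> \<le> M * norm (x - y)" for x y
    using delta_triangle[of x y] delta_triangle[of y x] M(2)[of "x - y"] ps_minus[of "x - y"]
    by (simp add: abs_le_iff)
  then show ?thesis using that M(1) by blast
qed

text \<open>Divides \<open>xi_calm_on_ray\<close> by the distance to A; the radius s / (2 M) keeps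
  that distance at least s / 2.\<close>

lemma nu_calm_on_ray:
  assumes a: "a \<in> A" "ps \<eta> = 1" and r: "0 < s" "s < r" "\<delta> (a + r *\<^sub>R \<eta>) = r"
  obtains C e where "0 < C" "0 < e"
    "\<And>z w. norm (z - (a + s *\<^sub>R \<eta>)) < e \<Longrightarrow> w \<in> nu_phi \<phi> A z \<Longrightarrow> norm (w - \<eta>) \<le> C * norm (z - (a + s *\<^sub>R \<eta>))"
proof -
  obtain C where C: "0 < C" "\<And>z c. c \<in> \<xi> z \<Longrightarrow> norm (c - a) \<le> C * norm (z - (a + s *\<^sub>R \<eta>))"
    using xi_calm_on_ray[OF a r] by blast
  obtain M where M: "0 < M" "\<And>x y. \<bar>\<delta> x - \<delta> y\<bar> \<le> M * norm (x - y)" using delta_Lipschitz by blast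
  have ds: "\<delta> (a + s *\<^sub>R \<eta>) = s" using ray_contract[OF a _ r(3), of s] r by simp
  define C1 where "C1 = (1 + C + M * norm \<eta>) * (2 / s)"
  define e where "e = s / (2 * M)"
  have C1: "0 < C1" using C(1) M(1) r(1) unfolding C1_def
    by (intro mult_pos_pos add_pos_nonneg) auto
  have "norm (w - \<eta>) \<le> C1 * norm (z - (a + s *\<^sub>R \<eta>))" if z: "norm (z - (a + s *\<^sub>R \<eta>)) < e" and w: "w \<in> nu_phi \<phi> A z" for z w
  proof -
    let ?q = "z - (a + s *\<^sub>R \<eta>)"
    have dl: "\<bar>\<delta> z - s\<bar> \<le> M * norm ?q" using M(2)[of z "a + s *\<^sub>R \<eta>"] ds by simp
    also have "M * norm ?q < s / 2" using z M(1) by (simp add: e_def field_simps)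
    finally have dz: "s / 2 \<le> \<delta> z" by linarith
    then have "z \<notin> A" using r(1) delta_pos by simp
    then have cz: "z - \<delta> z *\<^sub>R w \<in> \<xi> z" using w nu_iff by blast
    define c where "c = z - \<delta> z *\<^sub>R w"
    have "\<delta> z *\<^sub>R (w - \<eta>) = ?q - (c - a) + (s - \<delta> z) *\<^sub>R \<eta>" by (simp add: c_def algebra_simps)
    then have "\<delta> z * norm (w - \<eta>) = norm (?q - (c - a) + (s - \<delta> z) *\<^sub>R \<eta>)"
      using dz r(1) by (metis abs_of_nonneg delta_nonneg norm_scaleR)
    also have "\<dots> \<le> norm (?q - (c - a)) + norm ((s - \<delta> z) *\<^sub>R \<eta>)" by (rule norm_triangle_ineq)
    also have "\<dots> \<le> (norm ?q + norm (c - a)) + \<bar>s - \<delta> z\<bar> * norm \<eta>"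
      by (rule add_mono[OF norm_triangle_ineq4]) simp
    also have "\<dots> \<le> (norm ?q + C * norm ?q) + (M * norm ?q) * norm \<eta>"
      using C(2)[OF cz] dl by (intro add_mono mult_right_mono) (auto simp: c_def abs_minus_commute)
    also have "\<dots> = (1 + C + M * norm \<eta>) * norm ?q" by (simp add: algebra_simps)
    finally have "\<delta> z * norm (w - \<eta>) \<le> (1 + C + M * norm \<eta>) * norm ?q" .
    moreover have "s / 2 * norm (w - \<eta>) \<le> \<delta> z * norm (w - \<eta>)" using dz by (intro mult_right_mono) auto
    ultimately have "s / 2 * norm (w - \<eta>) \<le> (1 + C + M * norm \<eta>) * norm ?q" by linarith
    then have "2 / s * (s / 2 * norm (w - \<eta>)) \<le> 2 / s * ((1 + C + M * norm \<eta>) * norm ?q)"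
      using r(1) by (intro mult_left_mono) auto
    then show ?thesis using r(1) by (simp add: C1_def mult_ac) (simp add: algebra_simps)
  qed
  moreover have "0 < e" using r(1) M(1) by (simp add: e_def)
  ultimately show ?thesis using that C1 by blast
qed

lemma nu_diff_D:
  assumes "nu_diff_with \<phi> A x L" "\<eta> \<in> nu_phi \<phi> A x"
  shows "nu_pt \<phi> A x = \<eta>" "linear L" "x \<notin> A"
    "\<And>e. 0 < e \<Longrightarrow> \<exists>d>0. \<forall>y w. y \<notin> A \<and> norm (y - x) < d \<and> w \<in> nu_phi \<phi> A y \<longrightarrow> norm (w - \<eta> - L (y - x)) \<le> e * norm (y - x)"
proof -
  obtain w where "nu_phi \<phi> A x = {w}" using assms(1) by (auto simp: nu_diff_with_def)
  then have "nu_phi \<phi> A x = {\<eta>}" using assms(2) by simp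
  then show 1: "nu_pt \<phi> A x = \<eta>" by (simp add: nu_pt_def)
  show "linear L" "x \<notin> A"
    "\<And>e. 0 < e \<Longrightarrow> \<exists>d>0. \<forall>y w. y \<notin> A \<and> norm (y - x) < d \<and> w \<in> nu_phi \<phi> A y \<longrightarrow> norm (w - \<eta> - L (y - x)) \<le> e * norm (y - x)"
    using assms(1) unfolding nu_diff_with_def 1 by auto
qed

text \<open>Moving in the direction of a kernel vector of I - tau L leaves the retracted points stationary to
  first order but turns the normals, against the calmness of the normal field at interior points of the ray.\<close>
lemma retraction_derivative_injective:
  assumes a: "a \<in> A" "ps \<eta> = 1" and r: "\<delta> (a + r *\<^sub>R \<eta>) = r"
    and L: "nu_diff_with \<phi> A (a + r *\<^sub>R \<eta>) L" and \<tau>: "0 < \<tau>" "\<tau> < r" and v: "v = \<tau> *\<^sub>R L v"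
  shows "v = 0"
proof (rule ccontr)
  assume v0: "v \<noteq> 0"
  define x where "x = a + r *\<^sub>R \<eta>"
  define s where "s = r - \<tau>"
  have s: "0 < s" "s < r" "0 < r" using \<tau> by (auto simp: s_def)
  have \<eta>: "\<eta> \<in> nu_phi \<phi> A x" using ray_point(3)[OF a s(3) r] by (simp add: x_def)
  have L': "nu_diff_with \<phi> A x L" using L by (simp add: x_def)
  note nd = nu_diff_D[OF L' \<eta>]
  obtain C e0 where C: "0 < C" "0 < e0"
    "\<And>z w. norm (z - (a + s *\<^sub>R \<eta>)) < e0 \<Longrightarrow> w \<in> nu_phi \<phi> A z \<Longrightarrow> norm (w - \<eta>) \<le> C * norm (z - (a + s *\<^sub>R \<eta>))"
    using nu_calm_on_ray[OF a s(1,2) r] by blast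
  \<comment> \<open>Makes (1 + C \<tau>) e equal to 1 / (2 \<tau>), so that the final estimate
    bounds a positive number by its half.\<close>
  define e where "e = 1 / (2 * \<tau> * (1 + C * \<tau>))"
  have e: "0 < e" using \<tau> C by (auto simp: e_def intro!: divide_pos_pos mult_pos_pos add_pos_pos)
  obtain d where d: "0 < d" "\<And>y w. y \<notin> A \<Longrightarrow> norm (y - x) < d \<Longrightarrow> w \<in> nu_phi \<phi> A y \<Longrightarrow> norm (w - \<eta> - L (y - x)) \<le> e * norm (y - x)"
    using nd(4)[OF e] by blast
  obtain M where M: "0 < M" "\<And>x y. \<bar>\<delta> x - \<delta> y\<bar> \<le> M * norm (x - y)" using delta_Lipschitz by blast
  \<comment> \<open>The three bounds keep y where the derivative estimate holds,
    \<open>\<delta> y\<close> above \<tau>, and z where the normals are calm.\<close>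
  define D where "D = min d (min (s / (2 * M)) (e0 / (\<tau> * e)))"
  have D: "0 < D" using d s M C(2) \<tau> e by (simp add: D_def)
  define t where "t = D / (2 * norm v)"
  have t: "0 < t" "t * norm v < D" using D v0 by (auto simp: t_def)
  define y where "y = x + t *\<^sub>R v"
  have ny: "norm (y - x) = t * norm v" using t by (simp add: y_def)
  have "\<bar>\<delta> y - r\<bar> \<le> M * norm (y - x)" using M(2)[of y x] r by (simp add: x_def)
  also have "\<dots> \<le> M * (s / (2 * M))" using t(2) M(1) ny by (intro mult_left_mono) (auto simp: D_def)
  also have "\<dots> = s / 2" using M(1) by simp
  finally have dy: "\<tau> < \<delta> y" using s(1) abs_ge_minus_self[of "\<delta> y - r"] s_def by linarith
  then have yA: "y \<notin> A" using \<tau> delta_pos by simp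
  obtain w where w: "w \<in> nu_phi \<phi> A y" using nu_nonempty by blast
  define z where "z = y - \<tau> *\<^sub>R w"
  have wz: "w \<in> nu_phi \<phi> A z" unfolding z_def using nu_retract(3)[OF yA w] \<tau> dy by simp
  define q where "q = w - \<eta> - L (y - x)"
  have q: "norm q \<le> e * (t * norm v)" using d(2)[OF yA _ w] t(2) ny by (simp add: q_def D_def)
  have Lt: "L (y - x) = t *\<^sub>R L v" using linear_cmul[OF nd(2)] by (simp add: y_def)
  have "\<tau> *\<^sub>R L (y - x) = t *\<^sub>R v" unfolding Lt using arg_cong[OF v, of "scaleR t"] by (simp add: mult.commute)
  \<comment> \<open>The relation v = \<tau> L v cancels the first-order displacement; only the
    remainder q is left.\<close>
  then have zq: "z - (a + s *\<^sub>R \<eta>) = - (\<tau> *\<^sub>R q)"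
    by (simp add: z_def y_def x_def s_def q_def algebra_simps)
  have "norm (z - (a + s *\<^sub>R \<eta>)) \<le> \<tau> * (e * (t * norm v))" unfolding zq using q \<tau> by simp
  also have "\<dots> < \<tau> * e * D" using t(2) \<tau> e by (simp add: mult.assoc)
  also have "\<dots> \<le> \<tau> * e * (e0 / (\<tau> * e))" using \<tau> e by (intro mult_left_mono) (auto simp: D_def)
  also have "\<dots> = e0" using \<tau> e by simp
  finally have near: "norm (z - (a + s *\<^sub>R \<eta>)) < e0" .
  have "norm (w - \<eta>) \<le> C * norm (z - (a + s *\<^sub>R \<eta>))" by (rule C(3)[OF near wz])
  then have wn: "norm (w - \<eta>) \<le> C * \<tau> * (e * (t * norm v))"
    unfolding zq using q \<tau> C(1) by (simp add: mult.assoc) (meson mult_left_mono less_imp_le order_trans)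
  have "(t / \<tau>) *\<^sub>R v = (w - \<eta>) - q"
    using Lt v \<tau> by (simp add: q_def) (metis divide_self_if less_irrefl mult.commute scaleR_one scaleR_scaleR times_divide_eq_left)
  then have "t / \<tau> * norm v \<le> norm (w - \<eta>) + norm q"
    using norm_triangle_ineq4[of "w - \<eta>" q] t \<tau> by (metis abs_of_pos divide_pos_pos norm_scaleR)
  also have "\<dots> \<le> (C * \<tau> + 1) * (e * (t * norm v))" using wn q by (simp add: distrib_right)
  also have "\<dots> = (t * norm v) * ((1 + C * \<tau>) * e)" by (simp add: mult_ac add.commute)
  also have "(1 + C * \<tau>) * e = 1 / (2 * \<tau>)"
  proof -
    have "0 < 1 + C * \<tau>" using C(1) \<tau> by (intro add_pos_pos mult_pos_pos) auto
    then show ?thesis by (simp add: e_def)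
  qed
  finally have "t * norm v / \<tau> \<le> t * norm v / \<tau> / 2" by (simp add: mult.commute)
  moreover have "0 < t * norm v / \<tau>" using t v0 \<tau> by simp
  moreover have "k \<le> k / 2 \<Longrightarrow> 0 < k \<Longrightarrow> False" for k :: real by simp
  ultimately show False by blast
qed

end

section \<open>The tube of unique nearest points\<close>

text \<open>Positive reach enters through the conclusion of \<open>reach_normal_ineq\<close>, with
  \<open>rho\<close> as its constant.\<close>

locale reach_set = smooth_norm_set \<phi> A for \<phi> :: "'a::euclidean_space \<Rightarrow> real" and A +
  fixes rho :: real
  assumes rho_pos: "0 < rho"
    and normal_ineq: "\<And>c n c'. n \<in> Nunit A c \<Longrightarrow> c' \<in> A \<Longrightarrow> n \<bullet> (c' - c) \<le> (norm (c' - c))\<^sup>2 / (2 * rho)"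
begin

text \<open>The homogeneous form of \<open>normal_ineq\<close>. Its factor
  |\<open>J (z - c)\<close>| is small near A, so there the defect of monotonicity of the normals
  becomes small as well.\<close>

lemma J_normal_ineq:
  assumes "c \<in> \<xi> z" "c' \<in> A"
  shows "J (z - c) \<bullet> (c' - c) \<le> norm (J (z - c)) * ((norm (c' - c))\<^sup>2 / (2 * rho))"
proof (cases "z \<in> A")
  case True
  then have "z - c = 0" using xi_D(2)[OF assms(1)] delta_zero_iff by (metis ps_zero_iff)
  then have "J (z - c) = 0" by simp
  then show ?thesis by simp
next
  case False
  then have J0: "J (z - c) \<noteq> 0" using xi_D(1)[OF assms(1)] by auto
  have "((1 / norm (J (z - c))) *\<^sub>R J (z - c)) \<bullet> (c' - c) \<le> (norm (c' - c))\<^sup>2 / (2 * rho)"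
    by (rule normal_ineq[OF proximal_Nunit[OF assms(1) False] assms(2)])
  then have "norm (J (z - c)) * (((1 / norm (J (z - c))) *\<^sub>R J (z - c)) \<bullet> (c' - c)) \<le> norm (J (z - c)) * ((norm (c' - c))\<^sup>2 / (2 * rho))"
    by (rule mult_left_mono) simp
  then show ?thesis using J0 by simp
qed

definition CT where "CT = 2 * Lam / lam + 1"

lemma CT_pos: "1 < CT" using Lam_pos lam_pos by (simp add: CT_def)

text \<open>Let X, Z, E be the lengths of the changes of z - c, z and c. The two normal inequalities
  and strong monotonicity of \<open>J\<close> give X^2 / Lam <= Z X / lam + E^2 / (4 Lam). Since E
  <= X + Z, half of the left side absorbs the contribution of X to the last term.\<close>

lemma tube_exists:
  "\<exists>d>0. \<forall>z1 z2 c1 c2. \<delta> z1 < d \<longrightarrow> \<delta> z2 < d \<longrightarrow> c1 \<in> \<xi> z1 \<longrightarrow> c2 \<in> \<xi> z2 \<longrightarrow>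
     norm ((z1 - c1) - (z2 - c2)) \<le> CT * norm (z1 - z2)"
proof -
  obtain m M where m: "0 < m" "\<And>x. m * norm x \<le> ps x" by (rule ps_norm_bounds) blast
  define Cp where "Cp = 1 / (m * lam)"
  have Cp: "0 < Cp" using m lam_pos by (simp add: Cp_def)
  have Jle: "norm (J x) \<le> Cp * ps x" for x
  proof -
    have "norm (J x) \<le> norm x / lam" using J_Lipschitz[of x 0] by simp
    also have "\<dots> \<le> (ps x / m) / lam" using m(2)[of x] m(1) lam_pos by (intro divide_right_mono) (auto simp: field_simps)
    finally show ?thesis by (simp add: Cp_def)
  qed
  \<comment> \<open>Makes \<open>Cp * d / (2 * rho)\<close> equal to 1 / (8 Lam), so each normal
    inequality costs at most E^2 / (8 Lam).\<close>
  define d where "d = rho / (4 * Lam * Cp)"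
  have d: "0 < d" using rho_pos Lam_pos Cp by (simp add: d_def)
  have "norm ((z1 - c1) - (z2 - c2)) \<le> CT * norm (z1 - z2)"
    if z: "\<delta> z1 < d" "\<delta> z2 < d" and c: "c1 \<in> \<xi> z1" "c2 \<in> \<xi> z2" for z1 z2 c1 c2
  proof (rule ccontr)
    define x1 x2 where "x1 = z1 - c1" and "x2 = z2 - c2"
    define X Z E where "X = norm (x1 - x2)" and "Z = norm (z1 - z2)" and "E = norm (c2 - c1)"
    \<comment> \<open>This negation gives Z <= X, which allows Z^2 to be replaced by Z X at the
      end.\<close>
    assume "\<not> norm ((z1 - c1) - (z2 - c2)) \<le> CT * norm (z1 - z2)"
    then have big: "CT * Z < X" by (simp add: X_def Z_def x1_def x2_def)
    have nn: "0 \<le> X" "0 \<le> Z" "0 \<le> E" by (auto simp: X_def Z_def E_def)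
    have ZX: "Z \<le> X" "0 < X"
    proof -
      have "Z \<le> CT * Z" using CT_pos nn by (simp add: mult_le_cancel_right1)
      then show "Z \<le> X" "0 < X" using big nn by linarith+
    qed
    have bound: "J (z - c) \<bullet> (c' - c) \<le> E\<^sup>2 / (8 * Lam)" if "\<delta> z < d" "c \<in> \<xi> z" "c' \<in> A" "norm (c' - c) = E" for z c c'
    proof -
      have "norm (J (z - c)) \<le> Cp * d"
      proof (rule order_trans[OF Jle])
        show "Cp * ps (z - c) \<le> Cp * d"
          using xi_D(2)[OF that(2)] that(1) Cp by (intro mult_left_mono) auto
      qed
      then have "norm (J (z - c)) * (E\<^sup>2 / (2 * rho)) \<le> Cp * d * (E\<^sup>2 / (2 * rho))"
        using rho_pos by (intro mult_right_mono) auto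
      also have "\<dots> = E\<^sup>2 / (8 * Lam)" using Cp rho_pos by (simp add: d_def)
      finally show ?thesis using J_normal_ineq[OF that(2,3)] that(4) by simp
    qed
    have b1: "J x1 \<bullet> (c2 - c1) \<le> E\<^sup>2 / (8 * Lam)" unfolding x1_def
      by (rule bound[OF z(1) c(1)]) (use xi_D(1)[OF c(2)] in \<open>auto simp: E_def\<close>)
    have b2: "J x2 \<bullet> (c1 - c2) \<le> E\<^sup>2 / (8 * Lam)" unfolding x2_def
      by (rule bound[OF z(2) c(2)]) (use xi_D(1)[OF c(1)] in \<open>auto simp: E_def norm_minus_commute\<close>)
    have "E \<le> X + Z"
    proof -
      have "c2 - c1 = (x1 - x2) - (z1 - z2)" by (simp add: x1_def x2_def)
      then show ?thesis unfolding E_def X_def Z_def by (metis norm_triangle_ineq4)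
    qed
    then have "E\<^sup>2 \<le> (X + Z)\<^sup>2" using nn by (intro power_mono) auto
    also have "\<dots> \<le> 2 * X\<^sup>2 + 2 * Z\<^sup>2" by (rule power2_sum_le)
    finally have E2: "E\<^sup>2 \<le> 2 * X\<^sup>2 + 2 * Z\<^sup>2" .
    have "X\<^sup>2 / Lam \<le> (x1 - x2) \<bullet> (J x1 - J x2)"
      unfolding X_def by (rule dp_strongly_monotone(2)[OF dp_J dp_J])
    also have "x1 - x2 = (z1 - z2) + (c2 - c1)" by (simp add: x1_def x2_def)
    also have "((z1 - z2) + (c2 - c1)) \<bullet> (J x1 - J x2) = (z1 - z2) \<bullet> (J x1 - J x2) + J x1 \<bullet> (c2 - c1) + J x2 \<bullet> (c1 - c2)"
      by (simp add: inner_add_left inner_add_right inner_diff_left inner_diff_right inner_commute)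
    also have "(z1 - z2) \<bullet> (J x1 - J x2) \<le> Z * (X / lam)"
      unfolding Z_def X_def
      by (rule order_trans[OF norm_cauchy_schwarz]) (rule mult_left_mono[OF J_Lipschitz norm_ge_zero])
    finally have F: "X\<^sup>2 / Lam \<le> Z * (X / lam) + J x1 \<bullet> (c2 - c1) + J x2 \<bullet> (c1 - c2)" by simp
    have F2: "E\<^sup>2 / (8 * Lam) \<le> (2 * X\<^sup>2 + 2 * Z\<^sup>2) / (8 * Lam)" using E2 Lam_pos by (intro divide_right_mono) auto
    have F3: "Z * (X / lam) + (2 * X\<^sup>2 + 2 * Z\<^sup>2) / (8 * Lam) + (2 * X\<^sup>2 + 2 * Z\<^sup>2) / (8 * Lam) = Z * (X / lam) + (X\<^sup>2 + Z\<^sup>2) / (2 * Lam)"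
      using Lam_pos by (simp add: add_divide_distrib)
    have "X\<^sup>2 / Lam \<le> Z * (X / lam) + (X\<^sup>2 + Z\<^sup>2) / (2 * Lam)" using F F2 F3 b1 b2 by linarith
    then have "2 * Lam * (X\<^sup>2 / Lam) \<le> 2 * Lam * (Z * (X / lam) + (X\<^sup>2 + Z\<^sup>2) / (2 * Lam))"
      using Lam_pos by (intro mult_left_mono) auto
    moreover have "2 * Lam * (X\<^sup>2 / Lam) = 2 * X\<^sup>2"
      "2 * Lam * (Z * (X / lam) + (X\<^sup>2 + Z\<^sup>2) / (2 * Lam)) = 2 * Lam / lam * Z * X + X\<^sup>2 + Z\<^sup>2"
      using Lam_pos by (simp_all add: distrib_left add_divide_distrib)
    ultimately have "X * X \<le> 2 * Lam / lam * Z * X + Z * Z" by (simp add: power2_eq_square)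
    also have "Z * Z \<le> Z * X" using ZX nn by (intro mult_left_mono) auto
    also have "2 * Lam / lam * Z * X + Z * X = CT * Z * X" by (simp add: CT_def distrib_right)
    finally have "X * X \<le> CT * Z * X" by simp
    then have "X \<le> CT * Z" using ZX by simp
    then show False using big by simp
  qed
  with d show ?thesis by blast
qed

definition d0 where "d0 = (SOME d. 0 < d \<and> (\<forall>z1 z2 c1 c2. \<delta> z1 < d \<longrightarrow> \<delta> z2 < d \<longrightarrow> c1 \<in> \<xi> z1 \<longrightarrow> c2 \<in> \<xi> z2 \<longrightarrow>
     norm ((z1 - c1) - (z2 - c2)) \<le> CT * norm (z1 - z2)))"

lemma d0_pos: "0 < d0"
  and tube: "\<lbrakk>\<delta> z1 < d0; \<delta> z2 < d0; c1 \<in> \<xi> z1; c2 \<in> \<xi> z2\<rbrakk> \<Longrightarrow>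
     norm ((z1 - c1) - (z2 - c2)) \<le> CT * norm (z1 - z2)"
  using someI_ex[OF tube_exists] unfolding d0_def[symmetric] by auto

lemma xi_unique: "\<delta> z < d0 \<Longrightarrow> c \<in> \<xi> z \<Longrightarrow> c' \<in> \<xi> z \<Longrightarrow> c = c'"
  using tube[of z z c c'] by simp

lemma open_tube: "open {z. \<delta> z < d0}"
  by (rule open_Collect_less) (auto intro: continuous_delta continuous_intros)

text \<open>A nearest point gives an upper quadratic bound for the squared distance. Used from z to
  y and from y to z it yields both sides, and \<open>tube\<close> controls the change of gradient
  between them.\<close>

lemma has_derivative_delta_sq:
  assumes "\<delta> z < d0" "c \<in> \<xi> z"
  shows "((\<lambda>z. (\<delta> z)\<^sup>2 / 2) has_derivative (\<lambda>h. J (z - c) \<bullet> h)) (at z)"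
proof -
  have upper: "(\<delta> y)\<^sup>2 / 2 \<le> (\<delta> x)\<^sup>2 / 2 + J (x - b) \<bullet> (y - x) + (norm (y - x))\<^sup>2 / (2 * lam)" if b: "b \<in> \<xi> x" for x y b
  proof -
    have "(\<delta> y)\<^sup>2 \<le> (ps (y - b))\<^sup>2" using delta_le[OF xi_D(1)[OF b], of y] delta_nonneg[of y] by (intro power_mono) auto
    moreover have "(ps (y - b))\<^sup>2 / 2 \<le> (\<delta> x)\<^sup>2 / 2 + J (x - b) \<bullet> (y - x) + (norm (y - x))\<^sup>2 / (2 * lam)"
      using ps_quad_upper[OF dp_J, of "x - b" "y - x"] xi_D(2)[OF b] by simp
    ultimately show ?thesis by linarith
  qed
  obtain e where e: "0 < e" "ball z e \<subseteq> {z. \<delta> z < d0}" using open_tube assms(1) openE by blast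
  show ?thesis
  proof (rule has_derivative_quadratic_remainder[where r = e and C = "CT / lam + 1 / (2 * lam)"])
    fix y assume y: "norm (y - z) < e"
    then have "y \<in> ball z e" by (simp add: dist_norm norm_minus_commute)
    then have dy: "\<delta> y < d0" using e(2) by blast
    obtain b where b: "b \<in> \<xi> y" using xi_nonempty by blast
    have "norm (J (y - b) - J (z - c)) \<le> CT / lam * norm (y - z)"
      using J_Lipschitz[of "y - b" "z - c"] tube[OF dy assms(1) b assms(2)] lam_pos
      by (simp add: field_simps)
    then have "\<bar>(J (y - b) - J (z - c)) \<bullet> (y - z)\<bar> \<le> CT / lam * norm (y - z) * norm (y - z)"
      by (intro order_trans[OF Cauchy_Schwarz_ineq2] mult_right_mono) auto
    moreover have "0 \<le> CT / lam * norm (y - z) * norm (y - z)" using CT_pos lam_pos by simp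
    moreover have "J (y - b) \<bullet> (z - y) = - (J (y - b) \<bullet> (y - z))" by (simp add: inner_diff_right)
    moreover have "(J (y - b) - J (z - c)) \<bullet> (y - z) = J (y - b) \<bullet> (y - z) - J (z - c) \<bullet> (y - z)"
      by (simp only: inner_diff_left)
    moreover note upper[OF assms(2), of y] upper[OF b, of z, unfolded norm_minus_commute[of z y]]
    moreover have "(CT / lam + 1 / (2 * lam)) * (norm (y - z))\<^sup>2 = CT / lam * norm (y - z) * norm (y - z) + (norm (y - z))\<^sup>2 / (2 * lam)"
      by (simp add: distrib_right power2_eq_square)
    ultimately show "norm ((\<delta> y)\<^sup>2 / 2 - (\<delta> z)\<^sup>2 / 2 - J (z - c) \<bullet> (y - z)) \<le> (CT / lam + 1 / (2 * lam)) * (norm (y - z))\<^sup>2"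
      unfolding real_norm_def by linarith
  qed (use e in \<open>simp_all add: bounded_linear_inner_right\<close>)
qed

text \<open>Normals arise from the vectors in \<open>tube\<close> by division by the distance to A,
  so the constant depends on the lower bound k.\<close>

lemma nu_Lipschitz:
  assumes "0 < k"
  obtains C where "0 < C" "\<And>z1 z2 w1 w2. \<lbrakk>k \<le> \<delta> z1; \<delta> z1 < d0; k \<le> \<delta> z2; \<delta> z2 < d0; w1 \<in> nu_phi \<phi> A z1; w2 \<in> nu_phi \<phi> A z2\<rbrakk>
    \<Longrightarrow> norm (w1 - w2) \<le> C * norm (z1 - z2)"
proof -
  obtain m M where m: "0 < m" "\<And>x. m * norm x \<le> ps x" by (rule ps_norm_bounds) blast
  obtain M where M: "0 < M" "\<And>x y. \<bar>\<delta> x - \<delta> y\<bar> \<le> M * norm (x - y)" using delta_Lipschitz by blast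
  define C where "C = (CT + M / m) / k"
  have "norm (w1 - w2) \<le> C * norm (z1 - z2)"
    if z: "k \<le> \<delta> z1" "\<delta> z1 < d0" "k \<le> \<delta> z2" "\<delta> z2 < d0" and w: "w1 \<in> nu_phi \<phi> A z1" "w2 \<in> nu_phi \<phi> A z2" for z1 z2 w1 w2
  proof -
    have zA: "z1 \<notin> A" "z2 \<notin> A" using z assms delta_pos by auto
    have t: "norm (\<delta> z1 *\<^sub>R w1 - \<delta> z2 *\<^sub>R w2) \<le> CT * norm (z1 - z2)"
      using tube[OF z(2,4)] nu_iff[OF zA(1), of w1] nu_iff[OF zA(2), of w2] w by fastforce
    have w2: "norm w2 \<le> 1 / m" using m(2)[of w2] m(1) ps_nu[OF zA(2) w(2)] by (simp add: field_simps)
    have "\<delta> z1 *\<^sub>R (w1 - w2) = (\<delta> z1 *\<^sub>R w1 - \<delta> z2 *\<^sub>R w2) + (\<delta> z2 - \<delta> z1) *\<^sub>R w2" by (simp add: algebra_simps)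
    then have "norm (\<delta> z1 *\<^sub>R (w1 - w2)) \<le> norm (\<delta> z1 *\<^sub>R w1 - \<delta> z2 *\<^sub>R w2) + norm ((\<delta> z2 - \<delta> z1) *\<^sub>R w2)"
      by (metis norm_triangle_ineq)
    also have "\<dots> \<le> CT * norm (z1 - z2) + (M * norm (z1 - z2)) * (1 / m)"
      using t w2 M(2)[of z2 z1] M(1) unfolding norm_scaleR
      by (intro add_mono mult_mono) (auto simp: norm_minus_commute)
    also have "\<dots> = (CT + M / m) * norm (z1 - z2)" by (simp add: distrib_right)
    finally have "\<delta> z1 * norm (w1 - w2) \<le> (CT + M / m) * norm (z1 - z2)" using delta_nonneg[of z1] by simp
    moreover have "k * norm (w1 - w2) \<le> \<delta> z1 * norm (w1 - w2)" using z by (intro mult_right_mono) auto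
    ultimately have "k * norm (w1 - w2) \<le> (CT + M / m) * norm (z1 - z2)" by linarith
    then show ?thesis using assms by (simp add: C_def field_simps)
  qed
  moreover have "0 < C" using CT_pos M m assms by (auto simp: C_def intro!: divide_pos_pos add_pos_pos)
  ultimately show ?thesis using that by blast
qed

text \<open>Every point z near the retracted point is approximated up to o by the retraction of a point y near
  a + r eta, namely the one predicted by the derivative, and there the normal is the one at y.\<close>
lemma nu_diff_transfer:
  assumes a: "a \<in> A" "ps \<eta> = 1" and r: "\<delta> (a + r *\<^sub>R \<eta>) = r"
    and L: "nu_diff_with \<phi> A (a + r *\<^sub>R \<eta>) L" and t: "0 < t" "t < r" "t < d0"
    and N: "linear N" "\<And>h. N h - (r - t) *\<^sub>R L (N h) = h"
  shows "nu_diff_with \<phi> A (a + t *\<^sub>R \<eta>) (\<lambda>h. L (N h))"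
proof -
  define \<tau> where "\<tau> = r - t"
  define x where "x = a + r *\<^sub>R \<eta>"
  define x' where "x' = a + t *\<^sub>R \<eta>"
  have \<tau>: "0 < \<tau>" "\<tau> < r" "0 < r" using t by (auto simp: \<tau>_def)
  have L': "nu_diff_with \<phi> A x L" using L by (simp add: x_def)
  have \<eta>: "\<eta> \<in> nu_phi \<phi> A x" using ray_point(3)[OF a \<tau>(3) r] by (simp add: x_def)
  note nd = nu_diff_D[OF L' \<eta>]
  have dx': "\<delta> x' = t" unfolding x'_def by (rule ray_contract[OF a \<tau>(3) r]) (use t in auto)
  have x'A: "x' \<notin> A" using dx' t delta_pos by simp
  have \<eta>': "\<eta> \<in> nu_phi \<phi> A x'" unfolding x'_def by (rule ray_point(3)[OF a t(1)]) (use dx' in \<open>simp add: x'_def\<close>)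
  have single: "nu_phi \<phi> A x' = {\<eta>}"
  proof -
    have "w = \<eta>" if "w \<in> nu_phi \<phi> A x'" for w
    proof -
      have "x' - \<delta> x' *\<^sub>R w = x' - \<delta> x' *\<^sub>R \<eta>"
        by (rule xi_unique[OF _ iffD1[OF nu_iff[OF x'A] that] iffD1[OF nu_iff[OF x'A] \<eta>']]) (simp add: dx' t)
      then show ?thesis using dx' t by simp
    qed
    then show ?thesis using \<eta>' by blast
  qed
  obtain C where C: "0 < C" "\<And>z1 z2 w1 w2. \<lbrakk>t / 2 \<le> \<delta> z1; \<delta> z1 < d0; t / 2 \<le> \<delta> z2; \<delta> z2 < d0; w1 \<in> nu_phi \<phi> A z1; w2 \<in> nu_phi \<phi> A z2\<rbrakk>
    \<Longrightarrow> norm (w1 - w2) \<le> C * norm (z1 - z2)" using nu_Lipschitz[of "t / 2"] t by auto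
  obtain M where M: "0 < M" "\<And>x y. \<bar>\<delta> x - \<delta> y\<bar> \<le> M * norm (x - y)" using delta_Lipschitz by blast
  obtain B where B: "0 < B" "\<And>h. norm (N h) \<le> B * norm h"
    using linear_bounded_pos[OF N(1)] by blast
  \<comment> \<open>Within this radius the distance stays in the range from t / 2 to
    \<open>d0\<close> for which C was obtained.\<close>
  define \<zeta> where "\<zeta> = min (t / 2) ((d0 - t) / 2) / M"
  have \<zeta>: "0 < \<zeta>" using t M by (simp add: \<zeta>_def)
  have inT: "t / 2 \<le> \<delta> z" "\<delta> z < d0" if "norm (z - x') \<le> \<zeta>" for z
  proof -
    have "\<bar>\<delta> z - t\<bar> \<le> M * norm (z - x')" using M(2)[of z x'] dx' by simp
    also have "\<dots> \<le> M * \<zeta>" using that M(1) by (intro mult_left_mono) auto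
    also have "\<dots> = min (t / 2) ((d0 - t) / 2)" using M by (simp add: \<zeta>_def)
    finally show "t / 2 \<le> \<delta> z" "\<delta> z < d0" using t by (auto simp: abs_le_iff min_def split: if_splits)
  qed
  have main: "\<exists>d>0. \<forall>z w. z \<notin> A \<and> norm (z - x') < d \<and> w \<in> nu_phi \<phi> A z \<longrightarrow> norm (w - \<eta> - L (N (z - x'))) \<le> e * norm (z - x')" if e: "0 < e" for e
  proof -
    define K where "K = (1 + C * \<tau>) * B"
    have "0 < 1 + C * \<tau>" using C(1) \<tau> by (intro add_pos_pos mult_pos_pos) auto
    then have K: "0 < K" using B by (simp add: K_def)
    define e1 where "e1 = e / K"
    have e1: "0 < e1" using e K by (simp add: e1_def)
    obtain d where d: "0 < d" "\<And>y w. y \<notin> A \<Longrightarrow> norm (y - x) < d \<Longrightarrow> w \<in> nu_phi \<phi> A y \<Longrightarrow> norm (w - \<eta> - L (y - x)) \<le> e1 * norm (y - x)"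
      using nd(4)[OF e1] by blast
    define D where "D = min (min d (t / (2 * M)) / B) (\<zeta> / (1 + \<tau> * (e1 * B)))"
    have pos: "0 < 1 + \<tau> * (e1 * B)" using \<tau> e1 B by (intro add_pos_pos mult_pos_pos) auto
    have D: "0 < D" using d t M B \<zeta> pos by (simp add: D_def)
    have "norm (w - \<eta> - L (N (z - x'))) \<le> e * norm (z - x')" if z: "z \<notin> A" "norm (z - x') < D" "w \<in> nu_phi \<phi> A z" for z w
    proof -
      define h where "h = z - x'"
      define v where "v = N h"
      define y where "y = x + v"
      have nv: "norm v \<le> B * norm h" using B(2) by (simp add: v_def)
      also have "\<dots> \<le> B * D" using z(2) B(1) by (intro mult_left_mono) (auto simp: h_def)
      also have "\<dots> \<le> B * (min d (t / (2 * M)) / B)" using B(1) by (intro mult_left_mono) (auto simp: D_def)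
      finally have v1: "norm v \<le> min d (t / (2 * M))" using B(1) by simp
      have v1': "norm v < d"
      proof -
        have "B * norm h < B * D" using z(2) B(1) by (simp add: h_def)
        also have "\<dots> \<le> B * (min d (t / (2 * M)) / B)" using B(1) by (intro mult_left_mono) (auto simp: D_def)
        also have "\<dots> \<le> d" using B(1) by simp
        finally show ?thesis using nv by simp
      qed
      have "\<bar>\<delta> y - r\<bar> \<le> M * norm v" using M(2)[of y x] r by (simp add: x_def y_def)
      also have "\<dots> \<le> M * (t / (2 * M))" using v1 M(1) by (intro mult_left_mono) auto
      also have "\<dots> = t / 2" using M(1) by simp
      finally have dy: "\<tau> < \<delta> y" using t(1) abs_ge_minus_self[of "\<delta> y - r"] unfolding \<tau>_def by linarith
      then have yA: "y \<notin> A" using \<tau> delta_pos by simp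
      obtain w1 where w1: "w1 \<in> nu_phi \<phi> A y" using nu_nonempty by blast
      have q: "norm (w1 - \<eta> - L v) \<le> e1 * norm v" using d(2)[OF yA _ w1] v1' by (simp add: y_def)
      define z1 where "z1 = y - \<tau> *\<^sub>R w1"
      have w1z: "w1 \<in> nu_phi \<phi> A z1" unfolding z1_def using nu_retract(3)[OF yA w1] \<tau> dy by simp
      \<comment> \<open>As v solves this equation exactly, z and z1 differ by \<tau> times the
        differentiability remainder at y.\<close>
      have "h = v - \<tau> *\<^sub>R L v" using N(2)[of h] by (simp add: v_def \<tau>_def)
      then have "z1 - z = - (\<tau> *\<^sub>R (w1 - \<eta> - L v))"
        by (simp add: z1_def y_def h_def x_def x'_def \<tau>_def algebra_simps)
      then have "norm (z1 - z) = \<tau> * norm (w1 - \<eta> - L v)" using \<tau> by simp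
      also have "\<dots> \<le> \<tau> * (e1 * norm v)" using q \<tau> by (intro mult_left_mono) auto
      finally have zz: "norm (z1 - z) \<le> \<tau> * (e1 * norm v)" .
      also have "\<dots> \<le> \<tau> * (e1 * (B * norm h))" using nv \<tau> e1 by (intro mult_left_mono) auto
      finally have zz2: "norm (z1 - z) \<le> \<tau> * (e1 * B) * norm h" by (simp add: mult_ac)
      have "(1 + \<tau> * (e1 * B)) * norm h \<le> (1 + \<tau> * (e1 * B)) * (\<zeta> / (1 + \<tau> * (e1 * B)))"
        using z(2) pos by (intro mult_left_mono) (auto simp: h_def D_def)
      then have hz: "(1 + \<tau> * (e1 * B)) * norm h \<le> \<zeta>" using pos by simp
      moreover have "norm (z1 - x') \<le> norm (z1 - z) + norm h"
        using norm_triangle_ineq[of "z1 - z" "z - x'"] by (simp add: h_def)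
      ultimately have n1: "norm (z1 - x') \<le> \<zeta>" using zz2 by (simp add: distrib_right)
      have "0 \<le> \<tau> * (e1 * B) * norm h" using \<tau> e1 B by simp
      then have n2: "norm (z - x') \<le> \<zeta>" using hz by (simp add: distrib_right h_def)
      have "norm (w - w1) \<le> C * norm (z - z1)"
        by (rule C(2)) (use inT n1 n2 z(3) w1z in auto)
      also have "\<dots> \<le> C * (\<tau> * (e1 * norm v))" using zz C(1) by (intro mult_left_mono) (auto simp: norm_minus_commute)
      finally have ww: "norm (w - w1) \<le> C * (\<tau> * (e1 * norm v))" .
      have "norm (w - \<eta> - L v) \<le> norm (w - w1) + norm (w1 - \<eta> - L v)"
      proof -
        have eq: "w - \<eta> - L v = (w - w1) + (w1 - \<eta> - L v)" by simp
        show ?thesis by (subst eq) (rule norm_triangle_ineq)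
      qed
      also have "\<dots> \<le> (1 + C * \<tau>) * e1 * norm v" using ww q by (simp add: algebra_simps)
      also have "\<dots> \<le> (1 + C * \<tau>) * e1 * (B * norm h)" using nv \<open>0 < 1 + C * \<tau>\<close> e1 by (intro mult_left_mono) auto
      also have "\<dots> = K * e1 * norm h" by (simp add: K_def mult_ac)
      also have "K * e1 = e" using K by (simp add: e1_def)
      finally show ?thesis by (simp add: v_def h_def)
    qed
    with D show ?thesis by blast
  qed
  have "linear (\<lambda>h. L (N h))" using linear_compose[OF N(1) nd(2)] by (simp add: o_def)
  moreover have "nu_pt \<phi> A x' = \<eta>" using single by (simp add: nu_pt_def)
  ultimately show ?thesis
    using main x'A single unfolding nu_diff_with_def x'_def[symmetric] by auto
qed

end


section \<open>Eigenbases and ordered eigenvalues\<close>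

text \<open>\<open>detn\<close> is a bare Leibniz sum; as a matrix determinant it becomes
  multiplicative and computable on diagonal matrices.\<close>

lemma detn_eq_det: "detn n M = det (mat n n (\<lambda>(i, j). M i j))"
proof -
  have "det (mat n n (\<lambda>(i, j). M i j)) = (\<Sum>p | p permutes {0..<n}. of_int (sign p) * (\<Prod>i = 0..<n. mat n n (\<lambda>(i, j). M i j) $$ (i, p i)))"
    by (rule det_def') simp
  also have "\<dots> = detn n M"
    unfolding detn_def lessThan_atLeast0
  proof (intro sum.cong refl arg_cong2[of _ _ _ _ "(*)"] prod.cong)
    fix p i assume "p \<in> {p. p permutes {0..<n}}" "i \<in> {0..<n}"
    then show "mat n n (\<lambda>(i, j). M i j) $$ (i, p i) = M i (p i)" 
      using permutes_in_image[of p "{0..<n}" i] by simp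
  qed
  finally show ?thesis ..
qed

lemma detn_cong: "(\<And>i j. i < n \<Longrightarrow> j < n \<Longrightarrow> M i j = M' i j) \<Longrightarrow> detn n M = detn n M'"
  unfolding detn_eq_det by (intro arg_cong[of _ _ det] eq_matI) auto

lemma detn_mult: "detn n (\<lambda>i j. \<Sum>k<n. M i k * M' k j) = detn n M * detn n M'"
proof -
  have "det (mat n n (\<lambda>(i, j). M i j) * mat n n (\<lambda>(i, j). M' i j)) = detn n M * detn n M'"
    unfolding detn_eq_det by (rule det_mult) auto
  moreover have "mat n n (\<lambda>(i, j). M i j) * mat n n (\<lambda>(i, j). M' i j) = mat n n (\<lambda>(i, j). \<Sum>k<n. M i k * M' k j)"
    by (rule eq_matI) (auto simp: scalar_prod_def lessThan_atLeast0 intro!: sum.cong)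
  ultimately show ?thesis unfolding detn_eq_det by simp
qed

lemma detn_diagonal: "detn n (\<lambda>i j. if i = j then d i else 0) = (\<Prod>i<n. d i)"
proof -
  have "det (mat n n (\<lambda>(i, j). if i = j then d i else 0)) = prod_list (diag_mat (mat n n (\<lambda>(i, j). if i = j then d i else 0)))"
    by (rule det_upper_triangular[of _ n]) (auto simp: upper_triangular_def)
  also have "\<dots> = (\<Prod>i<n. d i)"
    by (simp add: prod_list_diag_prod lessThan_atLeast0)
  finally show ?thesis unfolding detn_eq_det .
qed

lemma monic_roots_unique:
  fixes xs ys :: "real list"
  assumes "length xs = n" "length ys = n" "\<And>t. (\<Prod>i<n. xs ! i - t) = (\<Prod>i<n. ys ! i - t)"
  shows "mset xs = mset ys"
proof -
  \<comment> \<open>The sign makes each factor evaluate to x - t, while its roots remain those of a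
    monic linear factor.\<close>
  define P :: "real list \<Rightarrow> real poly" where "P = (\<lambda>xs. prod_list (map (\<lambda>x. - [:- x, 1:]) xs))"
  have P: "poly (P zs) t = (\<Prod>i<length zs. zs ! i - t)" for zs t
  proof -
    have "poly (P zs) t = prod_list (map (\<lambda>x. x - t) zs)" unfolding P_def by (induction zs) (auto simp: algebra_simps)
    then show ?thesis by (simp add: prod.list_conv_set_nth lessThan_atLeast0)
  qed
  have nz: "P zs \<noteq> 0" for zs unfolding P_def by (auto simp: prod_list_zero_iff)
  have "proots (P zs) = mset zs" for zs
  proof (induction zs)
    case (Cons z zs)
    have "P (z # zs) = - [:- z, 1:] * P zs" by (simp add: P_def)
    then show ?case using proots_mult[of "- [:- z, 1:]" "P zs"] nz[of zs] Cons.IH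
      by (simp del: proots_uminus minus_pCons) (simp only: proots_uminus proots_linear_factor minus_minus)
  qed (simp add: P_def)
  moreover have "P xs = P ys"
    by (rule poly_ext) (use assms P in simp)
  ultimately show ?thesis by metis
qed

lemma orthonormal_list_expand:
  fixes b :: "'a::euclidean_space list"
  assumes V: "subspace V" and b: "length b = dim V" "\<forall>i<length b. b ! i \<in> V"
    and on: "\<forall>i<length b. \<forall>j<length b. b ! i \<bullet> b ! j = (if i = j then 1 else 0)" and v: "v \<in> V"
  shows "v = (\<Sum>i<dim V. (b ! i \<bullet> v) *\<^sub>R b ! i)"
proof -
  have dist: "distinct b"
    unfolding distinct_conv_nth using on by (metis zero_neq_one)
  have "pairwise orthogonal (set b)"
    unfolding pairwise_def real_inner_class.orthogonal_def
  proof (intro ballI impI)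
    fix x y assume "x \<in> set b" "y \<in> set b" "x \<noteq> y"
    then obtain i j where "i < length b" "j < length b" "b ! i = x" "b ! j = y" "i \<noteq> j"
      by (auto simp: in_set_conv_nth)
    then show "x \<bullet> y = 0" using on by auto
  qed
  moreover have "0 \<notin> set b"
  proof
    assume "0 \<in> set b"
    then obtain i where "i < length b" "b ! i = 0" by (auto simp: in_set_conv_nth)
    then show False using on by (metis inner_zero_left zero_neq_one)
  qed
  ultimately have ind: "independent (set b)" by (rule pairwise_orthogonal_independent)
  have sub: "set b \<subseteq> V" using b(2) by (auto simp: in_set_conv_nth)
  have "card (set b) = dim V" using distinct_card[OF dist] b(1) by simp
  then have "V \<subseteq> span (set b)" using card_ge_dim_independent[OF sub ind] by simp
  then have vs: "v \<in> span (set b)" using v by blast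
  define w where "w = v - (\<Sum>i<dim V. (b ! i \<bullet> v) *\<^sub>R b ! i)"
  have bw: "b ! j \<bullet> w = 0" if j: "j < dim V" for j
  proof -
    have "b ! j \<bullet> (\<Sum>i<dim V. (b ! i \<bullet> v) *\<^sub>R b ! i) = (\<Sum>i<dim V. if j = i then b ! i \<bullet> v else 0)"
      unfolding inner_sum_right using on b(1) j by (intro sum.cong) auto
    also have "\<dots> = b ! j \<bullet> v" using j by simp
    finally show ?thesis by (simp add: w_def inner_diff_right)
  qed
  have "w \<in> span (set b)" unfolding w_def
    by (intro span_diff vs span_sum span_scale span_base) (use b(1) in auto)
  moreover have "orthogonal w x" if "x \<in> set b" for x
    using that bw b(1) by (auto simp: in_set_conv_nth real_inner_class.orthogonal_def inner_commute)
  ultimately have "orthogonal w w" using orthogonal_to_span by blast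
  then show ?thesis by (simp add: w_def real_inner_class.orthogonal_def)
qed

text \<open>Orthonormality is not asked for, since L will be self-adjoint only for another inner
  product. Independence is implicit in spanning V by dim V vectors.\<close>

definition eigenbasis :: "('a::euclidean_space \<Rightarrow> 'a) \<Rightarrow> 'a set \<Rightarrow> 'a list \<Rightarrow> real list \<Rightarrow> bool" where
  "eigenbasis L V es cs \<longleftrightarrow> length es = dim V \<and> length cs = dim V \<and> set es \<subseteq> V \<and> V \<subseteq> span (set es) \<and>
     (\<forall>i<dim V. L (es ! i) = (cs ! i) *\<^sub>R es ! i)"

lemma span_list_sum:
  fixes es :: "'a::euclidean_space list"
  assumes "v \<in> span (set es)"
  shows "\<exists>c. v = (\<Sum>k<length es. c k *\<^sub>R es ! k)"
proof -
  let ?U = "{v. \<exists>c. v = (\<Sum>k<length es. c k *\<^sub>R es ! k)}"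
  have "subspace ?U"
    unfolding subspace_def
  proof (intro conjI ballI allI)
    show "0 \<in> ?U" by (auto intro!: exI[of _ "\<lambda>_. 0"])
    fix x y assume "x \<in> ?U" "y \<in> ?U"
    then obtain c d where "x = (\<Sum>k<length es. c k *\<^sub>R es ! k)" "y = (\<Sum>k<length es. d k *\<^sub>R es ! k)" by blast
    then show "x + y \<in> ?U" by (auto intro!: exI[of _ "\<lambda>k. c k + d k"] simp: scaleR_add_left sum.distrib)
  next
    fix x and a :: real assume "x \<in> ?U"
    then obtain c where "x = (\<Sum>k<length es. c k *\<^sub>R es ! k)" by blast
    then show "a *\<^sub>R x \<in> ?U" by (auto intro!: exI[of _ "\<lambda>k. a * c k"] simp: scaleR_sum_right)
  qed
  moreover have "set es \<subseteq> ?U"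
  proof
    fix v assume "v \<in> set es"
    then obtain i where i: "i < length es" "es ! i = v" by (auto simp: in_set_conv_nth)
    have "(\<Sum>k<length es. (if k = i then 1 else 0) *\<^sub>R es ! k) = (\<Sum>k<length es. if k = i then es ! k else 0)"
      by (rule sum.cong) auto
    also have "\<dots> = v" using i by simp
    finally show "v \<in> ?U" by (intro CollectI exI[of _ "\<lambda>k. if k = i then 1 else 0"]) simp
  qed
  ultimately have "span (set es) \<subseteq> ?U" by (intro span_minimal)
  then show ?thesis using assms by blast
qed

text \<open>With S the coordinates of \<open>es\<close> in b, the matrix M of L satisfies M S = S D
  for the diagonal matrix D of \<open>cs\<close>. S has a right inverse, so its determinant is
  nonzero and cancels. This links any eigenbasis to the orthonormal bases of
  \<open>ordered_eigs\<close>.\<close>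

lemma eigenbasis_charpoly:
  fixes L :: "'a::euclidean_space \<Rightarrow> 'a"
  assumes V: "subspace V" and L: "linear L" and E: "eigenbasis L V es cs"
    and b: "length b = dim V" "\<forall>i<length b. b ! i \<in> V"
    and on: "\<forall>i<length b. \<forall>j<length b. b ! i \<bullet> b ! j = (if i = j then 1 else 0)"
  shows "detn (dim V) (\<lambda>i j. b ! i \<bullet> L (b ! j) - (if i = j then t else 0)) = (\<Prod>i<dim V. cs ! i - t)"
proof -
  define n where "n = dim V"
  have e: "length es = n" "length cs = n" "set es \<subseteq> V" "V \<subseteq> span (set es)"
    and Le: "\<And>i. i < n \<Longrightarrow> L (es ! i) = (cs ! i) *\<^sub>R es ! i"
    using E by (auto simp: eigenbasis_def n_def)
  define S where "S = (\<lambda>i k. b ! i \<bullet> es ! k)"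
  have expand: "es ! k = (\<Sum>j<n. S j k *\<^sub>R b ! j)" if "k < n" for k
    using orthonormal_list_expand[OF V b on, of "es ! k"] that e subsetD[OF e(3) nth_mem[of k es]] by (auto simp: S_def n_def)
  have "\<forall>j. \<exists>c. j < n \<longrightarrow> b ! j = (\<Sum>k<n. c k *\<^sub>R es ! k)"
  proof
    fix j
    show "\<exists>c. j < n \<longrightarrow> b ! j = (\<Sum>k<n. c k *\<^sub>R es ! k)"
      using span_list_sum[of "b ! j" es] e(1,4) b by (cases "j < n") (auto simp: n_def)
  qed
  then obtain T where T: "\<And>j. j < n \<Longrightarrow> b ! j = (\<Sum>k<n. T j k *\<^sub>R es ! k)" by metis
  have "detn n S * detn n (\<lambda>k j. T j k) = detn n (\<lambda>i j. if i = j then 1 else 0)"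
    unfolding detn_mult[symmetric]
  proof (rule detn_cong)
    fix i j assume ij: "i < n" "j < n"
    have "(\<Sum>k<n. S i k * T j k) = b ! i \<bullet> b ! j"
      by (subst T[OF ij(2)]) (simp add: inner_sum_right S_def mult.commute)
    then show "(\<Sum>k<n. S i k * T j k) = (if i = j then 1 else 0)" using on b(1) ij by (simp add: n_def)
  qed
  also have "\<dots> = 1" using detn_diagonal[of n "\<lambda>_. 1"] by simp
  finally have S0: "detn n S \<noteq> 0" by auto
  have "detn n (\<lambda>i j. b ! i \<bullet> L (b ! j) - (if i = j then t else 0)) * detn n S =
    detn n S * detn n (\<lambda>i j. if i = j then cs ! i - t else 0)"
    unfolding detn_mult[symmetric]
  proof (rule detn_cong)
    fix i k assume ik: "i < n" "k < n"
    have "(\<Sum>j<n. (b ! i \<bullet> L (b ! j) - (if i = j then t else 0)) * S j k) =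
      (\<Sum>j<n. (b ! i \<bullet> L (b ! j)) * S j k) - (\<Sum>j<n. (if i = j then t else 0) * S j k)"
      by (simp add: left_diff_distrib sum_subtractf)
    also have "(\<Sum>j<n. (if i = j then t else 0) * S j k) = (\<Sum>j<n. if i = j then t * S j k else 0)"
      by (rule sum.cong) auto
    also have "\<dots> = t * S i k" using ik by simp
    also have "(\<Sum>j<n. (b ! i \<bullet> L (b ! j)) * S j k) = b ! i \<bullet> L (es ! k)"
      by (subst expand[OF ik(2)])
        (simp add: linear_sum[OF L] linear_cmul[OF L] inner_sum_right mult.commute)
    also have "\<dots> = cs ! k * S i k" using Le[OF ik(2)] by (simp add: S_def)
    finally have l: "(\<Sum>j<n. (b ! i \<bullet> L (b ! j) - (if i = j then t else 0)) * S j k) = (cs ! k - t) * S i k"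
      by (simp add: left_diff_distrib)
    have "(\<Sum>j<n. S i j * (if j = k then cs ! j - t else 0)) = (\<Sum>j<n. if k = j then S i j * (cs ! j - t) else 0)"
      by (rule sum.cong) auto
    also have "\<dots> = S i k * (cs ! k - t)" using ik by simp
    finally show "(\<Sum>j<n. (b ! i \<bullet> L (b ! j) - (if i = j then t else 0)) * S j k) =
      (\<Sum>j<n. S i j * (if j = k then cs ! j - t else 0))" using l by simp
  qed
  then show ?thesis using S0 unfolding n_def detn_diagonal by simp
qed

lemma ordered_eigs_eigenbasis:
  fixes L :: "'a::euclidean_space \<Rightarrow> 'a"
  assumes V: "subspace V" and L: "linear L" and E: "eigenbasis L V es cs"
  shows "ordered_eigs L V xs \<longleftrightarrow> xs = sort cs"
proof
  have lc: "length cs = dim V" using E by (simp add: eigenbasis_def)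
  {
    assume "ordered_eigs L V xs"
    then obtain b where s: "sorted xs" "length xs = dim V" and b: "length b = dim V" "\<forall>i<length b. b ! i \<in> V"
      and on: "\<forall>i<length b. \<forall>j<length b. b ! i \<bullet> b ! j = (if i = j then 1 else 0)"
      and p: "\<forall>t. detn (dim V) (\<lambda>i j. b ! i \<bullet> L (b ! j) - (if i = j then t else 0)) = (\<Prod>i<dim V. xs ! i - t)"
      unfolding ordered_eigs_def by blast
    have "mset xs = mset cs"
      by (rule monic_roots_unique[OF s(2) lc]) (use p eigenbasis_charpoly[OF V L E b on] in simp)
    then show "xs = sort cs" using s(1) by (metis properties_for_sort)
  }
  assume xs: "xs = sort cs"
  obtain B where B: "B \<subseteq> V" "pairwise orthogonal B" "\<And>x. x \<in> B \<Longrightarrow> norm x = 1" "independent B" "card B = dim V"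
    using orthonormal_basis_subspace[OF V] by metis
  obtain b where b: "set b = B" "distinct b" using finite_distinct_list[OF independent_imp_finite[OF B(4)]] by blast
  have lb: "length b = dim V" using distinct_card[OF b(2)] b(1) B(5) by simp
  have bV: "\<forall>i<length b. b ! i \<in> V" using b(1) B(1) by auto
  have on: "\<forall>i<length b. \<forall>j<length b. b ! i \<bullet> b ! j = (if i = j then 1 else 0)"
  proof (intro allI impI)
    fix i j assume ij: "i < length b" "j < length b"
    have m: "b ! i \<in> B" "b ! j \<in> B" using ij b(1) by auto
    show "b ! i \<bullet> b ! j = (if i = j then 1 else 0)"
    proof (cases "i = j")
      case True
      then show ?thesis using B(3)[OF m(1)] by (simp add: dot_square_norm)
    next
      case False
      then have "b ! i \<noteq> b ! j" using ij b(2) by (simp add: nth_eq_iff_index_eq)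
      then show ?thesis using B(2) m False by (auto simp: pairwise_def real_inner_class.orthogonal_def)
    qed
  qed
  have "(\<Prod>i<dim V. cs ! i - t) = (\<Prod>i<dim V. sort cs ! i - t)" for t
  proof -
    have "prod_list (map (\<lambda>x. x - t) cs) = prod_list (map (\<lambda>x. x - t) (sort cs))"
      unfolding prod_mset_prod_list[symmetric] by simp
    then show ?thesis using lc by (simp add: prod.list_conv_set_nth lessThan_atLeast0)
  qed
  then show "ordered_eigs L V xs" unfolding ordered_eigs_def
    using xs lc lb bV on eigenbasis_charpoly[OF V L E lb bV on] by (intro conjI exI[of _ b]) auto
qed

text \<open>By \<open>ordered_eigs_eigenbasis\<close> the description in \<open>eig\<close> is
  definite, so the eigenvalues can be read off any eigenbasis; \<open>eig\<close> counts from
  1.\<close>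

lemma eig_eigenbasis:
  assumes "subspace V" "linear L" "eigenbasis L V es cs"
  shows "eig L V i = sort cs ! (i - 1)"
  unfolding eig_def ordered_eigs_eigenbasis[OF assms] by simp

lemma sort_map_mono:
  assumes "mono_on (set cs) f"
  shows "sort (map f cs) = map f (sort cs)"
proof (rule properties_for_sort)
  show "mset (map f (sort cs)) = mset (map f cs)" by simp
  show "sorted (map f (sort cs))"
    by (rule sorted_map_mono) (use assms in auto)
qed

text \<open>Maximise the Rayleigh quotient of the form K over the unit sphere of V.\<close>
lemma selfadjoint_eigenvector:
  fixes L K :: "'a::euclidean_space \<Rightarrow> 'a"
  assumes V: "subspace V" "V \<noteq> {0}" and lin: "linear L" "linear K" and LV: "\<And>v. v \<in> V \<Longrightarrow> L v \<in> V"
    and K: "\<And>v w. K v \<bullet> w = v \<bullet> K w" "\<And>v. v \<noteq> 0 \<Longrightarrow> 0 < K v \<bullet> v"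
    and KL: "\<And>v w. v \<in> V \<Longrightarrow> w \<in> V \<Longrightarrow> K (L v) \<bullet> w = v \<bullet> K (L w)"
  obtains e c where "e \<in> V" "e \<noteq> 0" "L e = c *\<^sub>R e"
proof -
  define R where "R = (\<lambda>v. (K (L v) \<bullet> v) / (K v \<bullet> v))"
  have cK: "continuous_on T K" "continuous_on T L" "continuous_on T (\<lambda>v. K (L v))" for T
    using lin linear_compose[OF lin] by (auto simp: o_def linear_continuous_on linear_conv_bounded_linear)
  let ?S = "V \<inter> sphere 0 1"
  have "compact ?S" by (rule closed_Int_compact[OF closed_subspace[OF V(1)] compact_sphere])
  moreover have "?S \<noteq> {}"
  proof -
    obtain v where v: "v \<in> V" "v \<noteq> 0" using V subspace_0 by blast
    then have "(1 / norm v) *\<^sub>R v \<in> ?S" using subspace_scale[OF V(1)] by simp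
    then show ?thesis by blast
  qed
  moreover have "continuous_on ?S R" unfolding R_def
  proof (intro continuous_intros cK ballI)
    fix v assume "v \<in> ?S"
    then have "v \<noteq> 0" by auto
    then show "K v \<bullet> v \<noteq> 0" using K(2) by fastforce
  qed
  ultimately obtain e where e: "e \<in> ?S" "\<And>v. v \<in> ?S \<Longrightarrow> R v \<le> R e"
    using continuous_attains_sup[of ?S R] by blast
  define c where "c = R e"
  have e0: "e \<noteq> 0" using e(1) by auto
  have le: "K (L v) \<bullet> v \<le> c * (K v \<bullet> v)" if v: "v \<in> V" for v
  proof (cases "v = 0")
    case False
    have "R ((1 / norm v) *\<^sub>R v) \<le> c" unfolding c_def
      by (rule e(2)) (use v False subspace_scale[OF V(1)] in auto)
    moreover have "R ((1 / norm v) *\<^sub>R v) = R v" using False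
      by (simp add: R_def linear_cmul[OF lin(1)] linear_cmul[OF lin(2)])
    ultimately have "R v \<le> c" by simp
    then show ?thesis using K(2)[OF False] by (simp add: R_def divide_le_eq)
  qed (use linear_0[OF lin(1)] linear_0[OF lin(2)] in auto)
  have Kee: "K (L e) \<bullet> e = c * (K e \<bullet> e)" using K(2)[OF e0] by (simp add: c_def R_def)
  define w where "w = L e - c *\<^sub>R e"
  have wV: "w \<in> V" using e(1) LV subspace_scale[OF V(1)] by (auto simp: w_def intro!: subspace_diff[OF V(1)])
  have Kw: "K (L e) \<bullet> w - c * (K e \<bullet> w) = K w \<bullet> w"
    by (simp add: w_def linear_diff[OF lin(2)] linear_cmul[OF lin(2)] inner_diff_left)
  have eV: "e \<in> V" using e(1) by simp
  define b where "b = c * (K w \<bullet> w) - K (L w) \<bullet> w"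
  \<comment> \<open>The first variation at the maximiser e in direction w: the coefficient of s is
    twice the square of w for the form K, and small positive s then forces w = 0.\<close>
  have quad: "2 * s * (K w \<bullet> w) \<le> s\<^sup>2 * b" for s
  proof -
    have m: "e + s *\<^sub>R w \<in> V" by (intro subspace_add[OF V(1)] subspace_scale[OF V(1)] eV wV)
    have s1: "K (L w) \<bullet> e = K (L e) \<bullet> w" using KL[OF wV eV] by (simp add: inner_commute)
    have s2: "K w \<bullet> e = K e \<bullet> w" using K(1)[of w e] by (simp add: inner_commute)
    have "K (L (e + s *\<^sub>R w)) \<bullet> (e + s *\<^sub>R w) = K (L e) \<bullet> e + 2 * s * (K (L e) \<bullet> w) + s\<^sup>2 * (K (L w) \<bullet> w)"
      by (simp add: linear_add[OF lin(1)] linear_add[OF lin(2)] linear_cmul[OF lin(1)] linear_cmul[OF lin(2)]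
          inner_add_left inner_add_right s1 power2_eq_square algebra_simps)
    moreover have "K (e + s *\<^sub>R w) \<bullet> (e + s *\<^sub>R w) = K e \<bullet> e + 2 * s * (K e \<bullet> w) + s\<^sup>2 * (K w \<bullet> w)"
      by (simp add: linear_add[OF lin(2)] linear_cmul[OF lin(2)]
          inner_add_left inner_add_right s2 power2_eq_square algebra_simps)
    ultimately have "K (L e) \<bullet> e + 2 * s * (K (L e) \<bullet> w) + s\<^sup>2 * (K (L w) \<bullet> w) \<le> c * (K e \<bullet> e + 2 * s * (K e \<bullet> w) + s\<^sup>2 * (K w \<bullet> w))"
      using le[OF m] by simp
    then have "2 * s * (K (L e) \<bullet> w - c * (K e \<bullet> w)) \<le> s\<^sup>2 * b"
      unfolding Kee b_def by (simp add: algebra_simps)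
    then show ?thesis unfolding Kw .
  qed
  have "w = 0"
  proof (rule ccontr)
    assume "w \<noteq> 0"
    then have k: "0 < K w \<bullet> w" by (rule K(2))
    define s where "s = (K w \<bullet> w) / (\<bar>b\<bar> + 1)"
    have s: "0 < s" using k by (simp add: s_def)
    have "s * (2 * (K w \<bullet> w)) \<le> s * (s * b)" using quad[of s] by (simp add: power2_eq_square mult_ac)
    then have "2 * (K w \<bullet> w) \<le> s * b" using s by simp
    also have "\<dots> \<le> s * (\<bar>b\<bar> + 1)" using s by (intro mult_left_mono) auto
    also have "\<dots> = K w \<bullet> w" by (simp add: s_def)
    finally show False using k by simp
  qed
  then show ?thesis using that[of e c] eV e0 by (simp add: w_def)
qed

text \<open>Induction on the dimension: the complement W of an eigenvector for the form K is again
  invariant, because K L is symmetric on V.\<close>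

lemma selfadjoint_eigenbasis:
  fixes L K :: "'a::euclidean_space \<Rightarrow> 'a"
  assumes "subspace V" and lin: "linear L" "linear K" and "\<And>v. v \<in> V \<Longrightarrow> L v \<in> V"
    and K: "\<And>v w. K v \<bullet> w = v \<bullet> K w" "\<And>v. v \<noteq> 0 \<Longrightarrow> 0 < K v \<bullet> v"
    and "\<And>v w. v \<in> V \<Longrightarrow> w \<in> V \<Longrightarrow> K (L v) \<bullet> w = v \<bullet> K (L w)"
  shows "\<exists>es cs. eigenbasis L V es cs"
  using assms(1,4,7)
proof (induction "dim V" arbitrary: V)
  case 0
  then have "V \<subseteq> {0}" by (simp add: dim_eq_0)
  then have "V \<subseteq> span (set [])" by simp
  then have "eigenbasis L V [] []" unfolding eigenbasis_def 0(1)[symmetric] by simp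
  then show ?case by blast
next
  case (Suc n)
  have "V \<noteq> {0}" using Suc.hyps(2) by auto
  then obtain e c where e: "e \<in> V" "e \<noteq> 0" "L e = c *\<^sub>R e"
    using selfadjoint_eigenvector[OF Suc.prems(1) _ lin Suc.prems(2) K Suc.prems(3)] by blast
  have Ke: "0 < K e \<bullet> e" using K(2)[OF e(2)] .
  define W where "W = V \<inter> {w. K e \<bullet> w = 0}"
  have W: "subspace W" unfolding W_def by (intro subspace_inter Suc.prems(1) subspace_hyperplane)
  have dec: "\<exists>k. v - k *\<^sub>R e \<in> W" if "v \<in> V" for v
  proof
    show "v - ((K e \<bullet> v) / (K e \<bullet> e)) *\<^sub>R e \<in> W"
      using that e(1) Ke subspace_scale[OF Suc.prems(1) e(1)]
      by (auto simp: W_def inner_diff_right intro!: subspace_diff[OF Suc.prems(1)])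
  qed
  have sW: "span W = W" using W by (simp only: span_eq_iff)
  have eW: "e \<notin> span W" unfolding sW using Ke by (simp add: W_def)
  have "span (insert e W) = V"
  proof (rule subset_antisym)
    show "span (insert e W) \<subseteq> V" by (rule span_minimal) (use e(1) Suc.prems(1) in \<open>auto simp: W_def\<close>)
    show "V \<subseteq> span (insert e W)"
      using dec by (auto simp: span_insert intro: span_base)
  qed
  then have "dim V = Suc (dim W)" using dim_insert[of e W] eW by (metis dim_span Suc_eq_plus1)
  then have dW: "n = dim W" using Suc.hyps(2) by simp
  have LW: "L w \<in> W" if "w \<in> W" for w
  proof -
    have "w \<in> V" "K e \<bullet> w = 0" using that by (auto simp: W_def)
    have "K e \<bullet> L w = e \<bullet> K (L w)" by (rule K(1))
    also have "\<dots> = K (L e) \<bullet> w" using Suc.prems(3)[OF e(1) \<open>w \<in> V\<close>] by simp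
    also have "\<dots> = 0" using e(3) \<open>K e \<bullet> w = 0\<close> by (simp add: linear_cmul[OF lin(2)])
    finally show ?thesis using Suc.prems(2)[OF \<open>w \<in> V\<close>] by (simp add: W_def)
  qed
  obtain es cs where E: "eigenbasis L W es cs"
    using Suc.hyps(1)[OF dW W LW] Suc.prems(3) unfolding W_def by blast
  have "eigenbasis L V (e # es) (c # cs)"
    unfolding eigenbasis_def
  proof (intro conjI allI impI)
    have "W \<subseteq> span (set es)" using E by (simp add: eigenbasis_def)
    show "V \<subseteq> span (set (e # es))"
    proof
      fix v assume "v \<in> V"
      then obtain k where "v - k *\<^sub>R e \<in> span (set es)" using dec \<open>W \<subseteq> span (set es)\<close> by blast
      then show "v \<in> span (set (e # es))" by (auto simp: span_insert)
    qed
    fix i assume "i < dim V"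
    then show "L ((e # es) ! i) = ((c # cs) ! i) *\<^sub>R (e # es) ! i"
      using E e(3) \<open>dim V = Suc (dim W)\<close> by (cases i) (auto simp: eigenbasis_def)
  qed (use E e(1) \<open>dim V = Suc (dim W)\<close> in \<open>auto simp: eigenbasis_def W_def\<close>)
  then show ?case by blast
qed

text \<open>A zero entry could be dropped from the spanning list, leaving fewer than dim V
  vectors.\<close>

lemma eigenbasis_nonzero:
  assumes "subspace V" "eigenbasis L V es cs" "i < dim V"
  shows "es ! i \<noteq> 0"
proof
  assume "es ! i = 0"
  then have 0: "0 \<in> set es" using assms nth_mem[of i es] by (simp add: eigenbasis_def)
  have "V \<subseteq> span (set es - {0})" using assms(2) by (simp add: eigenbasis_def span_delete_0)
  then have "dim V \<le> card (set es - {0})" using dim_le_card[of V "set es - {0}"] by simp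
  also have "\<dots> < card (set es)" using 0 by (intro card_Diff1_less) auto
  also have "\<dots> \<le> dim V" using card_length[of es] assms(2) by (simp add: eigenbasis_def)
  finally show False by simp
qed

section \<open>Derivatives of the nearest point projection and curvatures\<close>

context smooth_norm_set
begin

text \<open>An arbitrary selection, as is \<open>nuf\<close> below. \<open>nu_diff_with\<close>
  quantifies over all values of the normal map, so every selection inherits the derivative and the
  usual rules apply. On A division by 0 makes \<open>nuf\<close> vanish.\<close>

definition proj where "proj z = (SOME c. c \<in> \<xi> z)"
definition nuf where "nuf z = (1 / \<delta> z) *\<^sub>R (z - proj z)"

lemma proj_in_xi: "proj z \<in> \<xi> z"
  unfolding proj_def by (rule someI_ex[OF xi_nonempty])

lemma nuf_in_nu: "nuf z \<in> nu_phi \<phi> A z"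
  using proj_in_xi unfolding nu_phi_def nuf_def by blast

lemma proj_eq: "proj z = z - \<delta> z *\<^sub>R nuf z"
proof (cases "\<delta> z = 0")
  case True
  then have "ps (z - proj z) = 0" using xi_D(2)[OF proj_in_xi] by simp
  then show ?thesis using True by simp
qed (simp add: nuf_def)

lemma nuf_has_derivative:
  assumes "nu_diff_with \<phi> A x L" "\<eta> \<in> nu_phi \<phi> A x"
  shows "(nuf has_derivative L) (at x)"
proof -
  note nd = nu_diff_D[OF assms]
  obtain w where "nu_phi \<phi> A x = {w}" using assms(1) unfolding nu_diff_with_def by blast
  then have nx: "nuf x = \<eta>" using nuf_in_nu[of x] assms(2) by simp
  obtain e0 where e0: "0 < e0" "ball x e0 \<subseteq> - A"
    using openE[OF open_Compl[OF closed_A], of x] nd(3) by blast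
  show ?thesis
    unfolding has_derivative_at_alt
  proof (intro conjI allI impI)
    show "bounded_linear L" using nd(2) by (simp add: linear_conv_bounded_linear)
    fix e :: real assume "0 < e"
    obtain d where d: "0 < d" "\<And>y w. y \<notin> A \<Longrightarrow> norm (y - x) < d \<Longrightarrow> w \<in> nu_phi \<phi> A y \<Longrightarrow> norm (w - \<eta> - L (y - x)) \<le> e * norm (y - x)"
      using nd(4)[OF \<open>0 < e\<close>] by blast
    have "norm (nuf y - nuf x - L (y - x)) \<le> e * norm (y - x)" if y: "norm (y - x) < min d e0" for y
    proof -
      have "y \<in> ball x e0" using y by (simp add: dist_norm norm_minus_commute)
      then have "y \<notin> A" using e0(2) by blast
      then show ?thesis using d(2)[OF _ _ nuf_in_nu, of y] y nx by simp
    qed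
    moreover have "0 < min d e0" using d(1) e0(1) by simp
    ultimately show "\<exists>d>0. \<forall>y. norm (y - x) < d \<longrightarrow> norm (nuf y - nuf x - L (y - x)) \<le> e * norm (y - x)"
      by blast
  qed
qed

text \<open>Uniqueness of the derivative of the selection \<open>nuf\<close> makes the description
  in \<open>Dnu\<close> definite.\<close>

lemma Dnu_eq: "nu_diff_with \<phi> A x L \<Longrightarrow> Dnu \<phi> A x = L"
  unfolding Dnu_def
  by (rule the_equality) (auto intro: has_derivative_unique nuf_has_derivative nuf_in_nu)

text \<open>For uniqueness, a normal n is tested against \<open>dphi n\<close>, the point of the
  Wulff shape where n is largest. This forces \<open>n \<bullet> \<eta> = \<phi> n\<close>, the
  equality case of \<open>inner_le_phi_ps\<close>, so n is a positive multiple of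
  \<open>J \<eta>\<close>.\<close>

lemma nphi_eq:
  assumes "ps \<eta> = 1" shows "nphi \<phi> \<eta> = (1 / norm (J \<eta>)) *\<^sub>R J \<eta>"
proof -
  have \<eta>0: "\<eta> \<noteq> 0" using assms by auto
  then have J0: "J \<eta> \<noteq> 0" by simp
  show ?thesis unfolding nphi_def
  proof (rule the_equality)
    have "J \<eta> \<bullet> (y - \<eta>) \<le> 0" if "y \<in> Wphi \<phi>" for y
    proof -
      have "J \<eta> \<bullet> y \<le> \<phi> (J \<eta>) * ps y" by (rule inner_le_phi_ps)
      also have "\<dots> \<le> 1" using that assms by (simp add: phi_J Wphi_def)
      finally show ?thesis using J_inner[of \<eta>] assms by (simp add: inner_diff_right)
    qed
    then show "norm ((1 / norm (J \<eta>)) *\<^sub>R J \<eta>) = 1 \<and> (\<forall>y\<in>Wphi \<phi>. ((1 / norm (J \<eta>)) *\<^sub>R J \<eta>) \<bullet> (y - \<eta>) \<le> 0)"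
      using J0 by (simp add: divide_le_0_iff)
  next
    fix n assume n: "norm n = 1 \<and> (\<forall>y\<in>Wphi \<phi>. n \<bullet> (y - \<eta>) \<le> 0)"
    have n0: "n \<noteq> 0" using n by auto
    then have k: "0 < \<phi> n" by (rule phi_pos)
    have d: "dp (\<phi> n *\<^sub>R dphi n) n" by (rule dp_dphi[OF n0])
    then have p1: "ps (dphi n) = 1" using n0 by (simp add: dp_def ps_scale)
    then have "n \<bullet> (dphi n - \<eta>) \<le> 0" using n by (auto simp: Wphi_def)
    moreover have "n \<bullet> dphi n = \<phi> n" using dphi_self[OF n0] by (simp add: inner_commute)
    moreover have "n \<bullet> \<eta> \<le> \<phi> n" using inner_le_phi_ps[of n \<eta>] assms by simp
    ultimately have "n \<bullet> \<eta> = \<phi> n" by (simp add: inner_diff_right)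
    then have "dp \<eta> ((1 / \<phi> n) *\<^sub>R n)" using assms n0 by (simp add: dp_def phi_scale)
    then have J: "J \<eta> = (1 / \<phi> n) *\<^sub>R n" by (rule J_eq)
    then have "norm (J \<eta>) = 1 / \<phi> n" using n by simp
    then show "n = (1 / norm (J \<eta>)) *\<^sub>R J \<eta>" using J n0 by simp
  qed
qed

text \<open>A point of density one of the set where rho is at least sigma is a limit of points of that set,
  and the condition on the length of rays is closed because the projection is calm there.\<close>
lemma delta_ray_rphi_low:
  assumes a: "a \<in> A" "ps \<eta> = 1" and r: "0 < r" "ereal r < rphi_low \<phi> A a \<eta>"
  shows "\<delta> (a + r *\<^sub>R \<eta>) = r"
proof -
  from r(2) obtain \<sigma> r' where s: "1 < \<sigma>" "0 < r'" "ereal r' < rphi \<phi> A a \<eta>" "r < \<sigma> * r'"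
    and dens: "density_one {x. x \<notin> A \<and> rho_phi \<phi> A x \<ge> ereal \<sigma>} (a + r' *\<^sub>R \<eta>)"
    unfolding rphi_low_def less_Sup_iff using r(1) by auto
  define x where "x = a + r' *\<^sub>R \<eta>"
  define S where "S = {x. x \<notin> A \<and> rho_phi \<phi> A x \<ge> ereal \<sigma>}"
  obtain s1 where s1: "r' < s1" "\<delta> (a + s1 *\<^sub>R \<eta>) = s1"
    using s(3) unfolding rphi_def less_Sup_iff by auto
  obtain C where C: "0 < C" "\<And>z c. c \<in> \<xi> z \<Longrightarrow> norm (c - a) \<le> C * norm (z - x)"
    using xi_calm_on_ray[OF a s(2) s1] unfolding x_def by blast
  obtain M where M: "0 < M" "\<And>x y. \<bar>\<delta> x - \<delta> y\<bar> \<le> M * norm (x - y)" using delta_Lipschitz by blast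
  have dx: "\<delta> x = r'" unfolding x_def using ray_contract[OF a _ s1(2), of r'] s1 s(2) by simp
  have approx: "\<exists>y\<in>S. norm (y - x) < e" if e: "0 < e" for e
  proof (rule ccontr)
    assume "\<not> ?thesis"
    then have em: "S \<inter> ball x k = {}" if "k < e" for k
      using that by (auto simp: dist_norm norm_minus_commute)
    have lo: "leb_outer ({} :: 'a set) = 0"
    proof -
      have "leb_outer ({} :: 'a set) \<le> emeasure lebesgue ({} :: 'a set)"
        unfolding leb_outer_def by (rule INF_lower) simp
      then show ?thesis by simp
    qed
    have "\<forall>\<^sub>F k in at_right 0. enn2real (leb_outer (S \<inter> ball x k)) / measure lebesgue (ball x k) = 0"
      using em lo e by (auto simp: eventually_at_right intro!: exI[of _ e])
    then have "((\<lambda>k. enn2real (leb_outer (S \<inter> ball x k)) / measure lebesgue (ball x k)) \<longlongrightarrow> 0) (at_right 0)"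
      by (rule tendsto_eventually)
    moreover have "((\<lambda>k. enn2real (leb_outer (S \<inter> ball x k)) / measure lebesgue (ball x k)) \<longlongrightarrow> 1) (at_right 0)"
      using dens unfolding density_one_def S_def x_def .
    ultimately have "(0::real) = 1" by (intro tendsto_unique) auto
    then show False by simp
  qed
  \<comment> \<open>The factor from r' to r is below \<sigma>, so from points of S the ray still
    realises the distance up to this factor.\<close>
  define k where "k = r / r'"
  have k: "0 < k" "k < \<sigma>" "k * r' = r" using r s by (auto simp: k_def field_simps)
  have ray: "\<delta> (b + k *\<^sub>R (y - b)) = k * \<delta> y" if y: "y \<in> S" and b: "b = (SOME b. b \<in> \<xi> y)" for y b
  proof -
    have bx: "b \<in> \<xi> y" unfolding b by (rule someI_ex[OF xi_nonempty])
    have dy: "0 < \<delta> y" using y delta_pos by (auto simp: S_def)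
    have "ereal k < rho_phi \<phi> A y" using k(2) y
      by (simp add: S_def) (metis ereal_less_eq(3) less_ereal.simps(1) order_less_le_trans)
    then obtain s' where s': "k < s'" "\<delta> (b + s' *\<^sub>R (y - b)) = s' * \<delta> y"
      unfolding rho_phi_def b[symmetric] Let_def less_Sup_iff by auto
    define y' where "y' = b + s' *\<^sub>R (y - b)"
    have "b \<in> \<xi> y'" using s' k(1) xi_D[OF bx] by (simp add: y'_def xi_phi_def ps_scale)
    from xi_contract(1)[OF this, of "k / s'"] have "\<delta> (b + (k / s') *\<^sub>R (y' - b)) = k / s' * \<delta> y'"
      using k(1) s'(1) by simp
    then show ?thesis using s' k(1) by (simp add: y'_def)
  qed
  define K where "K = M * (\<bar>1 - k\<bar> * C + k) + k * M"
  have main: "\<bar>\<delta> (a + r *\<^sub>R \<eta>) - r\<bar> \<le> K * norm (y - x)" if y: "y \<in> S" for y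
  proof -
    define b where "b = (SOME b. b \<in> \<xi> y)"
    have bx: "b \<in> \<xi> y" unfolding b_def by (rule someI_ex[OF xi_nonempty])
    have e: "a + r *\<^sub>R \<eta> - (b + k *\<^sub>R (y - b)) = - ((1 - k) *\<^sub>R (b - a)) - k *\<^sub>R (y - x)"
      unfolding k(3)[symmetric] x_def by (simp add: algebra_simps)
    have "norm (a + r *\<^sub>R \<eta> - (b + k *\<^sub>R (y - b))) \<le> \<bar>1 - k\<bar> * norm (b - a) + k * norm (y - x)"
      unfolding e using norm_triangle_ineq4[of "- ((1 - k) *\<^sub>R (b - a))" "k *\<^sub>R (y - x)"] k(1) by simp
    also have "\<dots> \<le> \<bar>1 - k\<bar> * (C * norm (y - x)) + k * norm (y - x)"
      using C(2)[OF bx] by (intro add_right_mono mult_left_mono) auto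
    finally have n: "norm (a + r *\<^sub>R \<eta> - (b + k *\<^sub>R (y - b))) \<le> (\<bar>1 - k\<bar> * C + k) * norm (y - x)"
      by (simp add: algebra_simps)
    have "\<bar>\<delta> (a + r *\<^sub>R \<eta>) - \<delta> (b + k *\<^sub>R (y - b))\<bar> \<le> M * ((\<bar>1 - k\<bar> * C + k) * norm (y - x))"
      using M(1) n by (intro order_trans[OF M(2)] mult_left_mono) auto
    moreover have "\<bar>k * \<delta> y - k * r'\<bar> \<le> k * (M * norm (y - x))"
      using mult_left_mono[OF M(2)[of y x], of k] k(1) dx
      by (simp add: right_diff_distrib[symmetric] abs_mult)
    ultimately show ?thesis unfolding ray[OF y b_def] K_def k(3)
      by (simp add: algebra_simps)
  qed
  show ?thesis
  proof (rule ccontr)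
    assume "\<delta> (a + r *\<^sub>R \<eta>) \<noteq> r"
    then have p: "0 < \<bar>\<delta> (a + r *\<^sub>R \<eta>) - r\<bar>" by simp
    have K: "0 \<le> K" using M C k by (simp add: K_def)
    define e where "e = \<bar>\<delta> (a + r *\<^sub>R \<eta>) - r\<bar> / (K + 1)"
    have e: "0 < e" using p K by (simp add: e_def)
    obtain y where y: "y \<in> S" "norm (y - x) < e" using approx[OF e] by blast
    have "K * norm (y - x) \<le> K * e" using y K by (intro mult_left_mono) auto
    moreover have "(K + 1) * e = \<bar>\<delta> (a + r *\<^sub>R \<eta>) - r\<bar>" using K by (simp add: e_def)
    then have "K * e + e = \<bar>\<delta> (a + r *\<^sub>R \<eta>) - r\<bar>" by (simp add: distrib_right)
    ultimately show False using main[OF y(1)] e by linarith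
  qed
qed

abbreviation tang where "tang \<eta> \<equiv> {v. J \<eta> \<bullet> v = 0}"

text \<open>The density condition in \<open>rphi_low\<close> is spent here: at the r chosen in
  \<open>kappa_phi\<close> it yields \<open>\<delta> (a + r *\<^sub>R \<eta>) = r\<close>, and later
  arguments work with this equation and the derivative.\<close>

lemma kappa_char:
  assumes "(a, \<eta>) \<in> Ntilde \<phi> A"
  obtains r L where "a \<in> A" "ps \<eta> = 1" "0 < r" "\<delta> (a + r *\<^sub>R \<eta>) = r" "nu_diff_with \<phi> A (a + r *\<^sub>R \<eta>) L"
    "\<And>i. kappa_phi \<phi> A a \<eta> i = (if 1 - r * eig L (tang \<eta>) i = 0 then \<infinity> else ereal (eig L (tang \<eta>) i / (1 - r * eig L (tang \<eta>) i)))"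
proof -
  have a: "a \<in> A" "ps \<eta> = 1" using assms by (auto simp: Ntilde_def Nphi_iff)
  define r where "r = (SOME r. 0 < r \<and> ereal r < rphi_low \<phi> A a \<eta> \<and> a + r *\<^sub>R \<eta> \<in> dmn_Dnu \<phi> A)"
  have "\<exists>r. 0 < r \<and> ereal r < rphi_low \<phi> A a \<eta> \<and> a + r *\<^sub>R \<eta> \<in> dmn_Dnu \<phi> A"
    using assms by (auto simp: Ntilde_def)
  from someI_ex[OF this] have r: "0 < r" "ereal r < rphi_low \<phi> A a \<eta>" "a + r *\<^sub>R \<eta> \<in> dmn_Dnu \<phi> A"
    unfolding r_def[symmetric] by auto
  then obtain L where L: "nu_diff_with \<phi> A (a + r *\<^sub>R \<eta>) L" by (auto simp: dmn_Dnu_def)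
  have d: "\<delta> (a + r *\<^sub>R \<eta>) = r" by (rule delta_ray_rphi_low[OF a r(1,2)])
  have pt: "nu_pt \<phi> A (a + r *\<^sub>R \<eta>) = \<eta>" by (rule nu_diff_D(1)[OF L ray_point(3)[OF a r(1) d]])
  have "J \<eta> \<noteq> 0" using a(2) by auto
  then have V: "{v. v \<bullet> nphi \<phi> \<eta> = 0} = tang \<eta>"
    unfolding nphi_eq[OF a(2)] by (auto simp: inner_commute)
  have chi: "chi_phi \<phi> A (a + r *\<^sub>R \<eta>) i = eig L (tang \<eta>) i" for i
    unfolding chi_phi_def pt V Dnu_eq[OF L] ..
  have "kappa_phi \<phi> A a \<eta> i = (if 1 - r * eig L (tang \<eta>) i = 0 then \<infinity> else ereal (eig L (tang \<eta>) i / (1 - r * eig L (tang \<eta>) i)))" for i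
    unfolding kappa_phi_def r_def[symmetric] Let_def chi ..
  then show ?thesis using that a r(1) d L by blast
qed

end

section \<open>Derivatives inside the tube\<close>

context reach_set
begin

lemma proj_Lipschitz: "\<delta> y < d0 \<Longrightarrow> \<delta> z < d0 \<Longrightarrow> norm (proj y - proj z) \<le> (1 + CT) * norm (y - z)"
  using tube[OF _ _ proj_in_xi proj_in_xi, of y z]
    norm_triangle_ineq4[of "y - z" "(y - proj y) - (z - proj z)"]
  by (simp add: algebra_simps)

lemma continuous_proj: "continuous_on {z. \<delta> z < d0} proj"
proof -
  have "(1 + CT)-lipschitz_on {z. \<delta> z < d0} proj"
    using CT_pos by (intro lipschitz_onI) (auto simp: dist_norm proj_Lipschitz)
  then show ?thesis by (rule lipschitz_on_continuous_on)
qed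

lemma delta_has_derivative:
  assumes "\<delta> z < d0" "z \<notin> A" "w \<in> nu_phi \<phi> A z"
  shows "(\<delta> has_derivative (\<lambda>h. J w \<bullet> h)) (at z)"
proof -
  have d: "0 < \<delta> z" using assms(2) delta_pos by simp
  have c: "z - \<delta> z *\<^sub>R w \<in> \<xi> z" using nu_iff[OF assms(2)] assms(3) by blast
  have "((\<lambda>z. (\<delta> z)\<^sup>2 / 2) has_derivative (\<lambda>h. \<delta> z * (J w \<bullet> h))) (at z)"
    using has_derivative_delta_sq[OF assms(1) c] by (simp add: J_scale)
  then have "((\<lambda>y. 2 * ((\<delta> y)\<^sup>2 / 2)) has_derivative (\<lambda>h. 2 * (\<delta> z * (J w \<bullet> h)))) (at z)"
    by (rule has_derivative_mult_right)
  then have "((\<lambda>y. sqrt (2 * ((\<delta> y)\<^sup>2 / 2))) has_derivative (\<lambda>h. (2 * (\<delta> z * (J w \<bullet> h))) * (inverse (sqrt (2 * ((\<delta> z)\<^sup>2 / 2))) / 2))) (at z)"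
    by (intro has_derivative_real_sqrt) (use d in auto)
  moreover have "(\<lambda>y. sqrt (2 * ((\<delta> y)\<^sup>2 / 2))) = \<delta>" by (simp add: delta_nonneg)
  moreover have "(\<lambda>h. (2 * (\<delta> z * (J w \<bullet> h))) * (inverse (sqrt (2 * ((\<delta> z)\<^sup>2 / 2))) / 2)) = (\<lambda>h. J w \<bullet> h)"
    using d by (simp add: delta_nonneg field_simps)
  ultimately show ?thesis by simp
qed

context
  fixes a \<eta> s L
  assumes a: "a \<in> A" "ps \<eta> = 1" and s: "0 < s" "s < d0" "\<delta> (a + s *\<^sub>R \<eta>) = s"
    and L: "nu_diff_with \<phi> A (a + s *\<^sub>R \<eta>) L"
begin

lemma nuf_deriv: "(nuf has_derivative L) (at (a + s *\<^sub>R \<eta>))"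
  and delta_deriv: "(\<delta> has_derivative (\<lambda>h. J \<eta> \<bullet> h)) (at (a + s *\<^sub>R \<eta>))"
  and nuf_eq: "nuf (a + s *\<^sub>R \<eta>) = \<eta>" and L_linear: "linear L"
proof -
  note rp = ray_point[OF a s(1) s(3)]
  show "(nuf has_derivative L) (at (a + s *\<^sub>R \<eta>))" by (rule nuf_has_derivative[OF L rp(3)])
  show "(\<delta> has_derivative (\<lambda>h. J \<eta> \<bullet> h)) (at (a + s *\<^sub>R \<eta>))"
    by (rule delta_has_derivative) (use s rp in auto)
  show "linear L" by (rule nu_diff_D(2)[OF L rp(3)])
  have "proj (a + s *\<^sub>R \<eta>) = a" by (rule xi_unique[OF _ proj_in_xi rp(1)]) (use s in simp)
  then show "nuf (a + s *\<^sub>R \<eta>) = \<eta>" using s by (simp add: nuf_def)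
qed

lemma diff_proj_deriv: "((\<lambda>z. z - proj z) has_derivative (\<lambda>h. s *\<^sub>R L h + (J \<eta> \<bullet> h) *\<^sub>R \<eta>)) (at (a + s *\<^sub>R \<eta>))"
proof -
  have "((\<lambda>z. \<delta> z *\<^sub>R nuf z) has_derivative (\<lambda>h. s *\<^sub>R L h + (J \<eta> \<bullet> h) *\<^sub>R \<eta>)) (at (a + s *\<^sub>R \<eta>))"
    using has_derivative_scaleR[OF delta_deriv nuf_deriv] unfolding s(3) nuf_eq .
  then show ?thesis by (simp add: proj_eq)
qed

lemma proj_deriv: "(proj has_derivative (\<lambda>h. h - (s *\<^sub>R L h + (J \<eta> \<bullet> h) *\<^sub>R \<eta>))) (at (a + s *\<^sub>R \<eta>))"
  using has_derivative_diff[OF has_derivative_ident diff_proj_deriv] by simp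

text \<open>Off A all normals lie on the level set \<open>ps = 1\<close>, whose tangent space at
  \<eta> is \<open>tang \<eta>\<close>.\<close>

lemma L_tangent: "J \<eta> \<bullet> L h = 0"
proof -
  let ?x = "a + s *\<^sub>R \<eta>"
  have "((\<lambda>z. (ps (nuf z))\<^sup>2 / 2) has_derivative (\<lambda>h. J \<eta> \<bullet> L h)) (at ?x)"
    using has_derivative_compose[OF nuf_deriv has_derivative_ps_sq[of "nuf ?x"]] nuf_eq by simp
  moreover have "((\<lambda>z. (ps (nuf z))\<^sup>2 / 2) has_derivative (\<lambda>h. 0)) (at ?x)"
  proof (rule has_derivative_transform_within_open[where f = "\<lambda>_. 1 / 2" and s = "- A"])
    show "?x \<in> - A" using ray_point(2)[OF a s(1) s(3)] by simp
    fix z assume "z \<in> - A"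
    then show "1 / 2 = (ps (nuf z))\<^sup>2 / 2" using ps_nu[OF _ nuf_in_nu, of z] by simp
  qed (use closed_A in auto)
  ultimately show ?thesis by (metis has_derivative_unique)
qed

lemma L_eigenbasis: "\<exists>es cs. eigenbasis L (tang \<eta>) es cs"
proof -
  let ?x = "a + s *\<^sub>R \<eta>"
  have "s *\<^sub>R \<eta> \<noteq> 0" using s a(2) by auto
  then obtain K where K: "(J has_derivative K) (at (s *\<^sub>R \<eta>))" "\<And>v w. K v \<bullet> w = v \<bullet> K w" "\<And>v. v \<noteq> 0 \<Longrightarrow> 0 < K v \<bullet> v"
    using J_differentiable by blast
  have lK: "linear K" using K(1) by (rule has_derivative_linear)
  define X where "X = (\<lambda>h. s *\<^sub>R L h + (J \<eta> \<bullet> h) *\<^sub>R \<eta>)"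
  have px: "?x - proj ?x = s *\<^sub>R \<eta>" using nuf_eq s(3) by (simp add: proj_eq)
  have dG: "((\<lambda>z. J (z - proj z)) has_derivative (\<lambda>h. K (X h))) (at ?x)"
    by (rule has_derivative_compose[where g = J and f = "\<lambda>z. z - proj z"])
      (use diff_proj_deriv K(1) px in \<open>simp_all add: X_def\<close>)
  have sym: "K (X v) \<bullet> w = v \<bullet> K (X w)" for v w
  proof (rule gradient_derivative_symmetric[OF open_tube _ _ dG])
    show "?x \<in> {z. \<delta> z < d0}" using s by simp
    fix y assume "y \<in> {z. \<delta> z < d0}"
    then show "((\<lambda>z. (\<delta> z)\<^sup>2 / 2) has_derivative (\<bullet>) (J (y - proj y))) (at y)"
      using has_derivative_delta_sq[OF _ proj_in_xi] by simp
  qed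
  have sub: "subspace (tang \<eta>)" by (rule subspace_hyperplane)
  show ?thesis
  proof (rule selfadjoint_eigenbasis[OF sub L_linear lK _ K(2,3)])
    show "L v \<in> tang \<eta>" for v using L_tangent by simp
    fix v w assume vw: "v \<in> tang \<eta>" "w \<in> tang \<eta>"
    \<comment> \<open>On tangent vectors the radial term of X vanishes, leaving s L.\<close>
    then have "s * (K (L v) \<bullet> w) = s * (v \<bullet> K (L w))"
      using sym[of v w] by (simp add: X_def linear_cmul[OF lK])
    then show "K (L v) \<bullet> w = v \<bullet> K (L w)" using s by simp
  qed
qed

end

text \<open>Diagonalise at the parameter t inside the tube; by the formula of nu_diff_transfer the same
  eigenvectors serve for L.\<close>
lemma eigendata:
  assumes a: "a \<in> A" "ps \<eta> = 1" and r: "\<delta> (a + r *\<^sub>R \<eta>) = r"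
    and L: "nu_diff_with \<phi> A (a + r *\<^sub>R \<eta>) L" and t: "0 < t" "t < r" "t < d0"
  obtains L' es cs where "nu_diff_with \<phi> A (a + t *\<^sub>R \<eta>) L'" "eigenbasis L (tang \<eta>) es cs"
    "eigenbasis L' (tang \<eta>) es (map (\<lambda>c. c / (1 - (r - t) * c)) cs)" "\<And>c. c \<in> set cs \<Longrightarrow> r * c \<le> 1"
proof -
  define \<tau> where "\<tau> = r - t"
  have \<tau>: "0 < \<tau>" "\<tau> < r" "0 < r" using t by (auto simp: \<tau>_def)
  have lL: "linear L" by (rule nu_diff_D(2)[OF L ray_point(3)[OF a \<tau>(3) r]])
  define M where "M = (\<lambda>h. h - \<tau> *\<^sub>R L h)"
  have lM: "linear M" unfolding M_def
    by (intro linear_compose_sub linear_ident linear_compose_scale_right lL)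
  have "inj M"
  proof (rule linear_injective_0[OF lM, THEN iffD2], intro allI impI)
    fix v assume "M v = 0"
    then show "v = 0" by (intro retraction_derivative_injective[OF a r L \<tau>(1,2)]) (simp add: M_def)
  qed
  then obtain N where N: "linear N" "\<And>x. M (N x) = x"
    using linear_injective_isomorphism[OF lM] by blast
  define L' where "L' = (\<lambda>h. L (N h))"
  have L': "nu_diff_with \<phi> A (a + t *\<^sub>R \<eta>) L'"
    unfolding L'_def by (rule nu_diff_transfer[OF a r L t N(1)]) (use N(2) in \<open>simp add: M_def \<tau>_def\<close>)
  have dt: "\<delta> (a + t *\<^sub>R \<eta>) = t" by (rule ray_contract[OF a \<tau>(3) r]) (use t in auto)
  obtain es ms where E: "eigenbasis L' (tang \<eta>) es ms"
    using L_eigenbasis[OF a t(1,3) dt L'] by blast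
  have sub: "subspace (tang \<eta>)" by (rule subspace_hyperplane)
  let ?n = "dim (tang \<eta>)"
  have Ee: "L' (es ! i) = ms ! i *\<^sub>R es ! i" "es ! i \<noteq> 0" if "i < ?n" for i
    using E eigenbasis_nonzero[OF sub E that] that by (auto simp: eigenbasis_def)
  \<comment> \<open>N is I + \<tau> L', so an eigenvector of L' for m is one of L for m / (1 +
    \<tau> m), which inverts c / (1 - \<tau> c).\<close>
  have key: "1 + \<tau> * ms ! i \<noteq> 0 \<and> L (es ! i) = (ms ! i / (1 + \<tau> * ms ! i)) *\<^sub>R es ! i" if i: "i < ?n" for i
  proof -
    let ?e = "es ! i" and ?m = "ms ! i"
    have "N ?e = ?e + \<tau> *\<^sub>R L' ?e" using N(2)[of ?e] by (simp add: M_def L'_def algebra_simps)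
    also have "\<dots> = (1 + \<tau> * ?m) *\<^sub>R ?e" using Ee(1)[OF i] by (simp add: scaleR_add_left)
    finally have Ne: "N ?e = (1 + \<tau> * ?m) *\<^sub>R ?e" .
    have nz: "1 + \<tau> * ?m \<noteq> 0"
    proof
      assume "1 + \<tau> * ?m = 0"
      then have "N ?e = 0" using Ne by simp
      then have "?e = 0" using N(2)[of ?e] linear_0[OF lM] by simp
      then show False using Ee(2)[OF i] by simp
    qed
    have "?m *\<^sub>R ?e = L (N ?e)" using Ee(1)[OF i] by (simp add: L'_def)
    also have "\<dots> = (1 + \<tau> * ?m) *\<^sub>R L ?e" unfolding Ne by (simp only: linear_cmul[OF lL])
    finally have "(1 / (1 + \<tau> * ?m)) *\<^sub>R (?m *\<^sub>R ?e) = (1 / (1 + \<tau> * ?m)) *\<^sub>R ((1 + \<tau> * ?m) *\<^sub>R L ?e)" by simp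
    then show ?thesis using nz by simp
  qed
  define cs where "cs = map (\<lambda>m. m / (1 + \<tau> * m)) ms"
  have lms: "length ms = ?n" using E by (simp add: eigenbasis_def)
  have EL: "eigenbasis L (tang \<eta>) es cs"
    using E key lms by (simp add: eigenbasis_def cs_def)
  have "map (\<lambda>c. c / (1 - \<tau> * c)) cs = ms"
  proof (rule nth_equalityI)
    fix i assume "i < length (map (\<lambda>c. c / (1 - \<tau> * c)) cs)"
    then have i: "i < ?n" using lms by (simp add: cs_def)
    have nz: "1 + \<tau> * ms ! i \<noteq> 0" using key[OF i] by simp
    have "1 - \<tau> * (ms ! i / (1 + \<tau> * ms ! i)) = 1 / (1 + \<tau> * ms ! i)" using nz by (simp add: field_simps)
    then show "map (\<lambda>c. c / (1 - \<tau> * c)) cs ! i = ms ! i"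
      using i lms nz by (simp add: cs_def)
  qed (simp add: cs_def)
  then have E2: "eigenbasis L' (tang \<eta>) es (map (\<lambda>c. c / (1 - (r - t) * c)) cs)" using E by (simp add: \<tau>_def)
  \<comment> \<open>Otherwise 1 / c < r and the eigenvector lies in the kernel of I - (1 / c) L,
    which \<open>retraction_derivative_injective\<close> makes trivial.\<close>
  have "r * c \<le> 1" if c: "c \<in> set cs" for c
  proof (rule ccontr)
    assume "\<not> r * c \<le> 1"
    then have rc: "1 < r * c" by simp
    have c0: "0 < c" using rc \<tau>(3) zero_less_mult_pos[of r c] by linarith
    obtain i where i: "i < ?n" "cs ! i = c" using c EL by (auto simp: in_set_conv_nth eigenbasis_def)
    have "L (es ! i) = c *\<^sub>R es ! i" using EL i by (auto simp: eigenbasis_def)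
    then have "es ! i = (1 / c) *\<^sub>R L (es ! i)" using c0 by simp
    then have "es ! i = 0"
      by (intro retraction_derivative_injective[OF a r L, of "1 / c"]) (use c0 rc in \<open>auto simp: field_simps\<close>)
    then show False using Ee(2)[OF i(1)] by simp
  qed
  then show ?thesis using that L' EL E2 by blast
qed

end

section \<open>Local graphs in the boundary\<close>

context smooth_norm_set
begin

text \<open>From an interior point of A one could move towards y within A, although the distance to
  A is positive on that segment.\<close>

lemma xi_frontier:
  assumes "c \<in> \<xi> y" "y \<notin> A" shows "c \<in> frontier A"
proof -
  have "c \<notin> interior A"
  proof
    assume "c \<in> interior A"
    then obtain e where e: "0 < e" "ball c e \<subseteq> A" by (auto simp: mem_interior)
    have yc: "y \<noteq> c" using assms xi_D(1)[OF assms(1)] by auto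
    define k where "k = min 1 (e / (2 * norm (y - c)))"
    have k: "0 < k" "k \<le> 1" using e(1) yc by (auto simp: k_def)
    have "k * norm (y - c) \<le> e / (2 * norm (y - c)) * norm (y - c)"
      by (rule mult_right_mono) (auto simp: k_def)
    then have "c + k *\<^sub>R (y - c) \<in> ball c e" using e(1) yc k by (simp add: dist_norm)
    then have "c + k *\<^sub>R (y - c) \<in> A" using e(2) by blast
    moreover have "0 < \<delta> (c + k *\<^sub>R (y - c))"
      using xi_contract(1)[OF assms(1), of k] k assms(2) delta_pos by simp
    ultimately show False using delta_pos by blast
  qed
  moreover have "c \<in> closure A" using xi_D(1)[OF assms(1)] closure_subset by blast
  ultimately show ?thesis by (simp add: frontier_def)
qed

lemma nuf_Nphi:
  assumes "y \<notin> A" shows "nuf y \<in> frontier (Wphi \<phi>)" "nuf y \<in> Nphi_at \<phi> A (proj y)"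
proof -
  have d: "0 < \<delta> y" using assms delta_pos by simp
  have 1: "ps (nuf y) = 1" by (rule ps_nu[OF assms nuf_in_nu])
  then show "nuf y \<in> frontier (Wphi \<phi>)" by (simp add: frontier_Wphi)
  have "proj y + \<delta> y *\<^sub>R nuf y = y" by (simp add: proj_eq)
  then have "\<delta> (proj y + \<delta> y *\<^sub>R nuf y) = \<delta> y" by simp
  then show "nuf y \<in> Nphi_at \<phi> A (proj y)"
    using d 1 xi_D(1)[OF proj_in_xi] unfolding Nphi_at_def Nphi_iff by blast
qed

lemma dim_tang: "ps \<eta> = 1 \<Longrightarrow> dim (tang \<eta>) = DIM('a) - 1"
  by (rule dim_hyperplane) auto

end

context reach_set
begin

text \<open>Y is a right inverse, obtained from the open mapping theorem, of the map F that combines proj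
  followed by the linear projection along n with the coordinate transversal to the tangent space.\<close>
lemma graph_parametrization:
  assumes a: "a \<in> A" "ps \<eta> = 1" and s: "0 < s" "s < d0" "\<delta> (a + s *\<^sub>R \<eta>) = s"
    and L: "nu_diff_with \<phi> A (a + s *\<^sub>R \<eta>) L"
    and surjL: "\<And>w. w \<in> tang \<eta> \<Longrightarrow> \<exists>v\<in>tang \<eta>. v - s *\<^sub>R L v = w"
    and n: "norm n = 1" "J \<eta> \<bullet> n \<noteq> 0"
  shows "\<exists>\<epsilon>>0. \<exists>Y D. Y a = a + s *\<^sub>R \<eta> \<and> (Y has_derivative D) (at a) \<and>
    (\<forall>b\<in>U_disk \<epsilon> a n. Y b \<notin> A \<and> proj (Y b) = b + ((proj (Y b) - a) \<bullet> n) *\<^sub>R n) \<and>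
    (\<forall>v\<in>tang \<eta>. D ((v - s *\<^sub>R L v) - ((v - s *\<^sub>R L v) \<bullet> n) *\<^sub>R n) = v)"
proof -
  define x where "x = a + s *\<^sub>R \<eta>"
  define P where "P = (\<lambda>z. z - (z \<bullet> n) *\<^sub>R n)"
  have lP: "linear P" unfolding P_def
    by (intro linearI) (auto simp: inner_add_left algebra_simps)
  have nn: "n \<bullet> n = 1" using n(1) by (simp add: dot_square_norm)
  have Pn: "P z \<bullet> n = 0" for z using nn by (simp add: P_def inner_diff_left)
  have lL: "linear L" by (rule L_linear[OF a s L])
  have px: "proj x = a" unfolding x_def
    by (rule xi_unique[OF _ proj_in_xi ray_point(1)[OF a s(1) s(3)]]) (use s in simp)
  define F where "F = (\<lambda>y. P (proj y - a) + (J \<eta> \<bullet> (y - x)) *\<^sub>R n)"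
  define D where "D = (\<lambda>h. P (h - (s *\<^sub>R L h + (J \<eta> \<bullet> h) *\<^sub>R \<eta>)) + (J \<eta> \<bullet> h) *\<^sub>R n)"
  have bP: "bounded_linear P" using lP by (simp add: linear_conv_bounded_linear)
  have dF: "(F has_derivative D) (at x)"
    unfolding F_def D_def
  proof (intro has_derivative_add)
    have "((\<lambda>y. proj y - a) has_derivative (\<lambda>h. h - (s *\<^sub>R L h + (J \<eta> \<bullet> h) *\<^sub>R \<eta>) - 0)) (at x)"
      unfolding x_def by (intro has_derivative_diff proj_deriv[OF a s L] has_derivative_const)
    then show "((\<lambda>y. P (proj y - a)) has_derivative (\<lambda>h. P (h - (s *\<^sub>R L h + (J \<eta> \<bullet> h) *\<^sub>R \<eta>)))) (at x)"
      using bounded_linear.has_derivative[OF bP] by fastforce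
    have "((\<lambda>y. y - x) has_derivative (\<lambda>h. h - 0)) (at x)"
      by (intro has_derivative_diff has_derivative_const has_derivative_ident)
    then show "((\<lambda>y. (J \<eta> \<bullet> (y - x)) *\<^sub>R n) has_derivative (\<lambda>h. (J \<eta> \<bullet> h) *\<^sub>R n)) (at x)"
      by (intro has_derivative_scaleR_left has_derivative_inner_right) simp
  qed
  have lD: "linear D" using dF by (rule has_derivative_linear)
  have J1: "J \<eta> \<bullet> \<eta> = 1" using J_inner[of \<eta>] a(2) by simp
  have "surj D"
    unfolding surj_def
  proof
    fix z
    \<comment> \<open>To solve D h = z, the radial part k of h fixes the transversal coordinate. The
      tangential part is then the preimage of w, the projection of the corrected vector q along n; P
      removes the multiple of n lost in that projection.\<close>
    define k where "k = z \<bullet> n"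
    define q where "q = z + (s * k) *\<^sub>R L \<eta>"
    define w where "w = q - ((J \<eta> \<bullet> q) / (J \<eta> \<bullet> n)) *\<^sub>R n"
    have "w \<in> tang \<eta>" using n(2) by (simp add: w_def inner_diff_right)
    then obtain v where v: "v \<in> tang \<eta>" "v - s *\<^sub>R L v = w" using surjL by blast
    have Jh: "J \<eta> \<bullet> (k *\<^sub>R \<eta> + v) = k" using v(1) J1 by (simp add: inner_add_right)
    have "k *\<^sub>R \<eta> + v - (s *\<^sub>R L (k *\<^sub>R \<eta> + v) + k *\<^sub>R \<eta>) = (v - s *\<^sub>R L v) - (s * k) *\<^sub>R L \<eta>"
      by (simp add: linear_add[OF lL] linear_cmul[OF lL] algebra_simps)
    also have "\<dots> = z - ((J \<eta> \<bullet> q) / (J \<eta> \<bullet> n)) *\<^sub>R n" unfolding v(2) w_def q_def by simp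
    finally have "D (k *\<^sub>R \<eta> + v) = P (z - ((J \<eta> \<bullet> q) / (J \<eta> \<bullet> n)) *\<^sub>R n) + k *\<^sub>R n"
      unfolding D_def Jh by simp
    also have "\<dots> = z" using nn by (simp add: P_def k_def inner_diff_left algebra_simps)
    finally show "\<exists>h. z = D h" by metis
  qed
  then obtain D' where D': "linear D'" "\<And>h. D' (D h) = h" "\<And>h. D (D' h) = h"
    using linear_surjective_isomorphism[OF lD] by blast
  obtain B where B: "0 < B" "\<And>h. norm (D' h) \<le> B * norm h" using linear_bounded_pos[OF D'(1)] by blast
  have F0: "F x = 0" using px linear_0[OF lP] by (simp add: F_def)
  obtain r1 where r1: "0 < r1" "\<And>y. norm (y - x) < r1 \<Longrightarrow> norm (F y - F x - D (y - x)) \<le> 1 / (2 * B) * norm (y - x)"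
  proof -
    have "0 < 1 / (2 * B)" using B(1) by simp
    then show ?thesis using dF that unfolding has_derivative_at_alt by blast
  qed
  \<comment> \<open>As D is invertible, F cannot shrink small displacements too much. This makes the
    selection Y below continuous at a, although it is chosen pointwise.\<close>
  have lower: "norm (y - x) \<le> 2 * B * norm (F y)" if y: "norm (y - x) < r1" for y
  proof -
    have "norm (y - x) \<le> B * norm (D (y - x))" using B(2)[of "D (y - x)"] D'(2) by simp
    also have "norm (D (y - x)) \<le> norm (F y) + norm (F y - D (y - x))"
      using norm_triangle_ineq4[of "F y" "F y - D (y - x)"] by simp
    also have "norm (F y - D (y - x)) \<le> 1 / (2 * B) * norm (y - x)" using r1(2)[OF y] F0 by simp
    finally have "norm (y - x) \<le> B * norm (F y) + norm (y - x) / 2"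
      using B(1) by (simp add: distrib_left)
    then show ?thesis by simp
  qed
  have xA: "x \<notin> A" unfolding x_def by (rule ray_point(2)[OF a s(1) s(3)])
  define S where "S = - A \<inter> {z. \<delta> z < d0}"
  have S: "open S" "x \<in> S" unfolding S_def using closed_A open_tube xA s by (auto simp: x_def open_Int)
  obtain r2 where r2: "0 < r2" "ball x r2 \<subseteq> S" using S openE by blast
  define T where "T = ball x (min r1 r2)"
  have T: "T \<subseteq> S" "x \<in> interior T" using r1 r2 by (auto simp: T_def interior_open)
  have cF: "continuous_on S F" unfolding F_def
    by (intro continuous_intros continuous_on_compose2[OF linear_continuous_on[OF bP], of S "\<lambda>y. proj y - a"]
        continuous_on_subset[OF continuous_proj]) (auto simp: S_def)
  \<comment> \<open>This open mapping theorem takes a continuous map with a derivative at the single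
    point x.\<close>
  have "F x \<in> interior (F ` T)"
  proof (rule sussmann_open_mapping[OF S(1) cF S(2) dF _ _ T])
    show "bounded_linear D'" using D'(1) by (simp add: linear_conv_bounded_linear)
    show "D \<circ> D' = id" using D'(3) by auto
  qed
  then obtain \<epsilon> where e: "0 < \<epsilon>" "ball 0 \<epsilon> \<subseteq> F ` T" unfolding F0 by (auto simp: mem_interior)
  define Y where "Y = (\<lambda>b. SOME y. y \<in> T \<and> F y = b - a)"
  have Y: "Y b \<in> T \<and> F (Y b) = b - a" if "norm (b - a) < \<epsilon>" for b
  proof -
    have "b - a \<in> F ` T" using that e(2) by (auto simp: subset_eq)
    then have "\<exists>y. y \<in> T \<and> F y = b - a" by auto
    then show ?thesis unfolding Y_def by (rule someI_ex)
  qed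
  have Yn: "norm (Y b - x) \<le> 2 * B * norm (b - a)" if "norm (b - a) < \<epsilon>" for b
    using lower[of "Y b"] Y[OF that] by (auto simp: T_def dist_norm norm_minus_commute)
  have Ya: "Y a = x" using Yn[of a] e(1) by simp
  have dY: "(Y has_derivative D') (at a)"
  proof (rule has_derivative_inverse_basic[where f = "\<lambda>y. F y + a" and f' = D and T = "ball a \<epsilon>"])
    show "((\<lambda>y. F y + a) has_derivative D) (at (Y a))"
      unfolding Ya using has_derivative_add[OF dF has_derivative_const[of a]] by simp
    show "bounded_linear D'" using D'(1) by (simp add: linear_conv_bounded_linear)
    show "D' \<circ> D = id" using D'(2) by auto
    show "continuous (at a) Y" unfolding continuous_at Lim_at dist_norm Ya
    proof (intro allI impI)
      fix e1 :: real assume e1: "0 < e1"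
      have "norm (Y b - x) < e1" if b: "norm (b - a) < min \<epsilon> (e1 / (2 * B))" for b
      proof -
        have "2 * B * norm (b - a) < 2 * B * (e1 / (2 * B))" using b B(1) by (intro mult_strict_left_mono) auto
        then show ?thesis using Yn[of b] b B(1) by simp
      qed
      moreover have "0 < min \<epsilon> (e1 / (2 * B))" using e(1) e1 B(1) by simp
      ultimately show "\<exists>d>0. \<forall>b. 0 < norm (b - a) \<and> norm (b - a) < d \<longrightarrow> norm (Y b - x) < e1" by blast
    qed
    show "F (Y z) + a = z" if "z \<in> ball a \<epsilon>" for z
      using Y[of z] that by (simp add: dist_norm norm_minus_commute)
  qed (use e in auto)
  have YA: "Y b \<notin> A" if "b \<in> U_disk \<epsilon> a n" for b
    using Y[of b] that T(1) by (auto simp: U_disk_def S_def)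
  have Yp: "proj (Y b) = b + ((proj (Y b) - a) \<bullet> n) *\<^sub>R n" if b: "b \<in> U_disk \<epsilon> a n" for b
  proof -
    \<comment> \<open>On the disk b - a has no component along n, so the transversal coordinate of F
      vanishes and only the projected point remains.\<close>
    have FY: "F (Y b) = b - a" "(b - a) \<bullet> n = 0" using Y[of b] b by (auto simp: U_disk_def)
    have "F (Y b) \<bullet> n = J \<eta> \<bullet> (Y b - x)" using Pn nn by (simp add: F_def inner_add_left)
    then have "J \<eta> \<bullet> (Y b - x) = 0" using FY by simp
    then have "P (proj (Y b) - a) = b - a" using FY(1) by (simp add: F_def)
    then show ?thesis unfolding P_def by (simp add: algebra_simps)
  qed
  have "D' ((v - s *\<^sub>R L v) - ((v - s *\<^sub>R L v) \<bullet> n) *\<^sub>R n) = v" if "v \<in> tang \<eta>" for v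
    using D'(2)[of v] that by (simp add: D_def P_def)
  then show ?thesis using e(1) Ya dY YA Yp
    by (intro exI[of _ \<epsilon>] exI[of _ Y] exI[of _ D'] conjI ballI) (auto simp: x_def)
qed

text \<open>Moves finiteness from the r in \<open>kappa_phi\<close> to a parameter t in the tube: 1
  - t m = (1 - r c) / (1 - (r - t) c), so finite curvatures make I - t L invertible on the tangent
  space, and they equal m / (1 - t m).\<close>

lemma Ntilde_n_data:
  assumes "(a, \<eta>) \<in> Ntilde_n \<phi> A"
  shows "\<exists>s L es ms. a \<in> A \<and> ps \<eta> = 1 \<and> 0 < s \<and> s < d0 \<and> \<delta> (a + s *\<^sub>R \<eta>) = s \<and>
    nu_diff_with \<phi> A (a + s *\<^sub>R \<eta>) L \<and> eigenbasis L (tang \<eta>) es ms \<and> (\<forall>m\<in>set ms. 1 - s * m \<noteq> 0) \<and>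
    (\<forall>i\<in>{1..DIM('a) - 1}. kappa_phi \<phi> A a \<eta> i = ereal (sort (map (\<lambda>m. m / (1 - s * m)) ms) ! (i - 1)))"
proof -
  have N: "(a, \<eta>) \<in> Ntilde \<phi> A" and fin: "\<And>i. i \<in> {1..DIM('a) - 1} \<Longrightarrow> kappa_phi \<phi> A a \<eta> i \<noteq> \<infinity>"
    using assms by (auto simp: Ntilde_n_def)
  obtain r L0 where a: "a \<in> A" "ps \<eta> = 1" and r: "0 < r" "\<delta> (a + r *\<^sub>R \<eta>) = r"
    and L0: "nu_diff_with \<phi> A (a + r *\<^sub>R \<eta>) L0"
    and kap: "\<And>i. kappa_phi \<phi> A a \<eta> i = (if 1 - r * eig L0 (tang \<eta>) i = 0 then \<infinity> else ereal (eig L0 (tang \<eta>) i / (1 - r * eig L0 (tang \<eta>) i)))"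
    using kappa_char[OF N] by blast
  define t where "t = min r d0 / 2"
  have t: "0 < t" "t < r" "t < d0" using r d0_pos by (auto simp: t_def min_def)
  obtain L es cs where L: "nu_diff_with \<phi> A (a + t *\<^sub>R \<eta>) L" and E0: "eigenbasis L0 (tang \<eta>) es cs"
    and E: "eigenbasis L (tang \<eta>) es (map (\<lambda>c. c / (1 - (r - t) * c)) cs)" and le: "\<And>c. c \<in> set cs \<Longrightarrow> r * c \<le> 1"
    using eigendata[OF a r(2) L0 t] by blast
  have sub: "subspace (tang \<eta>)" by (rule subspace_hyperplane)
  have lL0: "linear L0" by (rule nu_diff_D(2)[OF L0 ray_point(3)[OF a r]])
  have lc: "length cs = DIM('a) - 1" using E0 dim_tang[OF a(2)] by (simp add: eigenbasis_def)
  have eig: "eig L0 (tang \<eta>) i = sort cs ! (i - 1)" for i by (rule eig_eigenbasis[OF sub lL0 E0])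
  have ne: "1 - r * c \<noteq> 0" if "c \<in> set cs" for c
  proof -
    have "c \<in> set (sort cs)" using that by simp
    then obtain j where j: "j < DIM('a) - 1" "sort cs ! j = c" using lc unfolding in_set_conv_nth by auto
    \<comment> \<open>Curvatures are numbered from 1, list entries from 0.\<close>
    then have "kappa_phi \<phi> A a \<eta> (Suc j) \<noteq> \<infinity>" by (intro fin) auto
    then show ?thesis using j(2) kap[of "Suc j"] eig[of "Suc j"] by auto
  qed
  have lt: "r * c < 1" if "c \<in> set cs" for c using le[OF that] ne[OF that] by linarith
  have q: "0 < 1 - (r - t) * c" if "c \<in> set cs" for c
  proof (cases "0 \<le> c")
    case True
    then have "(r - t) * c \<le> r * c" using t by (intro mult_right_mono) auto
    then show ?thesis using lt[OF that] by linarith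
  next
    case False
    then have "(r - t) * c \<le> 0" using t by (simp add: mult_le_0_iff)
    then show ?thesis by linarith
  qed
  define ms where "ms = map (\<lambda>c. c / (1 - (r - t) * c)) cs"
  have m1: "1 - t * (c / (1 - (r - t) * c)) = (1 - r * c) / (1 - (r - t) * c)" if "c \<in> set cs" for c
    using q[OF that] by (simp add: field_simps)
  have nz: "1 - t * m \<noteq> 0" if "m \<in> set ms" for m
  proof -
    obtain c where c: "c \<in> set cs" "m = c / (1 - (r - t) * c)" using \<open>m \<in> set ms\<close> by (auto simp: ms_def)
    have "1 - t * m = (1 - r * c) / (1 - (r - t) * c)" using m1[OF c(1)] c(2) by simp
    then show ?thesis using q[OF c(1)] ne[OF c(1)] by simp
  qed
  have mm: "map (\<lambda>m. m / (1 - t * m)) ms = map (\<lambda>c. c / (1 - r * c)) cs"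
    unfolding ms_def map_map o_def
  proof (rule map_cong[OF refl])
    fix c assume c: "c \<in> set cs"
    show "c / (1 - (r - t) * c) / (1 - t * (c / (1 - (r - t) * c))) = c / (1 - r * c)"
      unfolding m1[OF c] using q[OF c] ne[OF c] by simp
  qed
  \<comment> \<open>All r c are below 1, so the spectrum lies on one branch of c / (1 - r c) and
    sorting commutes with this map.\<close>
  have "mono_on (set cs) (\<lambda>c. c / (1 - r * c))"
  proof (rule mono_onI)
    fix c c' assume c: "c \<in> set cs" "c' \<in> set cs" "c \<le> c'"
    have "c * (1 - r * c') \<le> c' * (1 - r * c)" using c(3) by (simp add: algebra_simps)
    then show "c / (1 - r * c) \<le> c' / (1 - r * c')"
      using lt[OF c(1)] lt[OF c(2)] by (simp add: frac_le_eq divide_le_0_iff mult.commute)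
  qed
  then have sm: "sort (map (\<lambda>m. m / (1 - t * m)) ms) = map (\<lambda>c. c / (1 - r * c)) (sort cs)"
    unfolding mm by (rule sort_map_mono)
  have "kappa_phi \<phi> A a \<eta> i = ereal (sort (map (\<lambda>m. m / (1 - t * m)) ms) ! (i - 1))"
    if i: "i \<in> {1..DIM('a) - 1}" for i
  proof -
    have il: "i - 1 < length (sort cs)" using i lc by auto
    then have "sort cs ! (i - 1) \<in> set cs" using nth_mem[OF il] by simp
    then have "1 - r * sort cs ! (i - 1) \<noteq> 0" by (rule ne)
    then show ?thesis unfolding kap eig sm using il by simp
  qed
  moreover have "\<delta> (a + t *\<^sub>R \<eta>) = t" by (rule ray_contract[OF a r]) (use t in auto)
  ultimately show ?thesis using a t(1,3) L E nz unfolding ms_def[symmetric] by blast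
qed

lemma eigenbasis_surj:
  assumes E: "eigenbasis L (tang \<eta>) es ms" and L: "linear L" and m: "\<And>m. m \<in> set ms \<Longrightarrow> 1 - s * m \<noteq> 0"
    and w: "w \<in> tang \<eta>"
  shows "\<exists>v\<in>tang \<eta>. v - s *\<^sub>R L v = w"
proof -
  have sub: "subspace (tang \<eta>)" by (rule subspace_hyperplane)
  let ?n = "length es"
  have e: "length ms = ?n" "set es \<subseteq> tang \<eta>" "tang \<eta> \<subseteq> span (set es)" "\<And>i. i < ?n \<Longrightarrow> L (es ! i) = ms ! i *\<^sub>R es ! i"
    using E unfolding eigenbasis_def by auto
  obtain c where c: "w = (\<Sum>k<?n. c k *\<^sub>R es ! k)" using span_list_sum[of w es] e(3) w by blast
  define v where "v = (\<Sum>k<?n. (c k / (1 - s * ms ! k)) *\<^sub>R es ! k)"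
  have "v \<in> tang \<eta>" unfolding v_def
    by (intro subspace_sum[OF sub] subspace_scale[OF sub] subsetD[OF e(2)] nth_mem) auto
  moreover have "v - s *\<^sub>R L v = (\<Sum>k<?n. (c k / (1 - s * ms ! k)) *\<^sub>R (es ! k - s *\<^sub>R L (es ! k)))"
    by (simp add: v_def linear_sum[OF L] linear_cmul[OF L] scaleR_sum_right sum_subtractf[symmetric] scaleR_diff_right mult.commute)
  moreover have "\<dots> = w" unfolding c
  proof (rule sum.cong[OF refl])
    fix k assume "k \<in> {..<?n}"
    then have k: "k < ?n" by simp
    have "es ! k - s *\<^sub>R L (es ! k) = (1 - s * ms ! k) *\<^sub>R es ! k" using e(4)[OF k] by (simp add: scaleR_diff_left)
    then show "(c k / (1 - s * ms ! k)) *\<^sub>R (es ! k - s *\<^sub>R L (es ! k)) = c k *\<^sub>R es ! k"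
      using m[of "ms ! k"] k e(1) by simp
  qed
  ultimately show ?thesis by metis
qed

text \<open>Translates the Euclidean normal of the theorem into \<open>J\<close>: since
  \<open>J \<eta>\<close> is a positive multiple of u, orthogonality to u is tangency at
  \<eta>.\<close>

lemma grad_eq_imp_J:
  assumes "norm u = 1" "grad \<phi> u = \<eta>"
  shows "ps \<eta> = 1" "J \<eta> = (1 / \<phi> u) *\<^sub>R u" "0 < \<phi> u"
proof -
  have u0: "u \<noteq> 0" using assms(1) by auto
  then show k: "0 < \<phi> u" by (rule phi_pos)
  have "grad \<phi> u = dphi u" unfolding grad_def
  proof (rule the_equality)
    show "(\<phi> has_derivative (\<bullet>) (dphi u)) (at u)" by (rule has_derivative_phi[OF u0])
    fix g assume "(\<phi> has_derivative (\<bullet>) g) (at u)"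
    then have "(\<bullet>) g = (\<bullet>) (dphi u)" using has_derivative_unique has_derivative_phi[OF u0] by blast
    then show "g = dphi u" by (metis vector_eq_rdot inner_commute)
  qed
  then have d: "dp (\<phi> u *\<^sub>R \<eta>) u" using dp_dphi[OF u0] assms(2) by simp
  then show "ps \<eta> = 1" using u0 by (simp add: dp_def ps_scale)
  have "dp \<eta> ((1 / \<phi> u) *\<^sub>R u)" using dp_scale[OF d, of "1 / \<phi> u"] u0 by simp
  then show "J \<eta> = (1 / \<phi> u) *\<^sub>R u" by (rule J_eq)
qed

lemma Ntilde_n_graph:
  assumes N: "(a, \<eta>) \<in> Ntilde_n \<phi> A" and n: "norm n = 1" "J \<eta> \<bullet> n \<noteq> 0"
  shows "\<exists>\<epsilon>>0. \<exists>f :: 'a \<Rightarrow> real. f differentiable (at a within U_disk \<epsilon> a n) \<and>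
    (\<forall>b\<in>U_disk \<epsilon> a n. b + f b *\<^sub>R n \<in> frontier A)"
proof -
  obtain s L es ms where a: "a \<in> A" "ps \<eta> = 1" and s: "0 < s" "s < d0" "\<delta> (a + s *\<^sub>R \<eta>) = s"
    and L: "nu_diff_with \<phi> A (a + s *\<^sub>R \<eta>) L" and E: "eigenbasis L (tang \<eta>) es ms"
    and mb: "\<forall>m\<in>set ms. 1 - s * m \<noteq> 0"
    and kap: "\<forall>i\<in>{1..DIM('a) - 1}. kappa_phi \<phi> A a \<eta> i = ereal (sort (map (\<lambda>m. m / (1 - s * m)) ms) ! (i - 1))"
    using Ntilde_n_data[OF N] by blast
  have m: "\<And>m. m \<in> set ms \<Longrightarrow> 1 - s * m \<noteq> 0" using mb by blast
  obtain \<epsilon> Y D where e: "0 < \<epsilon>" and Y: "Y a = a + s *\<^sub>R \<eta>" "(Y has_derivative D) (at a)"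
    and YU: "\<forall>b\<in>U_disk \<epsilon> a n. Y b \<notin> A \<and> proj (Y b) = b + ((proj (Y b) - a) \<bullet> n) *\<^sub>R n"
    using graph_parametrization[OF a s L eigenbasis_surj[OF E L_linear[OF a s L] m] n] by blast
  define f where "f = (\<lambda>b. (proj (Y b) - a) \<bullet> n)"
  have "((\<lambda>b. proj (Y b)) has_derivative (\<lambda>h. D h - (s *\<^sub>R L (D h) + (J \<eta> \<bullet> D h) *\<^sub>R \<eta>))) (at a)"
    by (rule has_derivative_compose[where g = proj, OF Y(2)]) (use proj_deriv[OF a s L] Y(1) in simp)
  then have "((\<lambda>b. proj (Y b) - a) has_derivative (\<lambda>h. D h - (s *\<^sub>R L (D h) + (J \<eta> \<bullet> D h) *\<^sub>R \<eta>) - 0)) (at a)"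
    by (intro has_derivative_diff has_derivative_const)
  then have "f differentiable (at a)"
    unfolding f_def differentiable_def by (intro exI) (rule has_derivative_inner_left)
  then have "f differentiable (at a within U_disk \<epsilon> a n)" by (rule differentiable_at_withinI)
  moreover have "b + f b *\<^sub>R n \<in> frontier A" if "b \<in> U_disk \<epsilon> a n" for b
    using xi_frontier[OF proj_in_xi, of "Y b"] YU that by (simp add: f_def)
  ultimately show ?thesis using e by blast
qed

lemma tang_eq:
  assumes "J \<eta> = k *\<^sub>R u" "k \<noteq> 0" shows "tang \<eta> = {w. w \<bullet> u = 0}"
  using assms by (auto simp: inner_commute)

text \<open>The field is \<open>nuf\<close> after Y. On the tangent space D inverts I - s L, because
  tangent vectors have no component along n = u; so the derivative is L (I - s L)^(-1), with
  eigenvalues m / (1 - s m).\<close>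

lemma Ntilde_n_normal_field:
  assumes N: "(a, \<eta>) \<in> Ntilde_n \<phi> A" and u: "norm u = 1" "grad \<phi> u = \<eta>"
  shows "\<exists>\<epsilon>>0. \<exists>f :: 'a \<Rightarrow> real. f differentiable (at a within U_disk \<epsilon> a u) \<and>
                   (\<forall>b\<in>U_disk \<epsilon> a u. b + f b *\<^sub>R u \<in> frontier A) \<and>
               (\<exists>\<eta>t :: 'a \<Rightarrow> 'a. \<exists>L :: 'a \<Rightarrow> 'a. \<exists>lams :: real list.
                   (\<forall>b\<in>U_disk \<epsilon> a u. \<eta>t b \<in> frontier (Wphi \<phi>) \<and>
                                        \<eta>t b \<in> Nphi_at \<phi> A (b + f b *\<^sub>R u)) \<and>
                   \<eta>t a = \<eta> \<and>
                   (\<eta>t has_derivative L) (at a within U_disk \<epsilon> a u) \<and>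
                   (\<forall>v\<in>{w. w \<bullet> u = 0}. L v \<in> {w. w \<bullet> u = 0}) \<and>
                   ordered_eigs L ({w. w \<bullet> u = 0}) lams \<and>
                   (\<forall>i\<in>{1..DIM('a) - 1}. ereal (lams ! (i - 1)) = kappa_phi \<phi> A a \<eta> i))"
proof -
  note Ju = grad_eq_imp_J[OF u]
  have V: "tang \<eta> = {w. w \<bullet> u = 0}" by (rule tang_eq[OF Ju(2)]) (use Ju(3) in auto)
  have Jn: "J \<eta> \<bullet> u \<noteq> 0" unfolding Ju(2) using Ju(3) u(1) by (auto simp: dot_square_norm)
  obtain s L es ms where a: "a \<in> A" "ps \<eta> = 1" and s: "0 < s" "s < d0" "\<delta> (a + s *\<^sub>R \<eta>) = s"
    and L: "nu_diff_with \<phi> A (a + s *\<^sub>R \<eta>) L" and E: "eigenbasis L (tang \<eta>) es ms"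
    and mb: "\<forall>m\<in>set ms. 1 - s * m \<noteq> 0"
    and kap: "\<forall>i\<in>{1..DIM('a) - 1}. kappa_phi \<phi> A a \<eta> i = ereal (sort (map (\<lambda>m. m / (1 - s * m)) ms) ! (i - 1))"
    using Ntilde_n_data[OF N] by blast
  have m: "\<And>m. m \<in> set ms \<Longrightarrow> 1 - s * m \<noteq> 0" using mb by blast
  have lL: "linear L" by (rule L_linear[OF a s L])
  obtain \<epsilon> Y D where e: "0 < \<epsilon>" and Y: "Y a = a + s *\<^sub>R \<eta>" "(Y has_derivative D) (at a)"
    and YU: "\<forall>b\<in>U_disk \<epsilon> a u. Y b \<notin> A \<and> proj (Y b) = b + ((proj (Y b) - a) \<bullet> u) *\<^sub>R u"
    and DU: "\<forall>v\<in>tang \<eta>. D ((v - s *\<^sub>R L v) - ((v - s *\<^sub>R L v) \<bullet> u) *\<^sub>R u) = v"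
    using graph_parametrization[OF a s L eigenbasis_surj[OF E lL m] u(1) Jn] by blast
  have YA: "Y b \<notin> A" if "b \<in> U_disk \<epsilon> a u" for b using YU that by blast
  have DV: "D ((v - s *\<^sub>R L v) - ((v - s *\<^sub>R L v) \<bullet> u) *\<^sub>R u) = v" if "v \<in> tang \<eta>" for v
    using DU that by blast
  define f where "f = (\<lambda>b. (proj (Y b) - a) \<bullet> u)"
  have "((\<lambda>b. proj (Y b)) has_derivative (\<lambda>h. D h - (s *\<^sub>R L (D h) + (J \<eta> \<bullet> D h) *\<^sub>R \<eta>))) (at a)"
    by (rule has_derivative_compose[where g = proj, OF Y(2)]) (use proj_deriv[OF a s L] Y(1) in simp)
  then have "((\<lambda>b. proj (Y b) - a) has_derivative (\<lambda>h. D h - (s *\<^sub>R L (D h) + (J \<eta> \<bullet> D h) *\<^sub>R \<eta>) - 0)) (at a)"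
    by (intro has_derivative_diff has_derivative_const)
  then have "f differentiable (at a)"
    unfolding f_def differentiable_def by (intro exI) (rule has_derivative_inner_left)
  then have fd: "f differentiable (at a within U_disk \<epsilon> a u)" by (rule differentiable_at_withinI)
  have fp: "b + f b *\<^sub>R u = proj (Y b)" if "b \<in> U_disk \<epsilon> a u" for b
    using YU that by (simp add: f_def)
  define L2 where "L2 = (\<lambda>h. L (D h))"
  have dn: "((\<lambda>b. nuf (Y b)) has_derivative L2) (at a)" unfolding L2_def
    by (rule has_derivative_compose[where g = nuf, OF Y(2)]) (use nuf_deriv[OF a s L] Y(1) in simp)
  have lL2: "linear L2" using dn by (rule has_derivative_linear)
  have L2V: "L2 v \<in> tang \<eta>" for v using L_tangent[OF a s L] by (simp add: L2_def)
  have sub: "subspace (tang \<eta>)" by (rule subspace_hyperplane)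
  have E2: "eigenbasis L2 (tang \<eta>) es (map (\<lambda>m. m / (1 - s * m)) ms)"
  proof -
    have "L2 (es ! i) = (ms ! i / (1 - s * ms ! i)) *\<^sub>R es ! i" if i: "i < dim (tang \<eta>)" for i
    proof -
      let ?e = "es ! i" and ?m = "ms ! i"
      have es: "?e \<in> tang \<eta>" "L ?e = ?m *\<^sub>R ?e" "1 - s * ?m \<noteq> 0"
        using E i m[of ?m] nth_mem[of i es] nth_mem[of i ms] by (auto simp: eigenbasis_def simp del: nth_mem)
      \<comment> \<open>The preimage of the eigenvector under I - s L.\<close>
      define v where "v = (1 / (1 - s * ?m)) *\<^sub>R ?e"
      have v: "v \<in> tang \<eta>" unfolding v_def by (rule subspace_scale[OF sub es(1)])
      have Lv: "L v = (?m / (1 - s * ?m)) *\<^sub>R ?e" unfolding v_def linear_cmul[OF lL] es(2) by simp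
      have "v - s *\<^sub>R L v = ((1 / (1 - s * ?m)) - s * (?m / (1 - s * ?m))) *\<^sub>R ?e"
        unfolding Lv unfolding v_def by (simp add: scaleR_diff_left)
      also have "(1 / (1 - s * ?m)) - s * (?m / (1 - s * ?m)) = 1"
        using es(3) by (simp add: diff_divide_distrib[symmetric])
      finally have ve: "v - s *\<^sub>R L v = ?e" by simp
      moreover have "?e \<bullet> u = 0" using es(1) unfolding V by simp
      ultimately have "D ?e = v" using DV[OF v] by simp
      then show ?thesis using Lv by (simp add: L2_def)
    qed
    then show ?thesis using E by (simp add: eigenbasis_def)
  qed
  define lams where "lams = sort (map (\<lambda>m. m / (1 - s * m)) ms)"
  have oe: "ordered_eigs L2 (tang \<eta>) lams"
    using ordered_eigs_eigenbasis[OF sub lL2 E2] by (simp add: lams_def)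
  have ya: "nuf (Y a) = \<eta>" unfolding Y(1) by (rule nuf_eq[OF a s L])
  have fr: "\<forall>b\<in>U_disk \<epsilon> a u. b + f b *\<^sub>R u \<in> frontier A"
    using xi_frontier[OF proj_in_xi YA] fp by simp
  have nf: "\<forall>b\<in>U_disk \<epsilon> a u. nuf (Y b) \<in> frontier (Wphi \<phi>) \<and> nuf (Y b) \<in> Nphi_at \<phi> A (b + f b *\<^sub>R u)"
    using nuf_Nphi[OF YA] fp by simp
  show ?thesis
    using e fd fr nf ya has_derivative_at_withinI[OF dn] L2V oe kap
    unfolding V lams_def[symmetric]
    by (intro exI[of _ \<epsilon>] exI[of _ f] exI[of _ "\<lambda>b. nuf (Y b)"] exI[of _ L2] exI[of _ lams] conjI) auto
qed

end

section \<open>Uniqueness of the finite curvature type\<close>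

lemma tendsto_difference_quotient:
  fixes g :: "real \<Rightarrow> 'b::real_normed_vector"
  assumes "(g has_derivative D) (at 0)" "g 0 = 0"
  shows "((\<lambda>t. (1 / t) *\<^sub>R g t) \<longlongrightarrow> D 1) (at_right 0)"
proof -
  have lin: "linear D" using assms(1) by (rule has_derivative_linear)
  have "((\<lambda>t. norm (g t - D t) / norm t) \<longlongrightarrow> 0) (at 0)"
    using assms unfolding has_derivative_at by simp
  then have "((\<lambda>t. norm (g t - D t) / norm t) \<longlongrightarrow> 0) (at_right 0)"
    by (rule filterlim_mono) (auto simp: at_le)
  moreover have "\<forall>\<^sub>F t in at_right 0. norm (g t - D t) / norm t = norm ((1 / t) *\<^sub>R g t - D 1)"
    unfolding eventually_at_right_field
  proof (intro exI[of _ 1] conjI allI impI)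
    fix t :: real assume t: "0 < t" 
    have "D t = t *\<^sub>R D 1" using linear_cmul[OF lin, of t 1] by simp
    then have "(1 / t) *\<^sub>R g t - D 1 = (1 / t) *\<^sub>R (g t - D t)" using t by (simp add: scaleR_diff_right)
    then show "norm (g t - D t) / norm t = norm ((1 / t) *\<^sub>R g t - D 1)" using t by simp
  qed simp
  ultimately have "((\<lambda>t. norm ((1 / t) *\<^sub>R g t - D 1)) \<longlongrightarrow> 0) (at_right 0)"
    by (rule Lim_transform_eventually)
  then show ?thesis by (metis Lim_null tendsto_norm_zero_cancel)
qed

context reach_set
begin

text \<open>The length r cancels by homogeneity of \<open>J\<close>, so the constant does not depend
  on how long the ray realises the distance.\<close>

lemma normal_ray_ineq:
  assumes "(a, \<eta>) \<in> Nphi \<phi> A" "c \<in> A"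
  shows "J \<eta> \<bullet> (c - a) \<le> norm (J \<eta>) / (2 * rho) * (norm (c - a))\<^sup>2"
proof -
  obtain r where a: "a \<in> A" "ps \<eta> = 1" and r: "0 < r" "\<delta> (a + r *\<^sub>R \<eta>) = r"
    using assms(1) unfolding Nphi_iff by blast
  have "J (a + r *\<^sub>R \<eta> - a) \<bullet> (c - a) \<le> norm (J (a + r *\<^sub>R \<eta> - a)) * ((norm (c - a))\<^sup>2 / (2 * rho))"
    by (rule J_normal_ineq[OF ray_point(1)[OF a r] assms(2)])
  then have "r * (J \<eta> \<bullet> (c - a)) \<le> r * (norm (J \<eta>) * ((norm (c - a))\<^sup>2 / (2 * rho)))"
    using r(1) by (simp add: J_scale mult.assoc)
  then have "J \<eta> \<bullet> (c - a) \<le> norm (J \<eta>) * ((norm (c - a))\<^sup>2 / (2 * rho))"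
    using r(1) by (simp only: mult_le_cancel_left_pos)
  then show ?thesis by simp
qed

text \<open>The graph over the line through a in direction v, with n along \<open>J \<eta>\<close>.
  That its tangential part is exactly \<tau> v is what \<open>opposite_normal_finite\<close>
  exploits.\<close>

lemma Ntilde_n_curve:
  assumes N: "(a, \<eta>) \<in> Ntilde_n \<phi> A" and v: "v \<in> tang \<eta>"
  shows "\<exists>e>0. \<exists>\<gamma> D. (\<gamma> has_derivative D) (at (0::real)) \<and> D 1 = v \<and> \<gamma> 0 = 0 \<and>
    (\<forall>\<tau>. \<bar>\<tau>\<bar> < e \<longrightarrow> a + \<gamma> \<tau> \<in> A \<and> (\<exists>k. \<gamma> \<tau> = \<tau> *\<^sub>R v + k *\<^sub>R J \<eta>))"
proof -
  obtain s L es ms where a: "a \<in> A" "ps \<eta> = 1" and s: "0 < s" "s < d0" "\<delta> (a + s *\<^sub>R \<eta>) = s"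
    and L: "nu_diff_with \<phi> A (a + s *\<^sub>R \<eta>) L" and E: "eigenbasis L (tang \<eta>) es ms"
    and mb: "\<forall>m\<in>set ms. 1 - s * m \<noteq> 0"
    using Ntilde_n_data[OF N] by blast
  have m: "\<And>m. m \<in> set ms \<Longrightarrow> 1 - s * m \<noteq> 0" using mb by blast
  have lL: "linear L" by (rule L_linear[OF a s L])
  define n where "n = (1 / norm (J \<eta>)) *\<^sub>R J \<eta>"
  have J0: "J \<eta> \<noteq> 0" using a(2) by auto
  have n: "norm n = 1" "J \<eta> \<bullet> n \<noteq> 0" using J0 by (auto simp: n_def)
  have tn: "w \<bullet> n = 0" if "w \<in> tang \<eta>" for w using that by (simp add: n_def inner_commute)
  obtain \<epsilon> Y D where e: "0 < \<epsilon>" and Y: "Y a = a + s *\<^sub>R \<eta>" "(Y has_derivative D) (at a)"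
    and YU: "\<forall>b\<in>U_disk \<epsilon> a n. Y b \<notin> A \<and> proj (Y b) = b + ((proj (Y b) - a) \<bullet> n) *\<^sub>R n"
    and DU: "\<forall>v\<in>tang \<eta>. D ((v - s *\<^sub>R L v) - ((v - s *\<^sub>R L v) \<bullet> n) *\<^sub>R n) = v"
    using graph_parametrization[OF a s L eigenbasis_surj[OF E lL m] n] by blast
  obtain w where w: "w \<in> tang \<eta>" "w - s *\<^sub>R L w = v" using eigenbasis_surj[OF E lL m v] by blast
  have Dv: "D v = w"
  proof -
    have "D ((w - s *\<^sub>R L w) - ((w - s *\<^sub>R L w) \<bullet> n) *\<^sub>R n) = w" using DU w(1) by blast
    then show ?thesis unfolding w(2) using tn[OF v] by simp
  qed
  define \<gamma> where "\<gamma> = (\<lambda>\<tau>. proj (Y (a + \<tau> *\<^sub>R v)) - a)"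
  define G where "G = (\<lambda>h. D h - (s *\<^sub>R L (D h) + (J \<eta> \<bullet> D h) *\<^sub>R \<eta>))"
  have "((\<lambda>b. proj (Y b)) has_derivative G) (at a)" unfolding G_def
    by (rule has_derivative_compose[where g = proj, OF Y(2)]) (use proj_deriv[OF a s L] Y(1) in simp)
  then have "((\<lambda>\<tau>. proj (Y (a + \<tau> *\<^sub>R v))) has_derivative (\<lambda>\<tau>. G (\<tau> *\<^sub>R v))) (at 0)"
    by (intro has_derivative_compose[where g = "\<lambda>b. proj (Y b)" and f = "\<lambda>\<tau>. a + \<tau> *\<^sub>R v"])
      (auto intro!: derivative_eq_intros)
  then have "(\<gamma> has_derivative (\<lambda>\<tau>. G (\<tau> *\<^sub>R v) - 0)) (at 0)"
    unfolding \<gamma>_def by (intro has_derivative_diff has_derivative_const)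
  then have d: "(\<gamma> has_derivative (\<lambda>\<tau>. G (\<tau> *\<^sub>R v))) (at 0)" by simp
  have G1: "G (1 *\<^sub>R v) = v" using Dv w by (simp add: G_def)
  have px: "proj (Y a) = a" unfolding Y(1)
    by (rule xi_unique[OF _ proj_in_xi ray_point(1)[OF a s(1) s(3)]]) (use s in simp)
  have g0: "\<gamma> 0 = 0" using px by (simp add: \<gamma>_def)
  have "a + \<gamma> \<tau> \<in> A \<and> (\<exists>k. \<gamma> \<tau> = \<tau> *\<^sub>R v + k *\<^sub>R J \<eta>)" if \<tau>: "\<bar>\<tau>\<bar> < \<epsilon> / (norm v + 1)" for \<tau>
  proof -
    have "norm (\<tau> *\<^sub>R v) \<le> \<bar>\<tau>\<bar> * (norm v + 1)" by (simp add: mult_left_mono)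
    also have "\<dots> < \<epsilon>" using \<tau> by (simp add: pos_less_divide_eq add_nonneg_pos)
    finally have b: "a + \<tau> *\<^sub>R v \<in> U_disk \<epsilon> a n" using tn[OF v] by (simp add: U_disk_def)
    have "proj (Y (a + \<tau> *\<^sub>R v)) \<in> A" using xi_D(1)[OF proj_in_xi] .
    moreover have "\<gamma> \<tau> = \<tau> *\<^sub>R v + (\<gamma> \<tau> \<bullet> n / norm (J \<eta>)) *\<^sub>R J \<eta>"
    proof -
      have "proj (Y (a + \<tau> *\<^sub>R v)) = a + \<tau> *\<^sub>R v + (\<gamma> \<tau> \<bullet> n) *\<^sub>R n"
        using YU b unfolding \<gamma>_def by blast
      moreover have "X = a + \<tau> *\<^sub>R v + q \<Longrightarrow> X - a = \<tau> *\<^sub>R v + q" for X q by simp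
      ultimately have "\<gamma> \<tau> = \<tau> *\<^sub>R v + (\<gamma> \<tau> \<bullet> n) *\<^sub>R n" unfolding \<gamma>_def by blast
      also have "(\<gamma> \<tau> \<bullet> n) *\<^sub>R n = (\<gamma> \<tau> \<bullet> n / norm (J \<eta>)) *\<^sub>R J \<eta>" by (simp add: n_def)
      finally show ?thesis .
    qed
    ultimately show ?thesis unfolding \<gamma>_def by auto
  qed
  moreover have "0 < \<epsilon> / (norm v + 1)" using e by (simp add: add_nonneg_pos)
  ultimately show ?thesis using d G1 g0 by blast
qed

text \<open>Curves in A tangent to every v and -v make \<open>J \<eta>'\<close> orthogonal to the
  tangent space, hence a multiple of \<open>J \<eta>\<close>. Both have \<open>\<phi>\<close>-norm
  1, and \<open>J\<close> is odd and injective.\<close>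

lemma other_normal:
  assumes N: "(a, \<eta>) \<in> Ntilde_n \<phi> A" and N': "(a, \<eta>') \<in> Nphi \<phi> A"
  shows "\<eta>' = \<eta> \<or> \<eta>' = - \<eta>"
proof -
  have \<eta>: "ps \<eta> = 1" "ps \<eta>' = 1" using N N' by (auto simp: Ntilde_n_def Ntilde_def Nphi_iff)
  define C where "C = norm (J \<eta>') / (2 * rho)"
  have neg: "J \<eta>' \<bullet> v \<le> 0" if v: "v \<in> tang \<eta>" for v
  proof -
    obtain e \<gamma> D where e: "0 < e" and g: "(\<gamma> has_derivative D) (at (0::real))" "D 1 = v" "\<gamma> 0 = 0"
      and gA: "\<forall>\<tau>. \<bar>\<tau>\<bar> < e \<longrightarrow> a + \<gamma> \<tau> \<in> A"
      using Ntilde_n_curve[OF N v] by blast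
    have lim: "((\<lambda>\<tau>. (1 / \<tau>) *\<^sub>R \<gamma> \<tau>) \<longlongrightarrow> v) (at_right 0)"
      using tendsto_difference_quotient[OF g(1,3)] g(2) by simp
    have t0: "((\<lambda>\<tau>::real. \<tau>) \<longlongrightarrow> 0) (at_right 0)" by (rule tendsto_ident_at)
    \<comment> \<open>Divide \<open>normal_ray_ineq\<close> along the curve by \<tau>; the quadratic
      right side disappears in the limit.\<close>
    have "J \<eta>' \<bullet> v \<le> C * (0 * (norm v)\<^sup>2)"
    proof (rule tendsto_le[OF trivial_limit_at_right_real])
      show "((\<lambda>\<tau>. C * (\<tau> * (norm ((1 / \<tau>) *\<^sub>R \<gamma> \<tau>))\<^sup>2)) \<longlongrightarrow> C * (0 * (norm v)\<^sup>2)) (at_right 0)"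
        by (intro tendsto_intros lim t0)
      show "((\<lambda>\<tau>. J \<eta>' \<bullet> ((1 / \<tau>) *\<^sub>R \<gamma> \<tau>)) \<longlongrightarrow> J \<eta>' \<bullet> v) (at_right 0)"
        by (intro tendsto_intros lim)
      show "\<forall>\<^sub>F \<tau> in at_right 0. J \<eta>' \<bullet> ((1 / \<tau>) *\<^sub>R \<gamma> \<tau>) \<le> C * (\<tau> * (norm ((1 / \<tau>) *\<^sub>R \<gamma> \<tau>))\<^sup>2)"
        unfolding eventually_at_right_field
      proof (intro exI[of _ e] conjI allI impI e)
        fix \<tau> :: real assume t: "0 < \<tau>" "\<tau> < e"
        have "a + \<gamma> \<tau> \<in> A" using gA t by simp
        then have "J \<eta>' \<bullet> \<gamma> \<tau> \<le> C * (norm (\<gamma> \<tau>))\<^sup>2"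
          using normal_ray_ineq[OF N', of "a + \<gamma> \<tau>"] by (simp add: C_def)
        then have "(1 / \<tau>) * (J \<eta>' \<bullet> \<gamma> \<tau>) \<le> (1 / \<tau>) * (C * (norm (\<gamma> \<tau>))\<^sup>2)"
          using t by (intro mult_left_mono) auto
        then show "J \<eta>' \<bullet> ((1 / \<tau>) *\<^sub>R \<gamma> \<tau>) \<le> C * (\<tau> * (norm ((1 / \<tau>) *\<^sub>R \<gamma> \<tau>))\<^sup>2)"
          using t by (simp add: power_mult_distrib power_divide power2_eq_square)
      qed
    qed
    then show ?thesis by simp
  qed
  have zero: "J \<eta>' \<bullet> v = 0" if "v \<in> tang \<eta>" for v
    using neg[of v] neg[of "- v"] that by simp
  have Jp: "0 < J \<eta> \<bullet> J \<eta>" using \<eta>(1) by auto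
  define k where "k = (J \<eta> \<bullet> J \<eta>') / (J \<eta> \<bullet> J \<eta>)"
  define w where "w = J \<eta>' - k *\<^sub>R J \<eta>"
  have wt: "J \<eta> \<bullet> w = 0" using Jp by (simp add: w_def k_def inner_diff_right)
  then have "J \<eta>' \<bullet> w = 0" by (intro zero) simp
  then have "w \<bullet> w = 0" using wt by (simp add: w_def inner_diff_left)
  then have Jk: "J \<eta>' = k *\<^sub>R J \<eta>" by (simp add: w_def)
  then have "\<phi> (J \<eta>') = \<bar>k\<bar> * \<phi> (J \<eta>)" by (simp add: phi_scale)
  then have "\<bar>k\<bar> = 1" using \<eta> by (simp add: phi_J)
  then have "k = 1 \<or> k = - 1" by linarith
  then show ?thesis
  proof
    assume "k = 1"
    then show ?thesis using Jk J_inj by simp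
  next
    assume "k = - 1"
    then have "J \<eta>' = J (- \<eta>)" using Jk by (simp add: J_minus)
    then show ?thesis using J_inj by blast
  qed
qed

text \<open>An infinite curvature at the opposite normal gives a tangent direction e in which the projection
  is stationary, so A stays below a quadratic with coefficient of order 1/t there, for arbitrarily small t;
  but A contains a curve tangent to e.\<close>
lemma opposite_normal_finite:
  assumes N: "(a, \<eta>) \<in> Ntilde_n \<phi> A" and N': "(a, - \<eta>) \<in> Ntilde \<phi> A"
  shows "(a, - \<eta>) \<in> Ntilde_n \<phi> A"
proof (rule ccontr)
  assume "(a, - \<eta>) \<notin> Ntilde_n \<phi> A"
  then obtain i where i: "i \<in> {1..DIM('a) - 1}" "kappa_phi \<phi> A a (- \<eta>) i = \<infinity>"
    using N' by (auto simp: Ntilde_n_def)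
  obtain r L0 where a: "a \<in> A" "ps (- \<eta>) = 1" and r: "0 < r" "\<delta> (a + r *\<^sub>R - \<eta>) = r"
    and L0: "nu_diff_with \<phi> A (a + r *\<^sub>R - \<eta>) L0"
    and kap: "\<And>i. kappa_phi \<phi> A a (- \<eta>) i = (if 1 - r * eig L0 (tang (- \<eta>)) i = 0 then \<infinity> else ereal (eig L0 (tang (- \<eta>)) i / (1 - r * eig L0 (tang (- \<eta>)) i)))"
    using kappa_char[OF N'] by blast
  have NN: "(a, \<eta>) \<in> Nphi \<phi> A" "(a, - \<eta>) \<in> Nphi \<phi> A"
    using N N' by (auto simp: Ntilde_n_def Ntilde_def)
  define p where "p = J \<eta>"
  have p0: "p \<noteq> 0" using a(2) by (auto simp: p_def)
  define C where "C = norm p / (2 * rho)"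
  have C: "0 \<le> C" using rho_pos by (simp add: C_def)
  \<comment> \<open>With both \<eta> and its negative as normals, the normal component of A is
    bounded from both sides.\<close>
  have up: "\<bar>p \<bullet> d\<bar> \<le> C * (norm d)\<^sup>2" if "a + d \<in> A" for d
    using normal_ray_ineq[OF NN(1) that] normal_ray_ineq[OF NN(2) that]
    by (simp add: p_def C_def J_minus)
  have V: "tang (- \<eta>) = tang \<eta>" by (simp add: J_minus)
  \<comment> \<open>Small enough for t C < 1 / (2 Lam), which contradicts the limit inequality at
    the end.\<close>
  define t where "t = min (min r d0) (1 / (2 * Lam * (C + 1))) / 2"
  define q where "q = 1 / (2 * Lam * (C + 1))"
  have "0 < q" using Lam_pos C by (simp add: q_def)
  then have "0 < min (min r d0) q" using r d0_pos by simp
  moreover have "min (min r d0) q \<le> r" "min (min r d0) q \<le> d0" "min (min r d0) q \<le> q" by auto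
  moreover have "t = min (min r d0) q / 2" by (simp add: t_def q_def)
  ultimately have t: "0 < t" "t < r" "t < d0" "t < 1 / (2 * Lam * (C + 1))"
    unfolding q_def[symmetric] by linarith+
  have tC: "t * C < 1 / (2 * Lam)"
  proof -
    have "t * C \<le> t * (C + 1)" using t by simp
    also have "\<dots> < 1 / (2 * Lam * (C + 1)) * (C + 1)" using t(4) C by (intro mult_strict_right_mono) auto
    also have "\<dots> = 1 / (2 * Lam)" using C by simp
    finally show ?thesis .
  qed
  obtain L es cs where L: "nu_diff_with \<phi> A (a + t *\<^sub>R - \<eta>) L" and E0: "eigenbasis L0 (tang (- \<eta>)) es cs"
    and E: "eigenbasis L (tang (- \<eta>)) es (map (\<lambda>c. c / (1 - (r - t) * c)) cs)"
    by (rule eigendata[OF a r(2) L0 t(1,2,3)])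
  have dt: "\<delta> (a + t *\<^sub>R - \<eta>) = t" by (rule ray_contract[OF a r]) (use t in auto)
  have sub: "subspace (tang (- \<eta>))" by (rule subspace_hyperplane)
  have lL0: "linear L0" by (rule nu_diff_D(2)[OF L0 ray_point(3)[OF a r]])
  have lc: "length cs = DIM('a) - 1" using E0 dim_tang[OF a(2)] by (simp add: eigenbasis_def)
  \<comment> \<open>An infinite curvature is an eigenvalue 1 / r at length r, hence 1 / t at length
    t, so the derivative of the projection annihilates e.\<close>
  have "1 - r * sort cs ! (i - 1) = 0"
    using i(2) kap[of i] eig_eigenbasis[OF sub lL0 E0, of i] by (auto split: if_splits)
  moreover have "sort cs ! (i - 1) \<in> set cs"
  proof -
    have "i - 1 < length (sort cs)" using i(1) lc by auto
    then show ?thesis using nth_mem[of "i - 1" "sort cs"] by simp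
  qed
  ultimately obtain j where j: "j < length cs" "1 - r * cs ! j = 0" by (auto simp: in_set_conv_nth)
  have cj: "cs ! j = 1 / r" using j(2) r(1) by (simp add: field_simps)
  have jd: "j < dim (tang (- \<eta>))" using j(1) E0 by (simp add: eigenbasis_def)
  define e where "e = es ! j"
  have e0: "e \<noteq> 0" unfolding e_def by (rule eigenbasis_nonzero[OF sub E0 jd])
  have eV: "e \<in> tang \<eta>"
  proof -
    have "e \<in> set es" using E0 jd by (simp add: eigenbasis_def e_def)
    moreover have "set es \<subseteq> tang (- \<eta>)" using E0 by (simp add: eigenbasis_def)
    ultimately show ?thesis unfolding V by blast
  qed
  have "L e = (cs ! j / (1 - (r - t) * cs ! j)) *\<^sub>R e"
    using E jd j(1) by (simp add: eigenbasis_def e_def)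
  also have "cs ! j / (1 - (r - t) * cs ! j) = 1 / t"
  proof -
    have "1 - (r - t) * (1 / r) = t / r" using r(1) by (simp add: diff_divide_distrib)
    then show ?thesis unfolding cj using r(1) by simp
  qed
  finally have Le: "L e = (1 / t) *\<^sub>R e" .
  define x where "x = a + t *\<^sub>R - \<eta>"
  define d where "d = (\<lambda>\<tau>. proj (x + \<tau> *\<^sub>R e) - a)"
  have px: "proj x = a" unfolding x_def
    by (rule xi_unique[OF _ proj_in_xi ray_point(1)[OF a t(1) dt]]) (use t dt in simp)
  have dd: "(d has_derivative (\<lambda>\<tau>. 0)) (at 0)"
  proof -
    define G where "G = (\<lambda>h. h - (t *\<^sub>R L h + (J (- \<eta>) \<bullet> h) *\<^sub>R - \<eta>))"
    have 1: "(proj has_derivative G) (at x)" unfolding x_def G_def by (rule proj_deriv[OF a t(1,3) dt L])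
    have "((\<lambda>\<tau>. proj (x + \<tau> *\<^sub>R e)) has_derivative (\<lambda>\<tau>. G (\<tau> *\<^sub>R e))) (at 0)"
      by (rule has_derivative_compose[where g = proj and f = "\<lambda>\<tau>. x + \<tau> *\<^sub>R e"])
        (use 1 in \<open>auto intro!: derivative_eq_intros\<close>)
    moreover have "G (\<tau> *\<^sub>R e) = 0" for \<tau>
    proof -
      have "L (\<tau> *\<^sub>R e) = \<tau> *\<^sub>R L e" by (rule linear_cmul[OF L_linear[OF a t(1,3) dt L]])
      then show ?thesis using Le t(1) eV by (simp add: G_def J_minus)
    qed
    ultimately have "((\<lambda>\<tau>. proj (x + \<tau> *\<^sub>R e)) has_derivative (\<lambda>\<tau>. 0)) (at 0)" by simp
    then have "(d has_derivative (\<lambda>\<tau>. 0 - 0)) (at 0)"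
      unfolding d_def by (intro has_derivative_diff has_derivative_const)
    then show ?thesis by simp
  qed
  have d0: "d 0 = 0" using px by (simp add: d_def)
  have limd: "((\<lambda>\<tau>. (1 / \<tau>) *\<^sub>R d \<tau>) \<longlongrightarrow> 0) (at_right 0)"
    using tendsto_difference_quotient[OF dd d0] .
  obtain \<epsilon> \<gamma> D where eps: "0 < \<epsilon>" and g: "(\<gamma> has_derivative D) (at (0::real))" "D 1 = e" "\<gamma> 0 = 0"
    and gA: "\<forall>\<tau>. \<bar>\<tau>\<bar> < \<epsilon> \<longrightarrow> a + \<gamma> \<tau> \<in> A \<and> (\<exists>k. \<gamma> \<tau> = \<tau> *\<^sub>R e + k *\<^sub>R J \<eta>)"
    using Ntilde_n_curve[OF N eV] by blast
  have limg: "((\<lambda>\<tau>. (1 / \<tau>) *\<^sub>R \<gamma> \<tau>) \<longlongrightarrow> e) (at_right 0)"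
    using tendsto_difference_quotient[OF g(1,3)] g(2) by simp
  \<comment> \<open>Compare the nearest point a + d \<tau> of z with the curve point a + \<gamma>
    \<tau>: the difference of z and the latter has no part along e, only multiples of \<eta> and p.
    The result is divided by the square of \<tau>.\<close>
  have main: "(norm (e - (1 / \<tau>) *\<^sub>R d \<tau>))\<^sup>2 / (2 * Lam) \<le>
      t * C * (norm ((1 / \<tau>) *\<^sub>R \<gamma> \<tau>))\<^sup>2 + t * C * (norm ((1 / \<tau>) *\<^sub>R d \<tau>))\<^sup>2 + (norm ((1 / \<tau>) *\<^sub>R \<gamma> \<tau> - e))\<^sup>2 / (2 * lam)"
    if \<tau>: "0 < \<tau>" "\<tau> < \<epsilon>" for \<tau>
  proof -
    have "\<bar>\<tau>\<bar> < \<epsilon>" using \<tau> by simp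
    then obtain k where b: "a + \<gamma> \<tau> \<in> A" and k: "\<gamma> \<tau> = \<tau> *\<^sub>R e + k *\<^sub>R p"
      using gA unfolding p_def by blast
    define z where "z = x + \<tau> *\<^sub>R e"
    have c: "a + d \<tau> \<in> \<xi> z" unfolding d_def z_def using proj_in_xi by simp
    have "(ps (z - (a + d \<tau>)))\<^sup>2 \<le> (ps (z - (a + \<gamma> \<tau>)))\<^sup>2"
      using delta_le[OF b, of z] xi_D(2)[OF c] delta_nonneg[of z] by (intro power_mono) auto
    moreover have "z - (a + d \<tau>) = - (t *\<^sub>R \<eta>) + (\<tau> *\<^sub>R e - d \<tau>)" by (simp add: z_def x_def)
    moreover have "z - (a + \<gamma> \<tau>) = - (t *\<^sub>R \<eta>) + - (k *\<^sub>R p)" by (simp add: z_def x_def k)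
    ultimately have i1: "(ps (- (t *\<^sub>R \<eta>) + (\<tau> *\<^sub>R e - d \<tau>)))\<^sup>2 / 2 \<le> (ps (- (t *\<^sub>R \<eta>) + - (k *\<^sub>R p)))\<^sup>2 / 2"
      by (metis divide_right_mono zero_le_numeral)
    have Jt: "J (- (t *\<^sub>R \<eta>)) = - (t *\<^sub>R p)" by (simp only: J_minus J_scale p_def)
    have pe: "p \<bullet> e = 0" using eV by (simp add: p_def)
    have i2: "(ps (- (t *\<^sub>R \<eta>)))\<^sup>2 / 2 + t * (p \<bullet> d \<tau>) + (norm (\<tau> *\<^sub>R e - d \<tau>))\<^sup>2 / (2 * Lam) \<le> (ps (- (t *\<^sub>R \<eta>) + (\<tau> *\<^sub>R e - d \<tau>)))\<^sup>2 / 2"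
      using ps_quad_lower[OF dp_J, of "- (t *\<^sub>R \<eta>)" "\<tau> *\<^sub>R e - d \<tau>"] pe unfolding Jt
      by (simp add: inner_diff_right)
    have i3: "(ps (- (t *\<^sub>R \<eta>) + - (k *\<^sub>R p)))\<^sup>2 / 2 \<le> (ps (- (t *\<^sub>R \<eta>)))\<^sup>2 / 2 + t * (p \<bullet> (k *\<^sub>R p)) + (norm (k *\<^sub>R p))\<^sup>2 / (2 * lam)"
      using ps_quad_upper[OF dp_J, of "- (t *\<^sub>R \<eta>)" "- (k *\<^sub>R p)"] unfolding Jt by (simp add: mult.left_commute)
    have "p \<bullet> (k *\<^sub>R p) = p \<bullet> \<gamma> \<tau>" using pe by (simp add: k inner_add_right)
    then have "p \<bullet> (k *\<^sub>R p) \<le> C * (norm (\<gamma> \<tau>))\<^sup>2" using up[OF b] by simp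
    then have i4: "t * (p \<bullet> (k *\<^sub>R p)) \<le> t * (C * (norm (\<gamma> \<tau>))\<^sup>2)" using t by (intro mult_left_mono) auto
    have "- (p \<bullet> d \<tau>) \<le> C * (norm (d \<tau>))\<^sup>2" using up[OF xi_D(1)[OF c]] by simp
    then have i5: "t * (- (p \<bullet> d \<tau>)) \<le> t * (C * (norm (d \<tau>))\<^sup>2)" using t by (intro mult_left_mono) auto
    have kp: "k *\<^sub>R p = \<gamma> \<tau> - \<tau> *\<^sub>R e" by (simp add: k)
    have tot: "(norm (\<tau> *\<^sub>R e - d \<tau>))\<^sup>2 / (2 * Lam) \<le> t * (C * (norm (\<gamma> \<tau>))\<^sup>2) + t * (C * (norm (d \<tau>))\<^sup>2) + (norm (\<gamma> \<tau> - \<tau> *\<^sub>R e))\<^sup>2 / (2 * lam)"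
      using i1 i2 i3 i4 i5 unfolding kp[symmetric] by linarith
    have sq: "(norm ((1 / \<tau>) *\<^sub>R y))\<^sup>2 = (1 / \<tau>\<^sup>2) * (norm y)\<^sup>2" for y :: 'a
      using \<tau> by (simp add: power_mult_distrib power_divide)
    have e1: "e - (1 / \<tau>) *\<^sub>R d \<tau> = (1 / \<tau>) *\<^sub>R (\<tau> *\<^sub>R e - d \<tau>)" "(1 / \<tau>) *\<^sub>R \<gamma> \<tau> - e = (1 / \<tau>) *\<^sub>R (\<gamma> \<tau> - \<tau> *\<^sub>R e)"
      using \<tau> by (simp_all add: scaleR_diff_right)
    have "(1 / \<tau>\<^sup>2) * ((norm (\<tau> *\<^sub>R e - d \<tau>))\<^sup>2 / (2 * Lam)) \<le> (1 / \<tau>\<^sup>2) * (t * (C * (norm (\<gamma> \<tau>))\<^sup>2) + t * (C * (norm (d \<tau>))\<^sup>2) + (norm (\<gamma> \<tau> - \<tau> *\<^sub>R e))\<^sup>2 / (2 * lam))"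
      using tot by (intro mult_left_mono) auto
    then show ?thesis unfolding e1 sq by (simp add: distrib_left mult.assoc mult.left_commute)
  qed
  \<comment> \<open>In the limit d \<tau> / \<tau> tends to 0 and \<gamma> \<tau> / \<tau> to e, so
    |e|^2 / (2 Lam) <= t C |e|^2.\<close>
  have "(norm (e - 0))\<^sup>2 / (2 * Lam) \<le> t * C * (norm e)\<^sup>2 + t * C * (norm (0::'a))\<^sup>2 + (norm (e - e))\<^sup>2 / (2 * lam)"
  proof (rule tendsto_le[OF trivial_limit_at_right_real])
    show "((\<lambda>\<tau>. t * C * (norm ((1 / \<tau>) *\<^sub>R \<gamma> \<tau>))\<^sup>2 + t * C * (norm ((1 / \<tau>) *\<^sub>R d \<tau>))\<^sup>2 + (norm ((1 / \<tau>) *\<^sub>R \<gamma> \<tau> - e))\<^sup>2 / (2 * lam))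
      \<longlongrightarrow> t * C * (norm e)\<^sup>2 + t * C * (norm (0::'a))\<^sup>2 + (norm (e - e))\<^sup>2 / (2 * lam)) (at_right 0)"
      by (intro tendsto_intros limg limd) (use lam_pos in auto)
    show "((\<lambda>\<tau>. (norm (e - (1 / \<tau>) *\<^sub>R d \<tau>))\<^sup>2 / (2 * Lam)) \<longlongrightarrow> (norm (e - 0))\<^sup>2 / (2 * Lam)) (at_right 0)"
      by (intro tendsto_intros limd) (use Lam_pos in auto)
    show "\<forall>\<^sub>F \<tau> in at_right 0. (norm (e - (1 / \<tau>) *\<^sub>R d \<tau>))\<^sup>2 / (2 * Lam) \<le>
      t * C * (norm ((1 / \<tau>) *\<^sub>R \<gamma> \<tau>))\<^sup>2 + t * C * (norm ((1 / \<tau>) *\<^sub>R d \<tau>))\<^sup>2 + (norm ((1 / \<tau>) *\<^sub>R \<gamma> \<tau> - e))\<^sup>2 / (2 * lam)"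
      unfolding eventually_at_right_field using eps main by blast
  qed
  then have "(1 / (2 * Lam)) * (norm e)\<^sup>2 \<le> t * C * (norm e)\<^sup>2" by simp
  then have "1 / (2 * Lam) \<le> t * C" using e0 by (simp only: mult_le_cancel_right) auto
  then show False using tC by linarith
qed

lemma Ntilde_n_disjoint: "fst ` Ntilde_n \<phi> A \<inter> fst ` (Ntilde \<phi> A - Ntilde_n \<phi> A) = {}"
proof -
  have False if N: "(a, \<eta>) \<in> Ntilde_n \<phi> A" and N': "(a, \<eta>') \<in> Ntilde \<phi> A" "(a, \<eta>') \<notin> Ntilde_n \<phi> A" for a \<eta> \<eta>'
  proof -
    have "(a, \<eta>') \<in> Nphi \<phi> A" using N'(1) by (simp add: Ntilde_def)
    from other_normal[OF N this] show False using N N' opposite_normal_finite[OF N] by auto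
  qed
  then show ?thesis by auto
qed

end

theorem theorem5p6:
  fixes \<phi> :: "'a::euclidean_space \<Rightarrow> real" and A :: "'a set"
  assumes "DIM('a) \<ge> 2"
    and "is_norm_fun \<phi>" and "C2_off_origin \<phi>" and "unif_convex \<phi>"
    and "closed A" and "A \<noteq> {}" and "reach A > 0"
  shows "(\<forall>a \<eta> u. (a, \<eta>) \<in> Ntilde_n \<phi> A \<and> u \<in> Nunit A a \<and> grad \<phi> u = \<eta> \<longrightarrow>
            (\<forall>\<nu>. norm \<nu> = 1 \<and> \<nu> \<bullet> u \<noteq> 0 \<longrightarrow>
               (\<exists>\<epsilon>>0. \<exists>f :: 'a \<Rightarrow> real. f differentiable (at a within U_disk \<epsilon> a \<nu>) \<and>
                   (\<forall>b\<in>U_disk \<epsilon> a \<nu>. b + f b *\<^sub>R \<nu> \<in> frontier A))) \<and>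
            (\<exists>\<epsilon>>0. \<exists>f :: 'a \<Rightarrow> real. f differentiable (at a within U_disk \<epsilon> a u) \<and>
                   (\<forall>b\<in>U_disk \<epsilon> a u. b + f b *\<^sub>R u \<in> frontier A) \<and>
               (\<exists>\<eta>t :: 'a \<Rightarrow> 'a. \<exists>L :: 'a \<Rightarrow> 'a. \<exists>lams :: real list.
                   (\<forall>b\<in>U_disk \<epsilon> a u. \<eta>t b \<in> frontier (Wphi \<phi>) \<and>
                                        \<eta>t b \<in> Nphi_at \<phi> A (b + f b *\<^sub>R u)) \<and>
                   \<eta>t a = \<eta> \<and>
                   (\<eta>t has_derivative L) (at a within U_disk \<epsilon> a u) \<and>
                   (\<forall>v\<in>{w. w \<bullet> u = 0}. L v \<in> {w. w \<bullet> u = 0}) \<and>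
                   ordered_eigs L ({w. w \<bullet> u = 0}) lams \<and>
                   (\<forall>i\<in>{1..DIM('a) - 1}. ereal (lams ! (i - 1)) = kappa_phi \<phi> A a \<eta> i))))
        \<and> fst ` Ntilde_n \<phi> A \<inter> fst ` (Ntilde \<phi> A - Ntilde_n \<phi> A) = {}"
proof -
  obtain \<rho> where "0 < \<rho>"
    "\<And>c n c'. n \<in> Nunit A c \<Longrightarrow> c' \<in> A \<Longrightarrow> n \<bullet> (c' - c) \<le> (norm (c' - c))\<^sup>2 / (2 * \<rho>)"
    using reach_normal_ineq[OF assms(5-7)] by blast
  then interpret reach_set \<phi> A \<rho>
    using assms by unfold_locales auto
  show ?thesis
  proof (intro conjI allI impI)
    fix a \<eta> u \<nu>
    assume h: "(a, \<eta>) \<in> Ntilde_n \<phi> A \<and> u \<in> Nunit A a \<and> grad \<phi> u = \<eta>" and n: "norm \<nu> = 1 \<and> \<nu> \<bullet> u \<noteq> 0"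
    have u: "norm u = 1" "grad \<phi> u = \<eta>" using h by (auto simp: Nunit_def)
    have "J \<eta> \<bullet> \<nu> \<noteq> 0" unfolding grad_eq_imp_J(2)[OF u]
      using grad_eq_imp_J(3)[OF u] n by (auto simp: inner_commute)
    then show "\<exists>\<epsilon>>0. \<exists>f :: 'a \<Rightarrow> real. f differentiable (at a within U_disk \<epsilon> a \<nu>) \<and>
      (\<forall>b\<in>U_disk \<epsilon> a \<nu>. b + f b *\<^sub>R \<nu> \<in> frontier A)"
      using Ntilde_n_graph h n by blast
  next
    fix a \<eta> u
    assume h: "(a, \<eta>) \<in> Ntilde_n \<phi> A \<and> u \<in> Nunit A a \<and> grad \<phi> u = \<eta>"
    show "\<exists>\<epsilon>>0. \<exists>f :: 'a \<Rightarrow> real. f differentiable (at a within U_disk \<epsilon> a u) \<and>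
                   (\<forall>b\<in>U_disk \<epsilon> a u. b + f b *\<^sub>R u \<in> frontier A) \<and>
               (\<exists>\<eta>t :: 'a \<Rightarrow> 'a. \<exists>L :: 'a \<Rightarrow> 'a. \<exists>lams :: real list.
                   (\<forall>b\<in>U_disk \<epsilon> a u. \<eta>t b \<in> frontier (Wphi \<phi>) \<and>
                                        \<eta>t b \<in> Nphi_at \<phi> A (b + f b *\<^sub>R u)) \<and>
                   \<eta>t a = \<eta> \<and>
                   (\<eta>t has_derivative L) (at a within U_disk \<epsilon> a u) \<and>
                   (\<forall>v\<in>{w. w \<bullet> u = 0}. L v \<in> {w. w \<bullet> u = 0}) \<and>
                   ordered_eigs L ({w. w \<bullet> u = 0}) lams \<and>
                   (\<forall>i\<in>{1..DIM('a) - 1}. ereal (lams ! (i - 1)) = kappa_phi \<phi> A a \<eta> i))"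
      by (rule Ntilde_n_normal_field) (use h in \<open>auto simp: Nunit_def\<close>)
  qed (rule Ntilde_n_disjoint)
qed

end
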